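(* Let $\mathfrak p=\mathbb{S}_{\mathcal N}\otimes\pi_{C\mathcal N}^{-1}(\mathfrak q)$ be a prime ideal of $\mathbb{S}_n$, where $\mathcal N\subseteq\{1,\dots,n\}$ and $\mathfrak q\in\mathrm{Spec}(L_{C\mathcal N})$ (every prime of $\mathbb{S}_n$ has a unique such form). Then: (1) $\mathrm{ht}(\mathfrak p)=|C\mathcal N|+\mathrm{ht}_{L_{C\mathcal N}}(\mathfrak q)$; (2) $\mathrm{cht}(\mathfrak p)=2|\mathcal N|+\mathrm{cht}_{L_{C\mathcal N}}(\mathfrak q)$; (3) $\mathrm{ht}(\mathfrak p)+\mathrm{cht}(\mathfrak p)=\mathrm{cl.Kdim}(\mathbb{S}_n)=2n$.
   Context: $K$ is a field. $\mathbb{S}_n$ is the $K$-algebra generated by $x_1,\dots,x_n,y_1,\dots,y_n$ subject to the defining relations $y_ix_i=1$ for all $i$, and $[x_i,y_j]=[x_i,x_j]=[y_i,y_j]=0$ for all $i\ne j$. For each $i$, $\mathbb{S}_1(i)$ is the subalgebra generated by $x_i,y_i$, and $\mathbb{S}_n=\mathbb{S}_1(1)\otimes\cdots\otimes\mathbb{S}_1(n)$. $F(i)=\bigoplus_{k,l\in\mathbb N}K(x_i^ky_i^l-x_i^{k+1}y_i^{l+1})$, an ideal of $\mathbb{S}_1(i)$ with $\mathbb{S}_1(i)/F(i)\cong K[x_i,x_i^{-1}]$. For $\mathcal N\subseteq\{1,\dots,n\}$, let $C\mathcal N$ be its complement and define: - $\mathbb{S}_{\mathcal N}=\bigotimes_{i\in\mathcal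 N}\mathbb{S}_1(i)$ ($=K$ if empty); - $L_{\mathcal N}=K[x_i,x_i^{-1}:i\in\mathcal N]$; - $\mathfrak a_{\mathcal N}=\sum_{i\in\mathcal N}\big(F(i)\otimes\bigotimes_{j\in\mathcal N\setminus\{i\}}\mathbb{S}_1(j)\big)$; - $\pi_{\mathcal N}:\mathbb{S}_{\mathcal N}\to\mathbb{S}_{\mathcal N}/\mathfrak a_{\mathcal N}\cong L_{\mathcal N}$. $\mathrm{ht}$ denotes height of a prime. The co-height is $\mathrm{cht}(\mathfrak p)=\mathrm{cl.Kdim}(A/\mathfrak p)$, the classical Krull dimension of the factor ring; subscripts indicate the ring in which height and co-height are computed. *)

theory Defs
  imports "HOL-Algebra.QuotRing" "HOL-Library.Extended_Nat"
begin

text \<open>Monomials of the Jacobson algebras: a monomial of S_I is a function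
  m :: nat \<Rightarrow> nat \<times> nat, where m i = (k,l) stands for the factor x_i^k y_i^l,
  and m i = (0,0) for i outside I.  Multiplication of monomials is the
  componentwise bicyclic product, coming from y_i x_i = 1:
  x^a y^b x^c y^d = x^(a + c - min b c) y^(b + d - min b c).\<close>

definition bic_mul :: "nat \<times> nat \<Rightarrow> nat \<times> nat \<Rightarrow> nat \<times> nat" where
  "bic_mul p q = (fst p + fst q - min (snd p) (fst q), snd p + snd q - min (snd p) (fst q))"

definition mono_mul :: "(nat \<Rightarrow> nat \<times> nat) \<Rightarrow> (nat \<Rightarrow> nat \<times> nat) \<Rightarrow> (nat \<Rightarrow> nat \<times> nat)" where
  "mono_mul u v = (\<lambda>i. bic_mul (u i) (v i))"

definition conv :: "('m \<Rightarrow> 'm \<Rightarrow> 'm) \<Rightarrow> ('m \<Rightarrow> 'k::field) \<Rightarrow> ('m \<Rightarrow> 'k) \<Rightarrow> ('m \<Rightarrow> 'k)" where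
  "conv mul f g = (\<lambda>m. \<Sum>(u,v) \<in> {(u,v). f u \<noteq> 0 \<and> g v \<noteq> 0 \<and> mul u v = m}. f u * g v)"

text \<open>S_I = tensor product of S_1(i), i in I, realised as its monomial basis
  algebra (K-linear combinations of the monomials prod_i x_i^(k_i) y_i^(l_i)).
  All S_I live in one type, so S_N and S_(CN) are literally subalgebras of S_n.\<close>
definition bic_alg :: "nat set \<Rightarrow> ((nat \<Rightarrow> nat \<times> nat) \<Rightarrow> 'k::field) ring" where
  "bic_alg I = \<lparr> carrier = {f. finite {m. f m \<noteq> 0} \<and>
                       (\<forall>m. f m \<noteq> 0 \<longrightarrow> (\<forall>i. i \<notin> I \<longrightarrow> m i = (0,0)))},
               mult = conv mono_mul,
               one = (\<lambda>m. if m = (\<lambda>i. (0,0)) then 1 else 0),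
               zero = (\<lambda>m. 0),
               add = (\<lambda>f g m. f m + g m) \<rparr>"

text \<open>S_n, on the index set {0..<n} (corresponding to {1..n}).\<close>
definition S :: "nat \<Rightarrow> ((nat \<Rightarrow> nat \<times> nat) \<Rightarrow> 'k::field) ring" where
  "S n = bic_alg {..<n}"

text \<open>L_I = K[x_i, x_i^-1 : i in I], realised as the group algebra of Z^I:
  a monomial is e :: nat \<Rightarrow> int (exponents), with e i = 0 outside I.\<close>
definition laurent_alg :: "nat set \<Rightarrow> ((nat \<Rightarrow> int) \<Rightarrow> 'k::field) ring" where
  "laurent_alg I = \<lparr> carrier = {f. finite {e. f e \<noteq> 0} \<and>
                       (\<forall>e. f e \<noteq> 0 \<longrightarrow> (\<forall>i. i \<notin> I \<longrightarrow> e i = 0))},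
               mult = conv (\<lambda>u v i. u i + v i),
               one = (\<lambda>e. if e = (\<lambda>i. 0) then 1 else 0),
               zero = (\<lambda>e. 0),
               add = (\<lambda>f g e. f e + g e) \<rparr>"

text \<open>pi_I : S_I \<rightarrow> S_I / a_I \<cong> L_I, the K-algebra map x_i \<mapsto> x_i, y_i \<mapsto> x_i^-1,
  i.e. x^k y^l \<mapsto> x^(k-l) on monomials (its kernel is a_I).\<close>
definition pi_map :: "((nat \<Rightarrow> nat \<times> nat) \<Rightarrow> 'k::field) \<Rightarrow> ((nat \<Rightarrow> int) \<Rightarrow> 'k)" where
  "pi_map f = (\<lambda>e. \<Sum>m \<in> {m. f m \<noteq> 0 \<and> (\<lambda>i. int (fst (m i)) - int (snd (m i))) = e}. f m)"

text \<open>The ideal S_N \<otimes> pi_(CN)^-1(q) of S_n = S_N \<otimes> S_(CN), where CN = {..<n} - N: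
  the set of finite sums of products a*b with a in S_N and b in pi^-1(q).\<close>
definition tensor_ideal :: "nat \<Rightarrow> nat set \<Rightarrow> ((nat \<Rightarrow> int) \<Rightarrow> 'k::field) set
                              \<Rightarrow> ((nat \<Rightarrow> nat \<times> nat) \<Rightarrow> 'k) set" where
  "tensor_ideal n N q =
     {finsum (S n :: ((nat \<Rightarrow> nat \<times> nat) \<Rightarrow> 'k) ring)
         (\<lambda>j. a j \<otimes>\<^bsub>(S n :: ((nat \<Rightarrow> nat \<times> nat) \<Rightarrow> 'k) ring)\<^esub> b j) {..<(k::nat)} | k a b.
        \<forall>j<k. a j \<in> carrier (bic_alg N :: ((nat \<Rightarrow> nat \<times> nat) \<Rightarrow> 'k) ring)
              \<and> b j \<in> carrier (bic_alg ({..<n} - N) :: ((nat \<Rightarrow> nat \<times> nat) \<Rightarrow> 'k) ring)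
              \<and> pi_map (b j) \<in> q}"

text \<open>Prime ideal of a (not necessarily commutative) ring: a proper ideal P
  such that for ideals I, J, IJ \<subseteq> P implies I \<subseteq> P or J \<subseteq> P
  (IJ \<subseteq> P iff all products a b, a in I, b in J, lie in P).\<close>
definition prime_ideal :: "('a, 'b) ring_scheme \<Rightarrow> 'a set \<Rightarrow> bool" where
  "prime_ideal R P \<longleftrightarrow> ideal P R \<and> P \<noteq> carrier R \<and>
     (\<forall>I J. ideal I R \<longrightarrow> ideal J R \<longrightarrow> (\<forall>a\<in>I. \<forall>b\<in>J. a \<otimes>\<^bsub>R\<^esub> b \<in> P) \<longrightarrow> I \<subseteq> P \<or> J \<subseteq> P)"

definition Spec :: "('a, 'b) ring_scheme \<Rightarrow> 'a set set" where
  "Spec R = {P. prime_ideal R P}"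

definition prime_chain :: "('a, 'b) ring_scheme \<Rightarrow> (nat \<Rightarrow> 'a set) \<Rightarrow> nat \<Rightarrow> bool" where
  "prime_chain R c k \<longleftrightarrow> (\<forall>i\<le>k. c i \<in> Spec R) \<and> (\<forall>i<k. c i \<subset> c (Suc i))"

definition height :: "('a, 'b) ring_scheme \<Rightarrow> 'a set \<Rightarrow> enat" where
  "height R P = Sup {enat k | k. \<exists>c. prime_chain R c k \<and> c k = P}"

definition cl_Kdim :: "('a, 'b) ring_scheme \<Rightarrow> enat" where
  "cl_Kdim R = Sup {enat k | k. \<exists>c. prime_chain R c k}"

definition coheight :: "('a, 'b) ring_scheme \<Rightarrow> 'a set \<Rightarrow> enat" where
  "coheight R P = cl_Kdim (R Quot P)"

end

theory Submission
  imports Defs "HOL-Library.Poly_Mapping" "HOL-Library.Function_Algebras" "Jordan_Normal_Form.Char_Poly"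
begin

text \<open>
  Both spectra carry a rank function, strictly monotone, such that every prime of positive rank
  has a predecessor of rank one less and every prime of non-maximal rank has a successor of rank
  one more; then height is the rank and co-height is the maximal rank minus the rank.

  For a prime \<open>q\<close> of \<open>L\<^sub>I\<close>, let \<open>t(q)\<close> be the largest number of variables that are algebraically
  independent modulo \<open>q\<close>; the rank is \<open>|I| - t(q)\<close>. A predecessor is obtained by extending the
  contraction of \<open>q\<close> to all variables but one. Monotonicity and successors rest on one integrality
  statement: if \<open>J\<close> is maximal independent, then after multiplication by a power of a fixed nonzero
  \<open>g\<close> in \<open>L\<^sub>J\<close> every element is integral over \<open>L\<^sub>J\<close> modulo \<open>q\<close>. For \<open>j\<close> in \<open>J\<close>, the element
  \<open>1 - x\<^sub>j\<^sup>M g\<close> then generates together with \<open>q\<close> an ideal avoiding the nonzero elements of \<open>L\<close> in the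
  variables \<open>J - {j}\<close>, and a maximal such ideal is a successor of \<open>q\<close>.

  For the Jacobson algebra put \<open>e = \<Prod>\<^sub>i\<^sub>\<in>\<^sub>N (1 - x\<^sub>i y\<^sub>i)\<close>. Modulo the ideals \<open>F(i)\<close>, \<open>i \<notin> N\<close>, the corner
  \<open>e S e\<close> is \<open>e L\<close> with \<open>L\<close> the Laurent ring in the variables outside \<open>N\<close>. A prime \<open>p\<close>, with \<open>N\<close> the set of \<open>i\<close> such that
  \<open>1 - x\<^sub>i y\<^sub>i \<notin> p\<close>, is recovered from its trace \<open>q\<close> on this corner, and inclusion of primes
  corresponds to \<open>N\<^sub>2 \<subseteq> N\<^sub>1\<close> and \<open>q\<^sub>1 \<subseteq> q\<^sub>2\<close>. The rank of \<open>p\<close> is \<open>2m - t(q)\<close> with \<open>m\<close> the number of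
  variables outside \<open>N\<close>.
\<close>

section \<open>Prime spectra of general rings: factor rings, chains, rank functions, subrings of a
  type\<close>

section \<open>Spectra under surjective homomorphisms\<close>

text \<open>A bound on the dimension is not enough: height and co-height must be attained through
  every single prime, hence neighbours of adjacent rank in both directions.

  Integrality alone does not yield successors, as it holds only up to powers of \<open>g\<close>.
  Modulo \<open>1 - x_j^M g\<close> the element \<open>g\<close> has the inverse
  \<open>x_j^M\<close>, so the denominators disappear. A large \<open>M\<close> makes all
  \<open>x_j\<close>-exponents of \<open>x_j^M g\<close> positive, which keeps
  \<open>1 - x_j^M g\<close> from dividing a nonzero element free of \<open>x_j\<close>.

  The rank \<open>2m - t\<close> is \<open>m + (m - t)\<close>: one for each variable outside
  \<open>N\<close>, plus the height of \<open>q\<close>. A step of rank one changes \<open>q\<close>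
  with \<open>N\<close> fixed, or moves one variable. If \<open>t = 0\<close>, so that
  \<open>q\<close> is maximal, a variable leaves \<open>N\<close> and \<open>q\<close> is extended
  to it: \<open>2m\<close> grows by two and \<open>t\<close> by one. If \<open>t = m\<close>, so
  that \<open>q\<close> is zero, a variable joins \<open>N\<close> and \<open>q\<close> stays zero.
  Primes with different \<open>N\<close> can be compared because the corner for \<open>N\<close> is
  assembled from corners for \<open>N\<close> with one more variable, by extracting coefficients of
  that variable.\<close>

lemma prime_chain_mono:
  assumes "prime_chain R c k" "i \<le> j" "j \<le> k"
  shows "c i \<subseteq> c j"
  using assms(2,3)
proof (induction rule: dec_induct)
  case (step m)
  then show ?case using assms(1) unfolding prime_chain_def
    by (metis Suc_le_lessD Suc_leD order_trans psubset_imp_subset)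
qed simp

lemma prime_ideal_subset_carrier:
  assumes "P \<in> Spec R" shows "P \<subseteq> carrier R"
proof -
  interpret ideal P R using assms by (simp add: Spec_def prime_ideal_def)
  show ?thesis by (rule a_subset)
qed

context ring_hom_ring
begin

lemma ideal_image:
  assumes "ideal I R" "h ` carrier R = carrier S"
  shows "ideal (h ` I) S"
proof (rule idealI)
  interpret I: ideal I R by fact
  show "ring S" by (rule S.ring_axioms)
  show "subgroup (h ` I) (add_monoid S)"
    by (rule img_is_add_subgroup) (rule I.a_subgroup)
  fix a x assume ax: "a \<in> h ` I" "x \<in> carrier S"
  then obtain b y where b: "b \<in> I" "a = h b" and y: "y \<in> carrier R" "x = h y"
    using assms(2) by blast
  have "h (y \<otimes> b) \<in> h ` I" "h (b \<otimes> y) \<in> h ` I"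
    using I.I_l_closed I.I_r_closed b y by blast+
  then show "x \<otimes>\<^bsub>S\<^esub> a \<in> h ` I" "a \<otimes>\<^bsub>S\<^esub> x \<in> h ` I"
    using b y by (simp_all add: I.Icarr)
qed

lemma vimage_image_ideal:
  assumes "ideal I R" "a_kernel R S h \<subseteq> I"
  shows "{r \<in> carrier R. h r \<in> h ` I} = I"
proof -
  interpret I: ideal I R by fact
  have "r \<in> I" if "r \<in> carrier R" "s \<in> I" "h r = h s" for r s
  proof -
    have c: "r \<in> carrier R" "s \<in> carrier R" using that I.Icarr by auto
    have "h (r \<oplus> \<ominus> s) = h r \<oplus>\<^bsub>S\<^esub> \<ominus>\<^bsub>S\<^esub> h s" using c by simp
    also have "\<dots> = \<zero>\<^bsub>S\<^esub>" unfolding that(3) by (rule S.r_neg) (use c in simp)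
    finally have "h (r \<oplus> \<ominus> s) = \<zero>\<^bsub>S\<^esub>" .
    moreover have "r \<oplus> \<ominus> s \<in> carrier R" using c by simp
    ultimately have "r \<oplus> \<ominus> s \<in> a_kernel R S h" unfolding a_kernel_def' by blast
    then have "r \<oplus> \<ominus> s \<oplus> s \<in> I" using assms(2) that(2) by (meson I.a_closed subsetD)
    moreover have "r \<oplus> \<ominus> s \<oplus> s = r"
      using c R.add.m_assoc[of r "\<ominus> s" s] R.l_neg[of s] by simp
    ultimately show ?thesis by simp
  qed
  then show ?thesis using I.Icarr by blast
qed

lemma Spec_vimage:
  assumes surj: "h ` carrier R = carrier S" and P: "P \<in> Spec S"
  shows "{r \<in> carrier R. h r \<in> P} \<in> Spec R"
proof -
  let ?Q = "{r \<in> carrier R. h r \<in> P}"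
  have id: "ideal P S" and pr: "P \<noteq> carrier S"
    "\<And>I J. ideal I S \<Longrightarrow> ideal J S \<Longrightarrow> (\<forall>a\<in>I. \<forall>b\<in>J. a \<otimes>\<^bsub>S\<^esub> b \<in> P) \<Longrightarrow> I \<subseteq> P \<or> J \<subseteq> P"
    using P by (auto simp: Spec_def prime_ideal_def)
  interpret P: ideal P S by fact
  have "ideal ?Q R" using ideal_vimage[OF id] .
  moreover have "?Q \<noteq> carrier R"
  proof
    assume "?Q = carrier R"
    then have "h \<one> \<in> P" by blast
    then show False using P.one_imp_carrier pr(1) by auto
  qed
  moreover have "I \<subseteq> ?Q \<or> J \<subseteq> ?Q"
    if I: "ideal I R" and J: "ideal J R" and IJ: "\<forall>a\<in>I. \<forall>b\<in>J. a \<otimes> b \<in> ?Q" for I J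
  proof -
    interpret I: ideal I R by fact
    interpret J: ideal J R by fact
    have "\<forall>a\<in>h ` I. \<forall>b\<in>h ` J. a \<otimes>\<^bsub>S\<^esub> b \<in> P"
    proof (intro ballI; elim imageE)
      fix a b x y assume "a = h x" "x \<in> I" "b = h y" "y \<in> J"
      then show "a \<otimes>\<^bsub>S\<^esub> b \<in> P" using IJ hom_mult[of x y] I.Icarr J.Icarr by (metis (mono_tags, lifting) mem_Collect_eq)
    qed
    then have "h ` I \<subseteq> P \<or> h ` J \<subseteq> P" by (intro pr(2) ideal_image I J surj)
    then show ?thesis using I.Icarr J.Icarr by blast
  qed
  ultimately show ?thesis by (simp add: Spec_def prime_ideal_def)
qed

lemma Spec_image:
  assumes surj: "h ` carrier R = carrier S" and Q: "Q \<in> Spec R" "a_kernel R S h \<subseteq> Q"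
  shows "h ` Q \<in> Spec S"
proof -
  have id: "ideal Q R" and pr: "Q \<noteq> carrier R"
    "\<And>I J. ideal I R \<Longrightarrow> ideal J R \<Longrightarrow> (\<forall>a\<in>I. \<forall>b\<in>J. a \<otimes> b \<in> Q) \<Longrightarrow> I \<subseteq> Q \<or> J \<subseteq> Q"
    using Q by (auto simp: Spec_def prime_ideal_def)
  interpret Q: ideal Q R by fact
  have eq: "{r \<in> carrier R. h r \<in> h ` Q} = Q" by (rule vimage_image_ideal[OF id Q(2)])
  have "ideal (h ` Q) S" by (rule ideal_image[OF id surj])
  moreover have "h ` Q \<noteq> carrier S" using eq pr(1) surj by blast
  moreover have "I \<subseteq> h ` Q \<or> J \<subseteq> h ` Q"
    if I: "ideal I S" and J: "ideal J S" and IJ: "\<forall>a\<in>I. \<forall>b\<in>J. a \<otimes>\<^bsub>S\<^esub> b \<in> h ` Q" for I J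
  proof -
    let ?v = "\<lambda>I. {r \<in> carrier R. h r \<in> I}"
    have "\<forall>a\<in>?v I. \<forall>b\<in>?v J. a \<otimes> b \<in> Q"
    proof (intro ballI)
      fix a b assume ab: "a \<in> ?v I" "b \<in> ?v J"
      then have "h (a \<otimes> b) \<in> h ` Q" using IJ hom_mult[of a b] by simp
      moreover have "a \<otimes> b \<in> carrier R" using ab by simp
      ultimately show "a \<otimes> b \<in> Q" using eq by blast
    qed
    then have "?v I \<subseteq> Q \<or> ?v J \<subseteq> Q" by (intro pr(2) ideal_vimage I J)
    moreover have "X \<subseteq> h ` Q" if "ideal X S" "?v X \<subseteq> Q" for X
    proof
      fix x assume x: "x \<in> X"
      then have "x \<in> carrier S" using that(1) by (meson ideal.Icarr)
      then obtain y where "y \<in> carrier R" "x = h y" using surj by blast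
      then show "x \<in> h ` Q" using x that(2) by blast
    qed
    ultimately show ?thesis using I J by blast
  qed
  ultimately show ?thesis by (simp add: Spec_def prime_ideal_def)
qed

lemma prime_chain_vimage:
  assumes surj: "h ` carrier R = carrier S" and c: "prime_chain S c k"
  shows "prime_chain R (\<lambda>i. {r \<in> carrier R. h r \<in> c i}) k"
    and "\<And>i. i \<le> k \<Longrightarrow> a_kernel R S h \<subseteq> {r \<in> carrier R. h r \<in> c i}"
proof -
  have "{r \<in> carrier R. h r \<in> c i} \<subset> {r \<in> carrier R. h r \<in> c (Suc i)}" if "i < k" for i
  proof -
    have "c i \<subset> c (Suc i)" "c (Suc i) \<in> Spec S" using c that by (auto simp: prime_chain_def)
    then obtain x where x: "x \<in> c (Suc i)" "x \<notin> c i" "x \<in> carrier S"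
      using prime_ideal_subset_carrier by blast
    then obtain y where "y \<in> carrier R" "x = h y" using surj by blast
    then show ?thesis using x \<open>c i \<subset> c (Suc i)\<close> by blast
  qed
  then show "prime_chain R (\<lambda>i. {r \<in> carrier R. h r \<in> c i}) k"
    using c Spec_vimage[OF surj] by (auto simp: prime_chain_def)
  fix i assume "i \<le> k"
  then have "ideal (c i) S" using c unfolding prime_chain_def Spec_def prime_ideal_def by blast
  then have "\<zero>\<^bsub>S\<^esub> \<in> c i" by (simp add: additive_subgroup.zero_closed ideal.axioms(1))
  then show "a_kernel R S h \<subseteq> {r \<in> carrier R. h r \<in> c i}"
    unfolding a_kernel_def' by (metis (mono_tags, lifting) Collect_mono)
qed

lemma prime_chain_image:
  assumes surj: "h ` carrier R = carrier S" and c: "prime_chain R c k" and ker: "a_kernel R S h \<subseteq> c 0"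
  shows "prime_chain S (\<lambda>i. h ` c i) k"
proof -
  have sub: "a_kernel R S h \<subseteq> c i" if "i \<le> k" for i
    using prime_chain_mono[OF c, of 0 i] that ker by auto
  have eq: "{r \<in> carrier R. h r \<in> h ` c i} = c i" if "i \<le> k" for i
    using c that by (intro vimage_image_ideal sub) (simp_all add: prime_chain_def Spec_def prime_ideal_def)
  show ?thesis unfolding prime_chain_def
  proof (intro conjI allI impI)
    fix i assume i: "i \<le> k"
    then show "h ` c i \<in> Spec S" using c by (intro Spec_image surj sub) (auto simp: prime_chain_def)
  next
    fix i assume i: "i < k"
    then have "c i \<subset> c (Suc i)" using c by (auto simp: prime_chain_def)
    moreover have "h ` c i \<noteq> h ` c (Suc i)" using eq[of i] eq[of "Suc i"] i calculation by (metis le_less less_eq_Suc_le psubset_eq)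
    ultimately show "h ` c i \<subset> h ` c (Suc i)" by blast
  qed
qed

text \<open>Lets the dimension of a factor ring be read off from chains upstairs, so that co-height
  needs no computation with cosets.\<close>

lemma cl_Kdim_image:
  assumes surj: "h ` carrier R = carrier S"
  shows "cl_Kdim S = Sup {enat k | k. \<exists>c. prime_chain R c k \<and> a_kernel R S h \<subseteq> c 0}"
proof -
  have "(\<exists>c. prime_chain S c k) \<longleftrightarrow> (\<exists>c. prime_chain R c k \<and> a_kernel R S h \<subseteq> c 0)" for k
    using prime_chain_vimage[OF surj] prime_chain_image[OF surj] by (metis (no_types, lifting) le0)
  then show ?thesis by (simp add: cl_Kdim_def)
qed

text \<open>Chains ending at a prime may start anywhere, so they can be pushed along
  \<open>h\<close> only if the kernel lies in every ideal; injectivity provides this.\<close>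

lemma height_image_iso:
  assumes surj: "h ` carrier R = carrier S" and inj: "inj_on h (carrier R)" and P: "P \<in> Spec S"
  shows "height S P = height R {r \<in> carrier R. h r \<in> P}"
proof -
  have ker: "a_kernel R S h \<subseteq> {\<zero>}"
  proof
    fix x assume "x \<in> a_kernel R S h"
    then have x: "x \<in> carrier R" "h x = \<zero>\<^bsub>S\<^esub>" unfolding a_kernel_def' by blast+
    have "h x = h \<zero>" unfolding x(2) by (rule hom_zero[symmetric])
    then have "x = \<zero>" by (rule inj_onD[OF inj _ x(1) R.zero_closed])
    then show "x \<in> {\<zero>}" by simp
  qed
  have "(\<exists>c. prime_chain S c k \<and> c k = P) \<longleftrightarrow>
     (\<exists>c. prime_chain R c k \<and> c k = {r \<in> carrier R. h r \<in> P})" (is "?l \<longleftrightarrow> ?r") for k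
  proof
    show "?l \<Longrightarrow> ?r" using prime_chain_vimage(1)[OF surj] by blast
  next
    assume ?r
    then obtain c where c: "prime_chain R c k" "c k = {r \<in> carrier R. h r \<in> P}" by blast
    then have "ideal (c 0) R" unfolding prime_chain_def Spec_def prime_ideal_def by blast
    then have "a_kernel R S h \<subseteq> c 0"
      using ker additive_subgroup.zero_closed[OF ideal.axioms(1)] by blast
    then have "prime_chain S (\<lambda>i. h ` c i) k" by (rule prime_chain_image[OF surj c(1)])
    moreover have "h ` c k = P" using prime_ideal_subset_carrier[OF P] surj c(2) by auto
    ultimately show ?l by blast
  qed
  then show ?thesis by (simp add: height_def)
qed

end

text \<open>The composite of \<open>h\<close> with the projection onto the factor ring is surjective
  with kernel the preimage of \<open>P\<close>, so one application of \<open>cl_Kdim_image\<close>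
  crosses both the change of model and the quotient.\<close>

lemma coheight_iso:
  assumes hom: "ring_hom_ring R T h" and surj: "h ` carrier R = carrier T" and P: "P \<in> Spec T"
  shows "coheight T P = Sup {enat k | k. \<exists>c. prime_chain R c k \<and> {r \<in> carrier R. h r \<in> P} \<subseteq> c 0}"
proof -
  interpret h: ring_hom_ring R T h by fact
  interpret P: ideal P T using P by (simp add: Spec_def prime_ideal_def)
  let ?g = "\<lambda>r. P +>\<^bsub>T\<^esub> h r"
  have gs: "ring_hom_ring T (T Quot P) ((+>\<^bsub>T\<^esub>) P)" by (rule P.rcos_ring_hom_ring)
  interpret g: ring_hom_ring R "T Quot P" ?g
    using ring_hom_trans[OF h.homh ring_hom_ring.homh[OF gs]]
    by (intro ring_hom_ring.intro ring_hom_ring_axioms.intro h.R.ring_axioms P.quotient_is_ring)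
       (simp add: o_def)
  have "?g ` carrier R = (\<lambda>x. P +>\<^bsub>T\<^esub> x) ` carrier T" using surj by (metis image_image)
  also have "\<dots> = carrier (T Quot P)" by (auto simp: FactRing_simps)
  finally have "?g ` carrier R = carrier (T Quot P)" .
  moreover have "a_kernel R (T Quot P) ?g = {r \<in> carrier R. h r \<in> P}"
  proof -
    have "P +>\<^bsub>T\<^esub> x = P \<longleftrightarrow> x \<in> P" if "x \<in> carrier T" for x
      using P.rcos_const_imp_mem[OF that] P.a_rcos_const[of x] by blast
    then have "P +>\<^bsub>T\<^esub> h r = P \<longleftrightarrow> h r \<in> P" if "r \<in> carrier R" for r using that surj by blast
    moreover have "\<zero>\<^bsub>T Quot P\<^esub> = P" by (simp add: FactRing_def)
    ultimately show ?thesis unfolding a_kernel_def' by (intro Collect_cong) auto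
  qed
  ultimately show ?thesis unfolding coheight_def using g.cl_Kdim_image by simp
qed

section \<open>Ranked spectra\<close>

text \<open>Strict monotonicity gives one inequality for each neighbour, so only the other one is
  demanded; together they make the rank change by exactly one. Neighbours in both directions put
  every prime on a chain from rank 0 to rank \<open>D\<close>.\<close>

definition ranked_Spec :: "('a, 'b) ring_scheme \<Rightarrow> nat \<Rightarrow> ('a set \<Rightarrow> nat) \<Rightarrow> bool" where
  "ranked_Spec R D rk \<longleftrightarrow>
     (\<forall>P\<in>Spec R. rk P \<le> D
        \<and> (\<forall>Q\<in>Spec R. P \<subset> Q \<longrightarrow> rk P < rk Q)
        \<and> (0 < rk P \<longrightarrow> (\<exists>Q\<in>Spec R. Q \<subset> P \<and> rk P \<le> Suc (rk Q)))
        \<and> (rk P < D \<longrightarrow> (\<exists>Q\<in>Spec R. P \<subset> Q \<and> rk Q \<le> Suc (rk P))))"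

lemma enat_Sup_eq:
  fixes K :: "nat \<Rightarrow> bool"
  assumes "K d" "\<And>k. K k \<Longrightarrow> k \<le> d"
  shows "Sup {enat k | k. K k} = enat d"
  using assms by (intro antisym Sup_least Sup_upper) auto

lemma ranked_chain_bound:
  assumes rk: "ranked_Spec R D rk" and c: "prime_chain R c k"
  shows "rk (c 0) + k \<le> rk (c k)"
proof -
  have "rk (c 0) + j \<le> rk (c j)" if "j \<le> k" for j
    using that
  proof (induction j)
    case (Suc j)
    then have "rk (c j) < rk (c (Suc j))"
      using rk c unfolding ranked_Spec_def prime_chain_def by simp
    then show ?case using Suc by simp
  qed simp
  then show ?thesis by simp
qed

lemma ranked_chain_down:
  assumes rk: "ranked_Spec R D rk" and P: "P \<in> Spec R"
  shows "\<exists>c. prime_chain R c (rk P) \<and> c (rk P) = P"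
  using P
proof (induction "rk P" arbitrary: P)
  case 0
  then show ?case by (auto simp: prime_chain_def)
next
  case (Suc m)
  from rk Suc.hyps(2) Suc.prems obtain Q where Q: "Q \<in> Spec R" "Q \<subset> P" "rk P \<le> Suc (rk Q)"
    unfolding ranked_Spec_def by (metis zero_less_Suc)
  moreover have "rk Q < rk P" using rk Q Suc.prems unfolding ranked_Spec_def by blast
  ultimately have m: "rk Q = m" using Suc.hyps(2) by simp
  obtain c where c: "prime_chain R c m" "c m = Q" using Suc.hyps(1)[OF m[symmetric] Q(1)] m by auto
  have "prime_chain R (c(Suc m := P)) (Suc m)"
    using c Q(2) Suc.prems unfolding prime_chain_def by (auto simp: le_Suc_eq less_Suc_eq)
  then show ?case unfolding Suc.hyps(2)[symmetric] by (intro exI[of _ "c(Suc m := P)"]) simp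
qed

lemma ranked_chain_up:
  assumes rk: "ranked_Spec R D rk" and P: "P \<in> Spec R"
  shows "\<exists>c. prime_chain R c (D - rk P) \<and> c 0 = P"
  using P
proof (induction "D - rk P" arbitrary: P)
  case 0
  then show ?case by (intro exI[of _ "\<lambda>_. P"]) (auto simp: prime_chain_def)
next
  case (Suc m)
  have "rk P < D" using Suc.hyps(2) by simp
  then obtain Q where Q: "Q \<in> Spec R" "P \<subset> Q" "rk Q \<le> Suc (rk P)"
    using rk Suc.prems unfolding ranked_Spec_def by blast
  moreover have "rk P < rk Q" using rk Q Suc.prems unfolding ranked_Spec_def by blast
  ultimately have m: "D - rk Q = m" using Suc.hyps(2) by simp
  obtain c where c: "prime_chain R c m" "c 0 = Q" using Suc.hyps(1)[OF m[symmetric] Q(1)] m by auto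
  have "prime_chain R (case_nat P c) (Suc m)"
    using c Q(2) Suc.prems unfolding prime_chain_def
    by (auto split: nat.split simp: less_Suc_eq_0_disj le_Suc_eq)
  then show ?case unfolding Suc.hyps(2)[symmetric] by (intro exI[of _ "case_nat P c"]) simp
qed

lemma ranked_height:
  assumes "ranked_Spec R D rk" "P \<in> Spec R"
  shows "height R P = enat (rk P)"
  unfolding height_def using ranked_chain_down[OF assms] ranked_chain_bound[OF assms(1)]
  by (intro enat_Sup_eq) (auto intro: add_leD2)

lemma ranked_coheight:
  assumes "ranked_Spec R D rk" "P \<in> Spec R"
  shows "Sup {enat k | k. \<exists>c. prime_chain R c k \<and> P \<subseteq> c 0} = enat (D - rk P)"
proof (rule enat_Sup_eq)
  show "\<exists>c. prime_chain R c (D - rk P) \<and> P \<subseteq> c 0" using ranked_chain_up[OF assms] by blast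
next
  fix k assume "\<exists>c. prime_chain R c k \<and> P \<subseteq> c 0"
  then obtain c where c: "prime_chain R c k" "P \<subseteq> c 0" by blast
  then have in_Spec: "c 0 \<in> Spec R" "c k \<in> Spec R" by (auto simp: prime_chain_def)
  have "rk P \<le> rk (c 0)"
    using assms c(2) in_Spec unfolding ranked_Spec_def by (metis less_imp_le order_refl psubsetI)
  moreover have "rk (c k) \<le> D" using assms(1) in_Spec unfolding ranked_Spec_def by blast
  ultimately show "k \<le> D - rk P" using ranked_chain_bound[OF assms(1) c(1)] by linarith
qed

text \<open>\<open>P\<close> witnesses that the spectrum is nonempty: descending from it ends at a
  prime of rank 0, and ascending from there gives a chain of length \<open>D\<close>.\<close>

lemma ranked_cl_Kdim:
  assumes "ranked_Spec R D rk" "P \<in> Spec R"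
  shows "Sup {enat k | k. \<exists>c. prime_chain R c k} = enat D"
proof (rule enat_Sup_eq)
  obtain c where c: "prime_chain R c (rk P)" "c (rk P) = P" using ranked_chain_down[OF assms] by blast
  then have Q: "c 0 \<in> Spec R" "rk (c 0) = 0"
    using ranked_chain_bound[OF assms(1) c(1)] by (auto simp: prime_chain_def)
  show "\<exists>c. prime_chain R c D" using ranked_chain_up[OF assms(1) Q(1)] Q(2) by auto
next
  fix k assume "\<exists>c. prime_chain R c k"
  then obtain c where c: "prime_chain R c k" by blast
  then have "rk (c k) \<le> D" using assms(1) unfolding ranked_Spec_def by (auto simp: prime_chain_def)
  then show "k \<le> D" using ranked_chain_bound[OF assms(1) c] by linarith
qed

section \<open>Unital subrings of a type\<close>

text \<open>The rings for different sets of variables are handled as subsets of one type, so that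
  contraction to fewer variables is plain intersection and inclusions need no embedding
  maps.\<close>

definition unital_subring :: "'a::ring_1 set \<Rightarrow> bool" where
  "unital_subring A \<longleftrightarrow> 1 \<in> A \<and> (\<forall>a\<in>A. \<forall>b\<in>A. a + b \<in> A \<and> a * b \<in> A) \<and> (\<forall>a\<in>A. - a \<in> A)"

definition subring_rec :: "'a::ring_1 set \<Rightarrow> 'a ring" where
  "subring_rec A = \<lparr>carrier = A, monoid.mult = (*), one = 1, zero = 0, add = (+)\<rparr>"

lemma subring_rec_simps [simp]:
  "carrier (subring_rec A) = A" "monoid.mult (subring_rec A) = (*)" "one (subring_rec A) = 1"
  "zero (subring_rec A) = 0" "add (subring_rec A) = (+)"
  by (simp_all add: subring_rec_def)

context
  fixes A :: "'a::ring_1 set"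
  assumes A: "unital_subring A"
begin

lemma unital_subring_closed:
  "1 \<in> A" "a \<in> A \<Longrightarrow> b \<in> A \<Longrightarrow> a + b \<in> A" "a \<in> A \<Longrightarrow> b \<in> A \<Longrightarrow> a * b \<in> A" "a \<in> A \<Longrightarrow> - a \<in> A"
  using A by (auto simp: unital_subring_def)

lemma unital_subring_closed': "0 \<in> A" "a \<in> A \<Longrightarrow> b \<in> A \<Longrightarrow> a - b \<in> A" "a \<in> A \<Longrightarrow> a ^ n \<in> A"
proof -
  show "0 \<in> A" using unital_subring_closed(2)[of 1 "- 1"] unital_subring_closed by simp
  show "a \<in> A \<Longrightarrow> b \<in> A \<Longrightarrow> a - b \<in> A"
    using unital_subring_closed(2)[of a "- b"] unital_subring_closed(4) by simp
  show "a \<in> A \<Longrightarrow> a ^ n \<in> A" by (induction n) (simp_all add: unital_subring_closed)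
qed

lemma unital_subring_sum: "(\<And>i. i \<in> X \<Longrightarrow> f i \<in> A) \<Longrightarrow> sum f X \<in> A"
  by (induction X rule: infinite_finite_induct) (simp_all add: unital_subring_closed unital_subring_closed')

lemma ring_subring_rec: "ring (subring_rec A)"
proof (rule ringI)
  show "abelian_group (subring_rec A)"
  proof (rule abelian_groupI)
    fix x assume "x \<in> carrier (subring_rec A)"
    then show "\<exists>y\<in>carrier (subring_rec A). y \<oplus>\<^bsub>subring_rec A\<^esub> x = \<zero>\<^bsub>subring_rec A\<^esub>"
      by (intro bexI[of _ "- x"]) (simp_all add: unital_subring_closed)
  qed (simp_all add: unital_subring_closed unital_subring_closed' algebra_simps)
  show "monoid (subring_rec A)"
    by (rule monoidI) (simp_all add: unital_subring_closed algebra_simps)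
qed (simp_all add: algebra_simps)

lemma ideal_subring_rec_iff:
  "ideal P (subring_rec A) \<longleftrightarrow> P \<subseteq> A \<and> 0 \<in> P \<and> (\<forall>a\<in>P. \<forall>b\<in>P. a + b \<in> P) \<and>
     (\<forall>a\<in>P. \<forall>r\<in>A. r * a \<in> P \<and> a * r \<in> P)"
proof
  assume "ideal P (subring_rec A)"
  then interpret ideal P "subring_rec A" .
  show "P \<subseteq> A \<and> 0 \<in> P \<and> (\<forall>a\<in>P. \<forall>b\<in>P. a + b \<in> P) \<and> (\<forall>a\<in>P. \<forall>r\<in>A. r * a \<in> P \<and> a * r \<in> P)"
    using a_subset additive_subgroup.zero_closed[OF is_additive_subgroup]
      additive_subgroup.a_closed[OF is_additive_subgroup] I_l_closed I_r_closed
    by (simp add: subset_iff)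
next
  assume *: "P \<subseteq> A \<and> 0 \<in> P \<and> (\<forall>a\<in>P. \<forall>b\<in>P. a + b \<in> P) \<and> (\<forall>a\<in>P. \<forall>r\<in>A. r * a \<in> P \<and> a * r \<in> P)"
  interpret ring "subring_rec A" by (rule ring_subring_rec)
  have neg: "- a \<in> P" if "a \<in> P" for a
  proof -
    have "- 1 \<in> A" by (simp add: unital_subring_closed)
    then have "- 1 * a \<in> P" using * that by blast
    then show ?thesis by simp
  qed
  show "ideal P (subring_rec A)"
  proof (rule idealI[OF ring_subring_rec])
    show "subgroup P (add_monoid (subring_rec A))"
    proof (rule add.subgroupI)
      fix a assume a: "a \<in> P"
      have "\<ominus>\<^bsub>subring_rec A\<^esub> a = - a"
        using a * by (intro minus_equality[symmetric, THEN sym]) (auto simp: unital_subring_closed)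
      then show "\<ominus>\<^bsub>subring_rec A\<^esub> a \<in> P" using neg[OF a] by simp
    qed (use * in auto)
  qed (use * in auto)
qed

text \<open>The last conclusion is the elementwise form of noncommutative primeness:
  \<open>a A b\<close> inside \<open>P\<close> forces a factor into \<open>P\<close>. Later proofs
  use it in place of products of ideals.\<close>

lemma Spec_subring_recD:
  assumes "P \<in> Spec (subring_rec A)"
  shows "P \<subseteq> A" "0 \<in> P" "\<And>a b. a \<in> P \<Longrightarrow> b \<in> P \<Longrightarrow> a + b \<in> P"
    "\<And>a r. a \<in> P \<Longrightarrow> r \<in> A \<Longrightarrow> r * a \<in> P" "\<And>a r. a \<in> P \<Longrightarrow> r \<in> A \<Longrightarrow> a * r \<in> P"
    "\<And>a. a \<in> P \<Longrightarrow> - a \<in> P" "1 \<notin> P"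
    "\<And>X f. (\<And>i. i \<in> X \<Longrightarrow> f i \<in> P) \<Longrightarrow> sum f X \<in> P"
    "\<And>a b. a \<in> A \<Longrightarrow> b \<in> A \<Longrightarrow> (\<And>s. s \<in> A \<Longrightarrow> a * s * b \<in> P) \<Longrightarrow> a \<in> P \<or> b \<in> P"
proof -
  have id: "ideal P (subring_rec A)" and ne: "P \<noteq> A"
    and pr: "\<And>I J. ideal I (subring_rec A) \<Longrightarrow> ideal J (subring_rec A) \<Longrightarrow> (\<forall>a\<in>I. \<forall>b\<in>J. a * b \<in> P) \<Longrightarrow> I \<subseteq> P \<or> J \<subseteq> P"
    using assms by (auto simp: Spec_def prime_ideal_def)
  note P = id[unfolded ideal_subring_rec_iff]
  show 1: "P \<subseteq> A" "0 \<in> P" "\<And>a b. a \<in> P \<Longrightarrow> b \<in> P \<Longrightarrow> a + b \<in> P"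
    "\<And>a r. a \<in> P \<Longrightarrow> r \<in> A \<Longrightarrow> r * a \<in> P" "\<And>a r. a \<in> P \<Longrightarrow> r \<in> A \<Longrightarrow> a * r \<in> P"
    using P by auto
  show "- a \<in> P" if "a \<in> P" for a
    using 1(4)[OF that, of "- 1"] by (simp add: unital_subring_closed)
  show "1 \<notin> P" using ne 1(1) 1(4)[of 1] by force
  show sum: "sum f X \<in> P" if "\<And>i. i \<in> X \<Longrightarrow> f i \<in> P" for X and f :: "'i \<Rightarrow> 'a"
    using that by (induction X rule: infinite_finite_induct) (use 1 in simp_all)
  fix a b assume ab: "a \<in> A" "b \<in> A" and s: "\<And>s. s \<in> A \<Longrightarrow> a * s * b \<in> P"
  \<comment> \<open>The ideal generated by \<open>c\<close>, taken as the intersection of all ideals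
    containing \<open>c\<close>; this avoids writing its elements as sums of products.\<close>
  define I where "I = (\<lambda>c. {x \<in> A. \<forall>J. ideal J (subring_rec A) \<longrightarrow> c \<in> J \<longrightarrow> x \<in> J})"
  have I: "ideal (I c) (subring_rec A)" "c \<in> A \<Longrightarrow> c \<in> I c" for c
    unfolding ideal_subring_rec_iff I_def
    by (auto simp: unital_subring_closed unital_subring_closed')
  \<comment> \<open>The \<open>x\<close> with \<open>x A b\<close> inside \<open>P\<close> form an
    ideal containing \<open>a\<close>, hence containing \<open>I a\<close>. The same argument on the
    other side, for a fixed element of \<open>I a\<close>, then covers \<open>I b\<close>.\<close>
  let ?J1 = "{x \<in> A. \<forall>s\<in>A. x * s * b \<in> P}"
  have "ideal ?J1 (subring_rec A)" unfolding ideal_subring_rec_iff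
  proof (intro conjI ballI)
    fix x r assume x: "x \<in> ?J1" and r: "r \<in> A"
    show "r * x \<in> ?J1" using x r 1(4) by (auto simp: unital_subring_closed mult.assoc)
    have "x * (r * s) * b \<in> P" if "s \<in> A" for s
      using x unital_subring_closed(3)[OF r that] by simp
    then show "x * r \<in> ?J1" using x r by (simp add: unital_subring_closed mult.assoc)
  qed (use 1 in \<open>auto simp: unital_subring_closed unital_subring_closed' algebra_simps\<close>)
  then have J1: "I a \<subseteq> ?J1" using ab s unfolding I_def by blast
  have "x * y \<in> P" if "x \<in> I a" "y \<in> I b" for x y
  proof -
    let ?J2 = "{y \<in> A. \<forall>s\<in>A. x * s * y \<in> P}"
    have x: "x \<in> A" using that(1) by (simp add: I_def)
    have "ideal ?J2 (subring_rec A)" unfolding ideal_subring_rec_iff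
    proof (intro conjI ballI)
      fix z r assume z: "z \<in> ?J2" and r: "r \<in> A"
      have "x * s * (r * z) \<in> P" if "s \<in> A" for s
      proof -
        have "x * (s * r) * z \<in> P" using z unital_subring_closed(3)[OF that r] by blast
        then show ?thesis by (simp add: mult.assoc)
      qed
      then show "r * z \<in> ?J2" using z r by (simp add: unital_subring_closed)
      have "x * s * (z * r) \<in> P" if "s \<in> A" for s
        using z r that 1(5)[of "x * s * z" r] by (simp add: mult.assoc)
      then show "z * r \<in> ?J2" using z r by (simp add: unital_subring_closed)
    qed (use 1 in \<open>auto simp: unital_subring_closed unital_subring_closed' algebra_simps\<close>)
    moreover have "b \<in> ?J2" using J1 that(1) ab by blast
    ultimately have "y \<in> ?J2" using that(2) unfolding I_def by blast
    then show ?thesis using unital_subring_closed(1) by force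
  qed
  then have "I a \<subseteq> P \<or> I b \<subseteq> P" by (intro pr I) auto
  then show "a \<in> P \<or> b \<in> P" using I(2) ab by blast
qed

lemma Spec_subring_recI:
  assumes "P \<subseteq> A" "0 \<in> P" "\<And>a b. a \<in> P \<Longrightarrow> b \<in> P \<Longrightarrow> a + b \<in> P"
    "\<And>a r. a \<in> P \<Longrightarrow> r \<in> A \<Longrightarrow> r * a \<in> P" "\<And>a r. a \<in> P \<Longrightarrow> r \<in> A \<Longrightarrow> a * r \<in> P"
    "1 \<notin> P"
    "\<And>a b. a \<in> A - P \<Longrightarrow> b \<in> A - P \<Longrightarrow> \<exists>s\<in>A. a * s * b \<notin> P"
  shows "P \<in> Spec (subring_rec A)"
  unfolding Spec_def prime_ideal_def mem_Collect_eq
proof (intro conjI allI impI)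
  show "ideal P (subring_rec A)" using assms by (simp add: ideal_subring_rec_iff)
  show "P \<noteq> carrier (subring_rec A)" using assms(6) unital_subring_closed(1) by auto
  fix I J assume I: "ideal I (subring_rec A)" and J: "ideal J (subring_rec A)"
    and IJ: "\<forall>a\<in>I. \<forall>b\<in>J. a \<otimes>\<^bsub>subring_rec A\<^esub> b \<in> P"
  show "I \<subseteq> P \<or> J \<subseteq> P"
  proof (rule ccontr)
    assume "\<not> (I \<subseteq> P \<or> J \<subseteq> P)"
    then obtain a b where ab: "a \<in> I" "a \<notin> P" "b \<in> J" "b \<notin> P" by blast
    then have "a \<in> A - P" "b \<in> A - P" using I J by (auto simp: ideal_subring_rec_iff)
    then obtain s where "s \<in> A" "a * s * b \<notin> P" using assms(7) by blast
    moreover have "a * s \<in> I" using I ab \<open>s \<in> A\<close> by (auto simp: ideal_subring_rec_iff)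
    ultimately show False using IJ ab by simp
  qed
qed

end

section \<open>Laurent polynomial rings: primes, integrality and rank\<close>

section \<open>Monoid algebras over functions on variables\<close>

abbreviation "single \<equiv> Poly_Mapping.single"
abbreviation "lookup \<equiv> Poly_Mapping.lookup"
abbreviation "keys \<equiv> Poly_Mapping.keys"

definition supp_on :: "nat set \<Rightarrow> (nat \<Rightarrow> 'g::monoid_add) set" where
  "supp_on I = {m. \<forall>i. i \<notin> I \<longrightarrow> m i = 0}"

definition alg_on :: "nat set \<Rightarrow> ((nat \<Rightarrow> 'g::monoid_add) \<Rightarrow>\<^sub>0 'k::field) set" where
  "alg_on I = {f. keys f \<subseteq> supp_on I}"

lemma supp_on_closed [simp]:
  "0 \<in> supp_on I" "u \<in> supp_on I \<Longrightarrow> v \<in> supp_on I \<Longrightarrow> u + v \<in> supp_on I"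
  by (auto simp: supp_on_def)

lemma supp_on_mono: "I \<subseteq> J \<Longrightarrow> supp_on I \<subseteq> supp_on J"
  by (auto simp: supp_on_def)

lemma alg_on_mono: "I \<subseteq> J \<Longrightarrow> alg_on I \<subseteq> alg_on J"
  using supp_on_mono[of I J] by (auto simp: alg_on_def)

lemma unital_subring_alg_on:
  "unital_subring (alg_on I :: ((nat \<Rightarrow> 'g::monoid_add) \<Rightarrow>\<^sub>0 'k::field) set)"
  unfolding unital_subring_def
proof (intro conjI ballI)
  show "1 \<in> (alg_on I :: ((nat \<Rightarrow> 'g) \<Rightarrow>\<^sub>0 'k) set)" by (simp add: alg_on_def)
  fix a b :: "(nat \<Rightarrow> 'g) \<Rightarrow>\<^sub>0 'k" assume ab: "a \<in> alg_on I" "b \<in> alg_on I"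
  show "a + b \<in> alg_on I" using ab Poly_Mapping.keys_add[of a b] by (auto simp: alg_on_def)
  have "keys (a * b) \<subseteq> {u + v | u v. u \<in> keys a \<and> v \<in> keys b}"
    by (rule keys_mult)
  then show "a * b \<in> alg_on I" using ab unfolding alg_on_def by (fastforce simp: subset_iff)
next
  fix a :: "(nat \<Rightarrow> 'g) \<Rightarrow>\<^sub>0 'k" assume "a \<in> alg_on I"
  moreover have "keys (- a) = keys a" by (auto simp: in_keys_iff)
  ultimately show "- a \<in> alg_on I" by (simp add: alg_on_def)
qed

abbreviation "alg_rec I \<equiv> subring_rec (alg_on I)"

lemmas alg_on_closed [simp] =
  unital_subring_closed[OF unital_subring_alg_on] unital_subring_closed'[OF unital_subring_alg_on]

lemmas alg_on_sum = unital_subring_sum[OF unital_subring_alg_on]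

lemma single_in_alg_on: "m \<in> supp_on I \<Longrightarrow> single m c \<in> alg_on I"
  by (simp add: alg_on_def)

lemma single_zero_in_alg_on [simp]: "single 0 c \<in> alg_on I"
  by (simp add: single_in_alg_on)

lemma poly_mapping_sum_single:
  "f = (\<Sum>m\<in>keys f. single m (lookup f m))"
  by (rule poly_mapping_eqI) (simp add: lookup_sum lookup_single when_def in_keys_iff)

lemma additive_sum:
  assumes "\<And>f g. F (f + g) = F f + (F g :: 'b::cancel_comm_monoid_add)"
  shows "F (sum h X) = (\<Sum>x\<in>X. F (h x :: 'a::comm_monoid_add))"
proof -
  have "F 0 = 0" using assms[of 0 0] by simp
  then show ?thesis by (induction X rule: infinite_finite_induct) (simp_all add: assms)
qed

text \<open>Reduces an identity to monomials; multilinear identities are proved by applying it once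
  per argument. Only additivity is asked because the coefficient stays inside
  \<open>single m c\<close>. The set \<open>M\<close> carries support conditions along.\<close>

lemma additive_eqI:
  fixes F G :: "('m \<Rightarrow>\<^sub>0 'k::comm_monoid_add) \<Rightarrow> 'b::cancel_comm_monoid_add"
  assumes F: "\<And>f g. F (f + g) = F f + F g" and G: "\<And>f g. G (f + g) = G f + G g"
    and eq: "\<And>m c. m \<in> M \<Longrightarrow> F (single m c) = G (single m c)"
    and f: "keys f \<subseteq> M"
  shows "F f = G f"
proof -
  have "F f = (\<Sum>m\<in>keys f. F (single m (lookup f m)))"
    using additive_sum[of F, OF F] poly_mapping_sum_single[of f] by metis
  also have "\<dots> = (\<Sum>m\<in>keys f. G (single m (lookup f m)))"
    using eq f by (intro sum.cong) auto
  also have "\<dots> = G f"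
    using additive_sum[of G, OF G] poly_mapping_sum_single[of f] by metis
  finally show ?thesis .
qed

lemma single_zero_commute:
  "f * single 0 (c::'k::field) = single 0 c * (f :: 'm::monoid_add \<Rightarrow>\<^sub>0 'k)"
  by (rule additive_eqI[of "\<lambda>f. f * _" "\<lambda>f. _ * f" UNIV]) (simp_all add: algebra_simps mult_single)

lemma single_split: "single m c = single 0 (c::'k::field) * single (m::'m::monoid_add) 1"
  by (simp add: mult_single)

definition lin_ext :: "('m \<Rightarrow> ('n::monoid_add \<Rightarrow>\<^sub>0 'k::field)) \<Rightarrow> ('m \<Rightarrow>\<^sub>0 'k) \<Rightarrow> ('n \<Rightarrow>\<^sub>0 'k)" where
  "lin_ext \<phi> f = (\<Sum>m\<in>keys f. single 0 (lookup f m) * \<phi> m)"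

lemma lin_ext_superset:
  assumes "finite X" "keys f \<subseteq> X"
  shows "lin_ext \<phi> f = (\<Sum>m\<in>X. single 0 (lookup f m) * \<phi> m)"
  unfolding lin_ext_def using assms by (intro sum.mono_neutral_left) (auto simp: in_keys_iff)

lemma lin_ext_single [simp]: "lin_ext \<phi> (single m c) = single 0 c * \<phi> m"
  by (subst lin_ext_superset[of "{m}"]) auto

lemma lin_ext_zero [simp]: "lin_ext \<phi> 0 = 0"
  by (simp add: lin_ext_def)

lemma lin_ext_add [simp]: "lin_ext \<phi> (f + g) = lin_ext \<phi> f + lin_ext \<phi> g"
proof -
  let ?X = "keys f \<union> keys g"
  have "keys (f + g) \<subseteq> ?X" by (rule Poly_Mapping.keys_add)
  then show ?thesis
    by (simp add: lin_ext_superset[of ?X] lookup_add single_add algebra_simps sum.distrib)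
qed

lemma lin_ext_uminus [simp]: "lin_ext \<phi> (- f) = - lin_ext \<phi> f"
  using lin_ext_add[of \<phi> f "- f"] by (simp add: eq_neg_iff_add_eq_0 add.commute)

lemma lin_ext_diff [simp]: "lin_ext \<phi> (f - g) = lin_ext \<phi> f - lin_ext \<phi> g"
  using lin_ext_add[of \<phi> f "- g"] by simp

lemma lin_ext_sum: "lin_ext \<phi> (sum h X) = (\<Sum>x\<in>X. lin_ext \<phi> (h x))"
  by (rule additive_sum) simp

lemma lin_ext_scale: "lin_ext \<phi> (single 0 c * f) = single 0 c * lin_ext \<phi> (f :: 'm::monoid_add \<Rightarrow>\<^sub>0 'k::field)"
  by (rule additive_eqI[of "\<lambda>f. lin_ext \<phi> (_ * f)" "\<lambda>f. _ * lin_ext \<phi> f" UNIV])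
     (simp_all add: algebra_simps mult_single flip: mult.assoc)

lemma lin_ext_in_alg_on:
  assumes "\<And>m. m \<in> keys f \<Longrightarrow> \<phi> m \<in> alg_on I"
  shows "lin_ext \<phi> f \<in> alg_on I"
  unfolding lin_ext_def using assms by (intro alg_on_sum alg_on_closed) auto

section \<open>Laurent polynomials in one distinguished variable\<close>

type_synonym 'k laurent = "(nat \<Rightarrow> int) \<Rightarrow>\<^sub>0 'k"

definition var_pow :: "nat \<Rightarrow> int \<Rightarrow> 'k::field laurent" where
  "var_pow i k = single (\<lambda>j. if j = i then k else 0) 1"

definition var_coeff :: "nat \<Rightarrow> int \<Rightarrow> 'k::field laurent \<Rightarrow> 'k laurent" where
  "var_coeff i k = lin_ext (\<lambda>e. if e i = k then single (e(i := 0)) 1 else 0)"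

definition var_exps :: "nat \<Rightarrow> 'k::field laurent \<Rightarrow> int set" where
  "var_exps i f = (\<lambda>e. e i) ` keys f"

lemma finite_var_exps [simp]: "finite (var_exps i f)"
  by (simp add: var_exps_def)

lemma var_pow_add: "var_pow i a * var_pow i b = var_pow i (a + b)"
  by (simp add: var_pow_def mult_single plus_fun_def if_distrib cong: if_cong)

lemma var_pow_0 [simp]: "var_pow i 0 = 1"
  by (simp add: var_pow_def single_one flip: zero_fun_def)

lemma var_pow_power: "var_pow i a ^ n = var_pow i (int n * a)"
  by (induction n) (simp_all add: var_pow_add algebra_simps)

lemma var_pow_in_alg_on: "i \<in> I \<Longrightarrow> var_pow i k \<in> alg_on I"
  by (auto simp: var_pow_def supp_on_def intro!: single_in_alg_on)

lemma var_coeff_linear [simp]: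
  "var_coeff i k 0 = 0" "var_coeff i k (f + g) = var_coeff i k f + var_coeff i k g"
  "var_coeff i k (- f) = - var_coeff i k f" "var_coeff i k (f - g) = var_coeff i k f - var_coeff i k g"
  by (simp_all add: var_coeff_def)

lemma var_coeff_sum: "var_coeff i k (sum h X) = (\<Sum>x\<in>X. var_coeff i k (h x))"
  by (simp add: var_coeff_def lin_ext_sum)

lemma var_coeff_in_alg_on:
  assumes "f \<in> alg_on I" shows "var_coeff i k f \<in> alg_on (I - {i})"
  unfolding var_coeff_def
  by (rule lin_ext_in_alg_on) (use assms in \<open>auto simp: alg_on_def supp_on_def subset_iff\<close>)

lemma var_coeff_notin_exps: "k \<notin> var_exps i f \<Longrightarrow> var_coeff i k f = 0"
  by (auto simp: var_coeff_def lin_ext_def var_exps_def intro!: sum.neutral)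

lemma var_coeff_expand:
  "f = (\<Sum>k\<in>var_exps i f. var_coeff i k f * var_pow i k)"
proof -
  \<comment> \<open>\<open>var_exps i f\<close> depends on \<open>f\<close>, so the claim is not
    visibly additive. A fixed finite set \<open>K\<close> containing all exponents that occur makes
    both sides additive.\<close>
  have *: "f = (\<Sum>k\<in>K. var_coeff i k f * var_pow i k)" if "keys f \<subseteq> {e. e i \<in> K}" "finite K" for K
  proof (rule additive_eqI[OF _ _ _ that(1), where F = "\<lambda>f. f"])
    fix m c assume m: "m \<in> {e. e i \<in> K}"
    have "(\<Sum>k\<in>K. var_coeff i k (single m c) * var_pow i k) =
          (\<Sum>k\<in>K. if m i = k then single m c else 0)"
      by (intro sum.cong) (auto simp: var_coeff_def var_pow_def mult_single plus_fun_def fun_eq_iff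
          intro!: arg_cong2[of _ _ _ _ single])
    then show "single m c = (\<Sum>k\<in>K. var_coeff i k (single m c) * var_pow i k)"
      using m that(2) by simp
  qed (simp_all add: algebra_simps sum.distrib)
  show ?thesis by (rule *) (auto simp: var_exps_def)
qed

lemma var_coeff_mult_var_pow: "var_coeff i k (f * var_pow i j) = var_coeff i (k - j) f"
proof (rule additive_eqI[of "\<lambda>f. var_coeff i k (f * var_pow i j)" "var_coeff i (k - j)" UNIV])
  fix m c
  have eq: "m i + j = k \<longleftrightarrow> m i = k - j" by auto
  have "(m + (\<lambda>j'. if j' = i then j else 0))(i := 0) = m(i := 0)" by auto
  then show "var_coeff i k (single m c * var_pow i j) = var_coeff i (k - j) (single m c)"
    by (simp add: var_coeff_def var_pow_def mult_single eq)
qed (simp_all add: algebra_simps)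

lemma var_coeff_const_mult:
  fixes c f :: "'k::field laurent"
  assumes "c \<in> alg_on (- {i})"
  shows "var_coeff i k (c * f) = c * var_coeff i k f"
proof (rule additive_eqI[of "\<lambda>f. var_coeff i k (c * f)" "\<lambda>f. c * var_coeff i k f" UNIV])
  fix m and d :: 'k
  show "var_coeff i k (c * single m d) = c * var_coeff i k (single m d)"
  proof (rule additive_eqI[of "\<lambda>c. var_coeff i k (c * _)" "\<lambda>c. c * _" "supp_on (- {i})"])
    fix u :: "nat \<Rightarrow> int" and b :: 'k
    assume "u \<in> supp_on (- {i})"
    then have "u i = 0" "(u + m)(i := 0) = u + m(i := 0)" by (auto simp: supp_on_def)
    then show "var_coeff i k (single u b * single m d) =
               single u b * var_coeff i k (single m d)"
      by (simp add: var_coeff_def mult_single)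
  qed (use assms in \<open>simp_all add: algebra_simps alg_on_def\<close>)
qed (simp_all add: algebra_simps)

lemma var_coeff_const:
  assumes "c \<in> alg_on (- {i})"
  shows "var_coeff i k c = (if k = 0 then c else 0)"
proof -
  have "var_coeff i k (1 :: 'a laurent) = (if k = 0 then 1 else 0)"
    unfolding single_one[symmetric] var_coeff_def by (auto simp: fun_upd_def zero_fun_def mult_single plus_fun_def)
  then show ?thesis using var_coeff_const_mult[OF assms, of k 1] by simp
qed

lemma var_coeff_in_compl [simp]: "var_coeff i k f \<in> alg_on (- {i})"
  using var_coeff_in_alg_on[of f UNIV i k] by (simp add: alg_on_def supp_on_def Compl_eq_Diff_UNIV)

lemma var_coeff_mult:
  "var_coeff i k (f * g) = (\<Sum>a\<in>var_exps i f. var_coeff i a f * var_coeff i (k - a) g)"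
proof -
  have "var_coeff i k (f * g) = var_coeff i k ((\<Sum>a\<in>var_exps i f. var_coeff i a f * var_pow i a) * g)"
    using var_coeff_expand[of f i] by simp
  also have "\<dots> = (\<Sum>a\<in>var_exps i f. var_coeff i k (var_coeff i a f * (g * var_pow i a)))"
    by (simp add: sum_distrib_left sum_distrib_right var_coeff_sum mult_ac)
  also have "\<dots> = (\<Sum>a\<in>var_exps i f. var_coeff i a f * var_coeff i (k - a) g)"
    by (simp add: var_coeff_const_mult var_coeff_mult_var_pow)
  finally show ?thesis .
qed

section \<open>Primes of Laurent polynomial rings\<close>

abbreviation LSpec :: "nat set \<Rightarrow> 'k::field laurent set set" where
  "LSpec I \<equiv> Spec (alg_rec I)"

lemmas LSpecD = Spec_subring_recD[OF unital_subring_alg_on]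

lemma LSpec_prime:
  assumes "P \<in> LSpec I" "a \<in> alg_on I" "b \<in> alg_on I" "a * b \<in> P"
  shows "a \<in> P \<or> b \<in> P"
proof (rule LSpecD(9)[OF assms(1-3)])
  fix s assume "s \<in> (alg_on I :: 'a laurent set)"
  then have "s * (a * b) \<in> P" by (rule LSpecD(4)[OF assms(1) assms(4)])
  then show "a * s * b \<in> P" by (simp add: mult_ac)
qed

lemma LSpec_power:
  assumes "P \<in> LSpec I" "a \<in> alg_on I" "a ^ n \<in> P"
  shows "a \<in> P"
  using assms(3)
proof (induction n)
  case 0
  then show ?case using LSpecD(7)[OF assms(1)] by simp
next
  case (Suc n)
  then show ?case using LSpec_prime[OF assms(1,2), of "a ^ n"] assms(2) by auto
qed

lemma LSpec_diff: "P \<in> LSpec I \<Longrightarrow> a \<in> P \<Longrightarrow> b \<in> P \<Longrightarrow> a - b \<in> P"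
  using LSpecD(3)[of P I a "- b"] LSpecD(6)[of P I b] by simp

lemma LSpecI:
  fixes P :: "'k::field laurent set"
  assumes "P \<subseteq> alg_on I" "0 \<in> P" "\<And>a b. a \<in> P \<Longrightarrow> b \<in> P \<Longrightarrow> a + b \<in> P"
    "\<And>a r. a \<in> P \<Longrightarrow> r \<in> alg_on I \<Longrightarrow> r * a \<in> P" "1 \<notin> P"
    "\<And>a b. a \<in> alg_on I \<Longrightarrow> b \<in> alg_on I \<Longrightarrow> a \<notin> P \<Longrightarrow> b \<notin> P \<Longrightarrow> a * b \<notin> P"
  shows "P \<in> LSpec I"
  using assms by (intro Spec_subring_recI[OF unital_subring_alg_on]) (auto simp: mult.commute intro!: bexI[of _ 1])

lemma LSpec_contract:
  assumes P: "P \<in> LSpec I" and JI: "J \<subseteq> I"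
  shows "P \<inter> alg_on J \<in> LSpec J"
proof (rule LSpecI)
  fix a r :: "'a laurent" assume "a \<in> P \<inter> alg_on J" "r \<in> alg_on J"
  then show "r * a \<in> P \<inter> alg_on J" using LSpecD(4)[OF P, of a r] alg_on_mono[OF JI] by auto
next
  fix a b :: "'a laurent" assume "a \<in> alg_on J" "b \<in> alg_on J" "a \<notin> P \<inter> alg_on J" "b \<notin> P \<inter> alg_on J"
  then show "a * b \<notin> P \<inter> alg_on J" using LSpec_prime[OF P, of a b] alg_on_mono[OF JI] by auto
qed (use LSpecD(2,3,7)[OF P] in auto)

text \<open>Gauss's argument: in the product coefficient of index \<open>a + b\<close> every summand
  but one has a factor beyond an extreme index and so lies in \<open>P\<close>, while the remaining
  one does not. The sign of \<open>s\<close> selects highest or lowest degree, so one proof serves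
  both ends.\<close>

lemma var_coeff_extreme:
  assumes P: "P \<in> LSpec I" and i: "i \<notin> I" and f: "f \<in> alg_on (insert i I)" and g: "g \<in> alg_on (insert i I)"
    and a: "var_coeff i a f \<notin> P" "\<And>a'. s * a < s * a' \<Longrightarrow> var_coeff i a' f \<in> P"
    and b: "var_coeff i b g \<notin> P" "\<And>b'. s * b < s * b' \<Longrightarrow> var_coeff i b' g \<in> P" and s: "(s::int) \<noteq> 0"
  shows "var_coeff i (a + b) (f * g) \<notin> P"
proof
  assume *: "var_coeff i (a + b) (f * g) \<in> P"
  note PD = LSpecD[OF P]
  have in_I: "var_coeff i k f \<in> alg_on I" "var_coeff i k g \<in> alg_on I" for k
    using var_coeff_in_alg_on[OF f, of i k] var_coeff_in_alg_on[OF g, of i k] i by simp_all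
  have term_in: "var_coeff i c f * var_coeff i (a + b - c) g \<in> P" if "c \<noteq> a" for c
  proof (cases "s * a < s * c")
    case True
    then show ?thesis using a(2) PD(5) in_I by blast
  next
    case False
    then have "s * c < s * a" using that s by (simp add: linorder_less_linear order_less_le)
    then have "s * b < s * (a + b - c)" by (simp add: algebra_simps)
    then show ?thesis using b(2) PD(4) in_I by blast
  qed
  have aexp: "a \<in> var_exps i f" using a(1) PD(2) var_coeff_notin_exps by metis
  have "var_coeff i (a + b) (f * g) = var_coeff i a f * var_coeff i b g +
      (\<Sum>c\<in>var_exps i f - {a}. var_coeff i c f * var_coeff i (a + b - c) g)"
    unfolding var_coeff_mult by (subst sum.remove[OF _ aexp]) simp_all
  moreover have "(\<Sum>c\<in>var_exps i f - {a}. var_coeff i c f * var_coeff i (a + b - c) g) \<in> P"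
    by (rule PD(8)) (use term_in in auto)
  ultimately have "var_coeff i a f * var_coeff i b g \<in> P"
    using LSpec_diff[OF P *] by fastforce
  from LSpec_prime[OF P in_I this] show False using a(1) b(1) by blast
qed

lemma var_coeff_extreme_exists:
  assumes P: "P \<in> LSpec I" and k: "var_coeff i k f \<notin> P" and s: "(s::int) \<noteq> 0"
  shows "\<exists>a. var_coeff i a f \<notin> P \<and> (\<forall>a'. s * a < s * a' \<longrightarrow> var_coeff i a' f \<in> P)"
proof -
  let ?K = "{k. var_coeff i k f \<notin> P}"
  have "?K \<subseteq> var_exps i f" using var_coeff_notin_exps LSpecD(2)[OF P] by force
  then have fin: "finite ((*) s ` ?K)" by (simp add: finite_subset)
  have "(*) s ` ?K \<noteq> {}" using k by blast
  then have "Max ((*) s ` ?K) \<in> (*) s ` ?K" by (rule Max_in[OF fin])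
  then obtain a where a: "a \<in> ?K" "Max ((*) s ` ?K) = s * a" by blast
  have "s * a' \<le> s * a" if "a' \<in> ?K" for a' using Max_ge[OF fin] a(2) that by auto
  then show ?thesis using a(1) by (intro exI[of _ a]) (auto simp: not_less[symmetric])
qed

text \<open>This is the extended ideal \<open>P[x_i, x_i^-1]\<close>; describing it by coefficients
  avoids generators.\<close>

definition var_extend :: "nat set \<Rightarrow> nat \<Rightarrow> 'k::field laurent set \<Rightarrow> 'k laurent set" where
  "var_extend I i P = {f \<in> alg_on (insert i I). \<forall>k. var_coeff i k f \<in> P}"

lemma LSpec_var_extend:
  fixes P :: "'k::field laurent set"
  assumes P: "P \<in> LSpec I" and i: "i \<notin> I"
  shows "var_extend I i P \<in> LSpec (insert i I)"
proof (rule LSpecI)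
  note PD = LSpecD[OF P]
  show "0 \<in> var_extend I i P" using PD(2) by (simp add: var_extend_def)
  show "1 \<notin> var_extend I i P"
    using PD(7) var_coeff_const[of "1 :: 'k laurent" i 0] by (auto simp: var_extend_def intro!: exI[of _ 0])
  show "a + b \<in> var_extend I i P" if "a \<in> var_extend I i P" "b \<in> var_extend I i P" for a b
    using that PD(3) by (simp add: var_extend_def)
  show "r * a \<in> var_extend I i P" if "a \<in> var_extend I i P" "r \<in> alg_on (insert i I)" for a r
  proof -
    have "var_coeff i j r \<in> alg_on I" for j using var_coeff_in_alg_on[OF that(2), of i j] i by simp
    then have "var_coeff i k (r * a) \<in> P" for k
      unfolding var_coeff_mult using that(1) by (intro PD(8) PD(4)) (auto simp: var_extend_def)
    then show ?thesis using that by (simp add: var_extend_def)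
  qed
  fix a b assume a: "a \<in> alg_on (insert i I)" "a \<notin> var_extend I i P"
    and b: "b \<in> alg_on (insert i I)" "b \<notin> var_extend I i P"
  then obtain k l where k: "var_coeff i k a \<notin> P" and l: "var_coeff i l b \<notin> P"
    by (auto simp: var_extend_def)
  obtain k' where k': "var_coeff i k' a \<notin> P" "\<And>j. 1 * k' < 1 * j \<Longrightarrow> var_coeff i j a \<in> P"
    using var_coeff_extreme_exists[OF P k, of 1] by fastforce
  obtain l' where l': "var_coeff i l' b \<notin> P" "\<And>j. 1 * l' < 1 * j \<Longrightarrow> var_coeff i j b \<in> P"
    using var_coeff_extreme_exists[OF P l, of 1] by fastforce
  show "a * b \<notin> var_extend I i P"
    using var_coeff_extreme[OF P i a(1) b(1) k' l'(1), of 1] l'(2) unfolding var_extend_def by auto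
qed (auto simp: var_extend_def)

lemma var_coeff_all_zero: "(\<And>k. var_coeff i k f = 0) \<Longrightarrow> f = 0"
  using var_coeff_expand[of f i] by simp

lemma alg_on_empty_single:
  assumes "f \<in> alg_on {}" shows "f = single 0 (lookup f 0)"
proof (rule poly_mapping_eqI)
  fix m
  have "m = 0" if "lookup f m \<noteq> 0" for m
    using assms that by (auto simp: alg_on_def supp_on_def subset_iff in_keys_iff)
  then show "lookup f m = lookup (single 0 (lookup f 0)) m"
    by (auto simp: lookup_single when_def)
qed

text \<open>The zero ideal extends to the zero ideal when a variable is added. Its primeness says
  that the Laurent ring is a domain, obtained here without an order on the monomials.\<close>

lemma zero_LSpec:
  assumes "finite I" shows "{0} \<in> (LSpec I :: 'k::field laurent set set)"
  using assms
proof (induction I)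
  case empty
  show ?case
  proof (rule LSpecI)
    fix a b :: "'k laurent" assume "a \<in> alg_on {}" "b \<in> alg_on {}" and nz: "a \<notin> {0}" "b \<notin> {0}"
    then obtain c d where cd: "a = single 0 c" "b = single 0 d"
      using alg_on_empty_single by metis
    then have "c * d \<noteq> 0" using nz by auto
    then have "lookup (a * b) 0 \<noteq> 0" using cd by (simp add: mult_single)
    then show "a * b \<notin> {0}" by auto
  qed simp_all
next
  case (insert i I)
  have "var_extend I i {0} = {0 :: 'k laurent}" using var_coeff_all_zero by (auto simp: var_extend_def)
  then show ?case using LSpec_var_extend[OF insert.IH insert.hyps(2)] by simp
qed

lemma alg_on_no_zero_divisors:
  assumes "finite I" "a \<in> alg_on I" "b \<in> alg_on I" "a \<noteq> 0" "b \<noteq> 0"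
  shows "a * b \<noteq> (0 :: 'k::field laurent)"
  using LSpec_prime[OF zero_LSpec[OF assms(1)] assms(2,3)] assms(4,5) by auto

lemma alg_on_prod_nonzero:
  assumes "finite I" "finite X" "\<And>x. x \<in> X \<Longrightarrow> f x \<in> alg_on I \<and> f x \<noteq> (0 :: 'k::field laurent)"
  shows "prod f X \<in> alg_on I \<and> prod f X \<noteq> 0"
  using assms(2,3) by (induction X) (auto simp: alg_on_no_zero_divisors[OF assms(1)])

lemma alg_on_power_nonzero:
  assumes "finite I" "a \<in> alg_on I" "a \<noteq> (0 :: 'k::field laurent)"
  shows "a ^ n \<noteq> 0"
  by (induction n) (use assms in \<open>auto simp: alg_on_no_zero_divisors[OF assms(1)]\<close>)

section \<open>Integrality by the determinant trick\<close>

lemma unital_subring_prod: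
  fixes A :: "'a::comm_ring_1 set"
  assumes "unital_subring A" "\<And>i. i \<in> X \<Longrightarrow> f i \<in> A"
  shows "prod f X \<in> A"
  using assms(2)
  by (induction X rule: infinite_finite_induct) (simp_all add: unital_subring_closed[OF assms(1)])

lemma det_in_unital_subring:
  fixes A :: "'a::comm_ring_1 set"
  assumes A: "unital_subring A" and M: "M \<in> carrier_mat n n"
    and e: "\<And>i j. i < n \<Longrightarrow> j < n \<Longrightarrow> M $$ (i, j) \<in> A"
  shows "det M \<in> A"
proof -
  note c = unital_subring_closed[OF A] unital_subring_closed'[OF A]
  have sgn: "(signof p :: 'a) \<in> A" for p :: "nat \<Rightarrow> nat" by (cases p rule: sign_cases) (simp_all add: c)
  show ?thesis unfolding det_def'[OF M]
  proof (rule unital_subring_sum[OF A])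
    fix p assume "p \<in> {p. p permutes {0..<n}}"
    then have "p i < n" if "i < n" for i using that permutes_in_image[of p "{0..<n}" i] by auto
    then have "(\<Prod>i = 0..<n. M $$ (i, p i)) \<in> A" by (intro unital_subring_prod[OF A] e) auto
    then show "signof p * (\<Prod>i = 0..<n. M $$ (i, p i)) \<in> A" using sgn c(3) by blast
  qed
qed

text \<open>Multiply the system by the adjugate. Since \<open>Q\<close> absorbs only elements of
  \<open>A\<close>, the adjugate must be shown to have its entries in \<open>A\<close> too.\<close>

lemma det_trick:
  fixes A Q :: "'a::comm_ring_1 set"
  assumes A: "unital_subring A" and M: "M \<in> carrier_mat n n"
    and e: "\<And>i j. i < n \<Longrightarrow> j < n \<Longrightarrow> M $$ (i, j) \<in> A"
    and Q: "0 \<in> Q" "\<And>a b. a \<in> Q \<Longrightarrow> b \<in> Q \<Longrightarrow> a + b \<in> Q" "\<And>a r. a \<in> Q \<Longrightarrow> r \<in> A \<Longrightarrow> r * a \<in> Q"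
    and v: "\<And>i. i < n \<Longrightarrow> (\<Sum>j<n. M $$ (i, j) * v j) \<in> Q" and j: "j < n"
  shows "det M * v j \<in> Q"
proof -
  let ?B = "adj_mat M"
  have B: "?B \<in> carrier_mat n n" "?B * M = det M \<cdot>\<^sub>m 1\<^sub>m n" using adj_mat[OF M] by auto
  have BA: "?B $$ (i, k) \<in> A" if "i < n" "k < n" for i k
  proof -
    have "mat_delete M k i \<in> carrier_mat (n - 1) (n - 1)" using mat_delete_carrier[OF M] .
    moreover have "mat_delete M k i $$ (i', j') \<in> A" if "i' < n - 1" "j' < n - 1" for i' j'
      using that M by (auto simp: mat_delete_def intro!: e)
    ultimately have "det (mat_delete M k i) \<in> A" by (rule det_in_unital_subring[OF A])
    moreover have "(- 1) ^ m \<in> A" for m :: nat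
      by (simp add: unital_subring_closed[OF A] unital_subring_closed'[OF A])
    ultimately show ?thesis
      using that M by (simp add: adj_mat_def cofactor_def unital_subring_closed[OF A])
  qed
  have "det M * v j = (\<Sum>k<n. (det M \<cdot>\<^sub>m 1\<^sub>m n) $$ (j, k) * v k)"
    using j by (subst sum.remove[of _ j]) auto
  also have "\<dots> = (\<Sum>k<n. (\<Sum>i<n. ?B $$ (j, i) * M $$ (i, k)) * v k)"
    unfolding B(2)[symmetric] using j B(1) M
    by (intro sum.cong refl arg_cong2[of _ _ _ _ "(*)"]) (auto simp: scalar_prod_def lessThan_atLeast0)
  also have "\<dots> = (\<Sum>i<n. ?B $$ (j, i) * (\<Sum>k<n. M $$ (i, k) * v k))"
    by (simp add: sum_distrib_left sum_distrib_right mult.assoc) (rule sum.swap)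
  also have "\<dots> \<in> Q"
  proof -
    have sumQ: "sum f X \<in> Q" if "\<And>i. i \<in> X \<Longrightarrow> f i \<in> Q" for f and X :: "nat set"
      using that by (induction X rule: infinite_finite_induct) (use Q in auto)
    show ?thesis by (rule sumQ) (use Q(3) v BA j in auto)
  qed
  finally show ?thesis .
qed

text \<open>Cayley-Hamilton in the form used for integrality: \<open>h\<close> acts on the
  \<open>v j\<close> modulo \<open>Q\<close> by a matrix over \<open>R\<close>, and the
  characteristic polynomial of that matrix annihilates them modulo \<open>Q\<close>.\<close>

lemma integral_relation:
  fixes A R Q :: "'a::comm_ring_1 set" and n :: nat
  assumes A: "unital_subring A" and R: "unital_subring R" "R \<subseteq> A" and h: "h \<in> A"
    and Q: "0 \<in> Q" "\<And>a b. a \<in> Q \<Longrightarrow> b \<in> Q \<Longrightarrow> a + b \<in> Q" "\<And>a r. a \<in> Q \<Longrightarrow> r \<in> A \<Longrightarrow> r * a \<in> Q"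
    and a: "\<And>i j. i < n \<Longrightarrow> j < n \<Longrightarrow> a i j \<in> R"
    and v: "\<And>i. i < n \<Longrightarrow> h * v i - (\<Sum>j<n. a i j * v j) \<in> Q"
  shows "\<exists>P. lead_coeff P = 1 \<and> (\<forall>k. coeff P k \<in> R) \<and> (\<forall>j<n. poly P h * v j \<in> Q)"
proof -
  define M where "M = Matrix.mat n n (\<lambda>(i, j). a i j)"
  have M: "M \<in> carrier_mat n n" by (simp add: M_def)
  \<comment> \<open>Evaluating the characteristic matrix at \<open>h\<close> gives \<open>h\<close>
    times the identity minus \<open>M\<close>, whose product with the vector \<open>v\<close> has
    entries in \<open>Q\<close>.\<close>
  define N where "N = map_mat (\<lambda>p. poly p h) (char_poly_matrix M)"
  have ev: "comm_ring_hom (\<lambda>p. poly p h)" by unfold_locales auto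
  have N: "N \<in> carrier_mat n n" using M by (simp add: N_def)
  have Nij: "N $$ (i, j) = (if i = j then h else 0) - a i j" if "i < n" "j < n" for i j
    using that M by (auto simp: N_def char_poly_matrix_def M_def)
  have det: "poly (char_poly M) h = det N"
    unfolding N_def char_poly_def by (rule comm_ring_hom.hom_det[OF ev, symmetric])
  have RA: "a i j \<in> A" if "i < n" "j < n" for i j using a[OF that] R(2) by blast
  have "det N * v j \<in> Q" if j: "j < n" for j
  proof (rule det_trick[OF A N _ Q _ j])
    show "N $$ (i, j) \<in> A" if "i < n" "j < n" for i j
      using that RA h by (auto simp: Nij unital_subring_closed[OF A] unital_subring_closed'[OF A])
    fix i assume i: "i < n"
    have "(\<Sum>j<n. N $$ (i, j) * v j) = (\<Sum>j<n. (if i = j then h else 0) * v j) - (\<Sum>j<n. a i j * v j)"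
      using i by (simp add: Nij algebra_simps sum_subtractf)
    also have "(\<Sum>j<n. (if i = j then h else 0) * v j) = h * v i"
      using i by (subst sum.remove[of _ i]) auto
    finally show "(\<Sum>j<n. N $$ (i, j) * v j) \<in> Q" using v[OF i] by simp
  qed
  moreover have "lead_coeff (char_poly M) = 1" using degree_monic_char_poly[OF M] by simp
  moreover have "coeff (char_poly M) k \<in> R" for k
  proof -
    \<comment> \<open>Polynomials with coefficients in \<open>R\<close> are again a unital subring,
      now of the polynomial type, so the determinant lemma applies to the characteristic matrix
      itself.\<close>
    let ?RX = "{p. \<forall>k. coeff p k \<in> R}"
    note c = unital_subring_closed[OF R(1)] unital_subring_closed'[OF R(1)]
    have "unital_subring ?RX" unfolding unital_subring_def
      by (auto simp: c coeff_mult intro!: unital_subring_sum[OF R(1)])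
    moreover have "char_poly_matrix M $$ (i, j) \<in> ?RX" if "i < n" "j < n" for i j
      using that M a by (auto simp: char_poly_matrix_def M_def c coeff_pCons split: nat.split)
    ultimately have "det (char_poly_matrix M) \<in> ?RX"
      by (intro det_in_unital_subring[of _ _ n]) (use M in simp_all)
    then show ?thesis by (simp add: char_poly_def)
  qed
  ultimately show ?thesis using det by metis
qed

section \<open>Denominators for a maximal independent set of variables\<close>

abbreviation alg_indep :: "'k::field laurent set \<Rightarrow> nat set \<Rightarrow> bool" where
  "alg_indep q J \<equiv> q \<inter> alg_on J \<subseteq> {0}"

lemma var_coeff_expand_superset:
  assumes "finite K" "\<And>k. var_coeff i k f \<noteq> 0 \<Longrightarrow> k \<in> K"
  shows "f = (\<Sum>k\<in>K. var_coeff i k f * var_pow i k)"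
proof -
  have "f = (\<Sum>k\<in>K \<union> var_exps i f. var_coeff i k f * var_pow i k)"
    by (subst (1) var_coeff_expand[of f i], rule sum.mono_neutral_left)
       (use assms in \<open>auto simp: var_coeff_notin_exps\<close>)
  also have "\<dots> = (\<Sum>k\<in>K. var_coeff i k f * var_pow i k)"
    by (rule sum.mono_neutral_right) (use assms in \<open>auto, force\<close>)
  finally show ?thesis .
qed

text \<open>Take a nonzero element of \<open>q\<close> in the variables \<open>insert i J\<close>
  and multiply it by a power of the unit \<open>x_i\<close> so that the exponents of
  \<open>x_i\<close> start at 0. Both extreme coefficients are kept nonzero: the top one serves to
  reduce high powers of \<open>x_i\<close>, the bottom one to remove \<open>x_i^-1\<close>.\<close>

lemma dependent_variable_relation:
  fixes q :: "'k::field laurent set"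
  assumes q: "q \<in> LSpec I" and JI: "J \<subseteq> I" and indep: "alg_indep q J"
    and i: "i \<in> I - J" and dep: "\<not> alg_indep q (insert i J)"
  shows "\<exists>d c. 0 < d \<and> (\<forall>k\<le>d. c k \<in> alg_on J) \<and> c 0 \<noteq> 0 \<and> c d \<noteq> 0
     \<and> (\<Sum>k\<le>d::nat. c k * var_pow i (int k)) \<in> q"
proof -
  obtain r where r: "r \<in> q" "r \<in> alg_on (insert i J)" "r \<noteq> 0" using dep by blast
  let ?K = "{k. var_coeff i k r \<noteq> 0}"
  have fin: "finite ?K"
    by (rule finite_subset[of _ "var_exps i r"]) (use var_coeff_notin_exps in auto)
  have ne: "?K \<noteq> {}" using r(3) var_coeff_all_zero[of i r] by blast
  define a where "a = Min ?K"
  define b where "b = Max ?K"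
  define d where "d = nat (b - a)"
  define c where "c = (\<lambda>k. var_coeff i (a + int k) r)"
  have ab: "a \<in> ?K" "b \<in> ?K" "a \<le> b" "\<And>k. k \<in> ?K \<Longrightarrow> a \<le> k \<and> k \<le> b"
    using Min_in[OF fin ne] Max_in[OF fin ne] fin Min_le_iff[OF fin ne] unfolding a_def b_def by auto
  have "r = (\<Sum>k\<in>{a..b}. var_coeff i k r * var_pow i k)"
    by (rule var_coeff_expand_superset) (use ab in auto)
  also have "\<dots> = (\<Sum>k\<le>d. c k * var_pow i (a + int k))"
    by (rule sum.reindex_bij_witness[of _ "\<lambda>k. a + int k" "\<lambda>k. nat (k - a)"])
       (use ab(3) in \<open>auto simp: c_def d_def\<close>)
  also have "\<dots> = var_pow i a * (\<Sum>k\<le>d. c k * var_pow i (int k))"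
    by (simp add: sum_distrib_left var_pow_add[symmetric] mult_ac)
  finally have "var_pow i (- a) * r = (\<Sum>k\<le>d. c k * var_pow i (int k))"
    by (simp add: mult.assoc[symmetric] var_pow_add)
  moreover have "var_pow i (- a) \<in> alg_on I" using i by (simp add: var_pow_in_alg_on)
  ultimately have rel: "(\<Sum>k\<le>d. c k * var_pow i (int k)) \<in> q"
    using LSpecD(4)[OF q r(1)] by metis
  have cJ: "c k \<in> alg_on J" for k
    using var_coeff_in_alg_on[OF r(2), of i "a + int k"] i alg_on_mono[of "insert i J - {i}" J]
    by (auto simp: c_def)
  have c0: "c 0 \<noteq> 0" "c d \<noteq> 0" using ab(1-3) by (simp_all add: c_def d_def)
  have "0 < d"
  proof (rule ccontr)
    assume "\<not> 0 < d"
    then have "c 0 \<in> q" using rel by simp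
    then show False using indep cJ[of 0] c0(1) by blast
  qed
  then show ?thesis using cJ c0 rel by blast
qed

lemma single_eq_prod_var_pow:
  assumes "finite I" "e \<in> supp_on I"
  shows "(single e 1 :: 'k::field laurent) = (\<Prod>i\<in>I. var_pow i (e i))"
proof -
  have "(\<Prod>i\<in>A. var_pow i (e i)) = (single (\<lambda>j. if j \<in> A then e j else 0) 1 :: 'k laurent)"
    if "finite A" for A
    using that
  proof (induction A)
    case empty
    then show ?case by (simp add: single_one flip: zero_fun_def)
  next
    case (insert i A)
    have "(\<lambda>j. if j = i then e i else 0) + (\<lambda>j. if j \<in> A then e j else 0) =
          (\<lambda>j. if j \<in> insert i A then e j else 0)"
      using insert.hyps(2) by (auto simp: fun_eq_iff)
    then show ?case using insert by (simp add: var_pow_def mult_single)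
  qed
  moreover have "(\<lambda>j. if j \<in> I then e j else 0) = e" using assms(2) by (auto simp: supp_on_def)
  ultimately show ?thesis using assms(1) by simp
qed

text \<open>The module spanned by the monomials of the box is stable under the variables once these are
  multiplied by the product of all extreme coefficients of the chosen relations.\<close>

lemma exists_integral_denominator:
  fixes q :: "'k::field laurent set"
  assumes fin: "finite I" and q: "q \<in> LSpec I" and JI: "J \<subseteq> I" and indep: "alg_indep q J"
    and max: "\<And>i. i \<in> I - J \<Longrightarrow> \<not> alg_indep q (insert i J)"
  shows "\<exists>g\<in>alg_on J. g \<noteq> 0 \<and> (\<forall>f\<in>alg_on I. \<exists>N P. lead_coeff P = 1
           \<and> (\<forall>k. coeff P k \<in> alg_on J) \<and> poly P (g ^ N * f) \<in> q)"
proof -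
  note qD = LSpecD[OF q]
  have finJ: "finite J" using JI fin by (rule finite_subset)
  have JsubI: "x \<in> alg_on I" if "x \<in> alg_on J" for x :: "'k laurent" using that alg_on_mono[OF JI] by blast
  have "\<forall>i\<in>I - J. \<exists>d c. 0 < d \<and> (\<forall>k\<le>d. c k \<in> alg_on J) \<and> c 0 \<noteq> 0 \<and> c d \<noteq> 0
     \<and> (\<Sum>k\<le>d::nat. c k * var_pow i (int k)) \<in> q"
    using dependent_variable_relation[OF q JI indep] max by blast
  from bchoice[OF this] obtain d where "\<forall>i\<in>I - J. \<exists>c. 0 < d i \<and> (\<forall>k\<le>d i. c k \<in> alg_on J) \<and> c 0 \<noteq> 0
     \<and> c (d i) \<noteq> 0 \<and> (\<Sum>k\<le>d i. c k * var_pow i (int k)) \<in> q" by blast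
  from bchoice[OF this] obtain c where "\<forall>i\<in>I - J. 0 < d i \<and> (\<forall>k\<le>d i. c i k \<in> alg_on J) \<and> c i 0 \<noteq> 0
     \<and> c i (d i) \<noteq> 0 \<and> (\<Sum>k\<le>d i. c i k * var_pow i (int k)) \<in> q" by blast
  then have dc: "\<And>i. i \<in> I - J \<Longrightarrow> 0 < d i"
      "\<And>i k. i \<in> I - J \<Longrightarrow> k \<le> d i \<Longrightarrow> c i k \<in> alg_on J"
      "\<And>i. i \<in> I - J \<Longrightarrow> c i 0 \<noteq> 0" "\<And>i. i \<in> I - J \<Longrightarrow> c i (d i) \<noteq> 0"
      "\<And>i. i \<in> I - J \<Longrightarrow> (\<Sum>k\<le>d i::nat. c i k * var_pow i (int k)) \<in> q"
    by auto
  define g where "g = (\<Prod>i\<in>I - J. c i 0 * c i (d i))"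
  have "c i 0 * c i (d i) \<in> alg_on J \<and> c i 0 * c i (d i) \<noteq> 0" if "i \<in> I - J" for i
    using alg_on_no_zero_divisors[OF finJ, of "c i 0" "c i (d i)"] dc(2-4)[OF that] by simp
  then have g: "g \<in> alg_on J" "g \<noteq> 0"
    using alg_on_prod_nonzero[OF finJ, of "I - J" "\<lambda>i. c i 0 * c i (d i)"] fin
    unfolding g_def by blast+
  have g_split: "\<exists>g'\<in>alg_on J. g = g' * c i 0 * c i (d i)" if "i \<in> I - J" for i
  proof -
    have "g = (\<Prod>i\<in>I - J - {i}. c i 0 * c i (d i)) * c i 0 * c i (d i)"
      unfolding g_def using that fin by (subst prod.remove[of _ i]) (auto simp: mult_ac)
    moreover have "(\<Prod>i\<in>I - J - {i}. c i 0 * c i (d i)) \<in> alg_on J"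
      by (rule unital_subring_prod[OF unital_subring_alg_on]) (use dc in auto)
    ultimately show ?thesis by blast
  qed
  \<comment> \<open>Exponents of the spanning monomials: below the degree \<open>d i\<close> of the
    relation for a dependent variable, and 0 for the variables in \<open>J\<close>, which act as
    scalars.\<close>
  define B where "B = {\<beta>. \<forall>i. (i \<in> I - J \<longrightarrow> \<beta> i \<in> {0..<int (d i)}) \<and> (i \<notin> I - J \<longrightarrow> \<beta> i = 0)}"
  have "B \<subseteq> {\<beta>. \<forall>i. (i \<in> I - J \<longrightarrow> \<beta> i \<in> (\<Union>i\<in>I - J. {0..<int (d i)})) \<and> (i \<notin> I - J \<longrightarrow> \<beta> i = 0)}"
    unfolding B_def by blast
  moreover have "finite {\<beta>. \<forall>i. (i \<in> I - J \<longrightarrow> \<beta> i \<in> (\<Union>i\<in>I - J. {0..<int (d i)})) \<and> (i \<notin> I - J \<longrightarrow> \<beta> i = 0)}"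
    using fin by (intro finite_set_of_finite_funs) auto
  ultimately have finB: "finite B" by (rule finite_subset)
  have zeroB: "0 \<in> B" using dc(1) by (auto simp: B_def)
  define mon :: "(nat \<Rightarrow> int) \<Rightarrow> 'k laurent" where "mon = (\<lambda>\<beta>. single \<beta> 1)"
  have monI: "mon \<beta> \<in> alg_on I" if "\<beta> \<in> B" for \<beta>
    using that unfolding mon_def by (intro single_in_alg_on) (auto simp: B_def supp_on_def)
  have mon_shift: "mon \<beta> * var_pow i k = mon (\<beta>(i := \<beta> i + k))" for \<beta> i k
  proof -
    have "\<beta> + (\<lambda>j. if j = i then k else 0) = \<beta>(i := \<beta> i + k)" by auto
    then show ?thesis by (simp add: mon_def var_pow_def mult_single)
  qed
  \<comment> \<open>Including \<open>q\<close> in \<open>M\<close> lets the module be studied modulo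
    \<open>q\<close> without forming the factor ring.\<close>
  define M where "M = {(\<Sum>\<beta>\<in>B. a \<beta> * mon \<beta>) + z | a z. (\<forall>\<beta>\<in>B. a \<beta> \<in> alg_on J) \<and> z \<in> q}"
  have M_I: "x \<in> M" if "x = (\<Sum>\<beta>\<in>B. a \<beta> * mon \<beta>) + z" "\<forall>\<beta>\<in>B. a \<beta> \<in> alg_on J" "z \<in> q" for x a z
    using that unfolding M_def by blast
  have M_add: "x + y \<in> M" if xy: "x \<in> M" "y \<in> M" for x y
  proof -
    obtain a z a' z' where "x = (\<Sum>\<beta>\<in>B. a \<beta> * mon \<beta>) + z" "\<forall>\<beta>\<in>B. a \<beta> \<in> alg_on J" "z \<in> q"
       "y = (\<Sum>\<beta>\<in>B. a' \<beta> * mon \<beta>) + z'" "\<forall>\<beta>\<in>B. a' \<beta> \<in> alg_on J" "z' \<in> q"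
      using xy unfolding M_def by blast
    then have "x + y = (\<Sum>\<beta>\<in>B. (a \<beta> + a' \<beta>) * mon \<beta>) + (z + z')"
       "\<forall>\<beta>\<in>B. a \<beta> + a' \<beta> \<in> alg_on J" "z + z' \<in> q"
      using qD(3) by (auto simp: algebra_simps sum.distrib)
    then show ?thesis by (rule M_I)
  qed
  have M_scale: "r * x \<in> M" if rx: "r \<in> alg_on J" "x \<in> M" for r x
  proof -
    obtain a z where "x = (\<Sum>\<beta>\<in>B. a \<beta> * mon \<beta>) + z" "\<forall>\<beta>\<in>B. a \<beta> \<in> alg_on J" "z \<in> q"
      using rx unfolding M_def by blast
    then have "r * x = (\<Sum>\<beta>\<in>B. (r * a \<beta>) * mon \<beta>) + (r * z)"
       "\<forall>\<beta>\<in>B. r * a \<beta> \<in> alg_on J" "r * z \<in> q"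
      using qD(4)[of z r] JsubI rx(1) by (auto simp: algebra_simps sum_distrib_left)
    then show ?thesis by (rule M_I)
  qed
  have M_q: "z \<in> M" if "z \<in> q" for z
    using that by (intro M_I[of z "\<lambda>_. 0" z]) auto
  have M_mon: "mon \<beta> \<in> M" if "\<beta> \<in> B" for \<beta>
  proof -
    have "mon \<beta> = (\<Sum>\<gamma>\<in>B. (if \<gamma> = \<beta> then 1 else 0) * mon \<gamma>) + 0"
      using finB that by (simp add: if_distrib[of "\<lambda>x. x * _"] cong: if_cong)
    moreover have "\<forall>\<gamma>\<in>B. (if \<gamma> = \<beta> then 1 else 0) \<in> (alg_on J :: 'k laurent set)" by simp
    ultimately show ?thesis by (rule M_I) (rule qD(2))
  qed
  have M_diff: "x - y \<in> M" if "x \<in> M" "y \<in> M" for x y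
    using M_add[OF that(1) M_scale[of "- 1" y]] that(2) by simp
  have M_sum: "sum f X \<in> M" if "\<And>x. x \<in> X \<Longrightarrow> f x \<in> M" for f and X :: "'x set"
    using that by (induction X rule: infinite_finite_induct) (auto simp: M_add M_q[OF qD(2)])
  have M_mult: "u * x \<in> M" if u: "u \<in> alg_on I" "\<And>\<beta>. \<beta> \<in> B \<Longrightarrow> u * mon \<beta> \<in> M" and x: "x \<in> M" for u x
  proof -
    obtain a z where az: "x = (\<Sum>\<beta>\<in>B. a \<beta> * mon \<beta>) + z" "\<forall>\<beta>\<in>B. a \<beta> \<in> alg_on J" "z \<in> q"
      using x unfolding M_def by blast
    have "u * x = (\<Sum>\<beta>\<in>B. a \<beta> * (u * mon \<beta>)) + u * z"
      unfolding az(1) by (simp add: algebra_simps sum_distrib_left)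
    also have "\<dots> \<in> M"
    proof (rule M_add)
      show "(\<Sum>\<beta>\<in>B. a \<beta> * (u * mon \<beta>)) \<in> M" using az(2) M_scale[OF _ u(2)] by (intro M_sum) blast
      show "u * z \<in> M" by (intro M_q qD(4)[OF az(3) u(1)])
    qed
    finally show ?thesis .
  qed
  \<comment> \<open>Elements that preserve \<open>M\<close> up to a power of \<open>g\<close>. They
    are closed under sums and products and contain \<open>L_J\<close>, so it suffices to show that
    the variables and their inverses are good.\<close>
  define good where "good = (\<lambda>u. \<exists>N. \<forall>x\<in>M. g ^ N * u * x \<in> M)"
  have gN: "g ^ N * x \<in> M" if "x \<in> M" for N x using g(1) by (intro M_scale that) simp
  have good_mult: "good (u * w)" if uw: "good u" "good w" for u w
  proof -
    obtain m n where mn: "\<And>x. x \<in> M \<Longrightarrow> g ^ m * u * x \<in> M" "\<And>x. x \<in> M \<Longrightarrow> g ^ n * w * x \<in> M"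
      using uw unfolding good_def by blast
    have "g ^ (m + n) * (u * w) * x \<in> M" if "x \<in> M" for x
    proof -
      have "g ^ m * u * (g ^ n * w * x) \<in> M" by (intro mn that)
      then show ?thesis by (simp add: power_add mult_ac)
    qed
    then show ?thesis unfolding good_def by blast
  qed
  have good_add: "good (u + w)" if uw: "good u" "good w" for u w
  proof -
    obtain m n where mn: "\<And>x. x \<in> M \<Longrightarrow> g ^ m * u * x \<in> M" "\<And>x. x \<in> M \<Longrightarrow> g ^ n * w * x \<in> M"
      using uw unfolding good_def by blast
    have "g ^ (m + n) * (u + w) * x \<in> M" if "x \<in> M" for x
    proof -
      have "g ^ n * (g ^ m * u * x) + g ^ m * (g ^ n * w * x) \<in> M" by (intro M_add gN mn that)
      then show ?thesis by (simp add: power_add algebra_simps)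
    qed
    then show ?thesis unfolding good_def by blast
  qed
  have good_J: "good u" if "u \<in> alg_on J" for u
    unfolding good_def using M_scale that by (intro exI[of _ 0]) simp
  have good_power: "good (u ^ n)" if "good u" for u n
    by (induction n) (auto intro: good_mult good_J that)
  \<comment> \<open>Inside the box this is a shift. At the upper face the relation replaces
    \<open>c i (d i)\<close> times \<open>x_i^(d i)\<close> by lower powers; the remaining factors
    of \<open>g\<close> are scalars from \<open>L_J\<close>.\<close>
  have step_up: "g * var_pow i 1 * mon \<beta> \<in> M" if i: "i \<in> I - J" and \<beta>: "\<beta> \<in> B" for i \<beta>
  proof (cases "\<beta> i + 1 < int (d i)")
    case True
    then have "\<beta>(i := \<beta> i + 1) \<in> B" using \<beta> i by (auto simp: B_def)
    then have "g * (mon \<beta> * var_pow i 1) \<in> M" unfolding mon_shift by (intro M_scale g(1) M_mon)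
    then show ?thesis by (simp add: mult_ac)
  next
    case False
    moreover have "\<beta> i \<in> {0..<int (d i)}" using \<beta> i unfolding B_def by blast
    ultimately have \<beta>i: "\<beta> i + 1 = int (d i)" by simp
    define \<gamma> where "\<gamma> = \<beta>(i := 0)"
    obtain g' where g': "g' \<in> alg_on J" "g = g' * c i 0 * c i (d i)" using g_split[OF i] by blast
    have \<gamma>: "mon \<gamma> * var_pow i k = mon (\<beta>(i := k))" for k unfolding mon_shift \<gamma>_def by simp
    have "mon \<gamma> * (\<Sum>k\<le>d i. c i k * var_pow i (int k)) \<in> q"
    proof (rule qD(4)[OF dc(5)[OF i]])
      have "\<gamma> \<in> B" using \<beta> dc(1)[OF i] by (auto simp: B_def \<gamma>_def)
      then show "mon \<gamma> \<in> alg_on I" by (rule monI)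
    qed
    moreover have "mon \<gamma> * (\<Sum>k\<le>d i. c i k * var_pow i (int k)) =
      (\<Sum>k<d i. c i k * mon (\<beta>(i := int k))) + c i (d i) * mon (\<beta>(i := int (d i)))"
      by (simp add: lessThan_Suc_atMost[symmetric] sum_distrib_left distrib_left \<gamma>[symmetric] mult_ac)
    moreover have "(\<Sum>k<d i. c i k * mon (\<beta>(i := int k))) \<in> M"
    proof (rule M_sum)
      fix k assume "k \<in> {..<d i}"
      moreover then have "\<beta>(i := int k) \<in> B" using \<beta> i by (auto simp: B_def)
      ultimately show "c i k * mon (\<beta>(i := int k)) \<in> M" using dc(2)[OF i] by (intro M_scale M_mon) auto
    qed
    ultimately have "c i (d i) * mon (\<beta>(i := int (d i))) \<in> M" using M_diff[OF M_q] by fastforce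
    then have "(g' * c i 0) * (c i (d i) * mon (\<beta>(i := int (d i)))) \<in> M"
      by (rule M_scale[rotated]) (use g'(1) dc(2)[OF i, of 0] in simp)
    then have "g * (mon \<beta> * var_pow i 1) \<in> M" unfolding mon_shift \<beta>i g'(2) by (simp add: mult_ac)
    then show ?thesis by (simp add: mult_ac)
  qed
  \<comment> \<open>Mirror image at the lower face: the relation divided by \<open>x_i\<close>
    expresses \<open>c i 0\<close> times \<open>x_i^-1\<close> by nonnegative powers below
    \<open>d i\<close>.\<close>
  have step_down: "g * var_pow i (- 1) * mon \<beta> \<in> M" if i: "i \<in> I - J" and \<beta>: "\<beta> \<in> B" for i \<beta>
  proof (cases "\<beta> i > 0")
    case True
    then have "\<beta>(i := \<beta> i + - 1) \<in> B" using \<beta> i by (auto simp: B_def)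
    then have "g * (mon \<beta> * var_pow i (- 1)) \<in> M" unfolding mon_shift by (intro M_scale g(1) M_mon)
    then show ?thesis by (simp add: mult_ac)
  next
    case False
    moreover have "\<beta> i \<in> {0..<int (d i)}" using \<beta> i unfolding B_def by blast
    ultimately have \<beta>i: "\<beta> i = 0" by simp
    obtain g' where g': "g' \<in> alg_on J" "g = g' * c i 0 * c i (d i)" using g_split[OF i] by blast
    have \<gamma>: "mon \<beta> * var_pow i (- 1) * var_pow i k = mon (\<beta>(i := k - 1))" for k
    proof -
      have "\<beta> i + (- 1 + k) = k - 1" using \<beta>i by simp
      moreover have "mon \<beta> * var_pow i (- 1) * var_pow i k = mon \<beta> * var_pow i (- 1 + k)"
        by (simp only: mult.assoc var_pow_add)
      ultimately show ?thesis by (simp only: mon_shift)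
    qed
    have "mon \<beta> * var_pow i (- 1) * (\<Sum>k\<le>d i. c i k * var_pow i (int k)) \<in> q"
      using monI[OF \<beta>] i by (intro qD(4)[OF dc(5)[OF i]]) (simp add: var_pow_in_alg_on)
    moreover have "mon \<beta> * var_pow i (- 1) * (\<Sum>k\<le>d i. c i k * var_pow i (int k)) =
      c i 0 * mon (\<beta>(i := - 1)) + (\<Sum>k\<in>{1..d i}. c i k * mon (\<beta>(i := int k - 1)))"
    proof -
      have "mon \<beta> * var_pow i (- 1) * (\<Sum>k\<le>d i. c i k * var_pow i (int k)) =
         (\<Sum>k\<in>{..d i}. c i k * mon (\<beta>(i := int k - 1)))"
        by (simp add: sum_distrib_left \<gamma>[symmetric] mult_ac)
      moreover have split: "(\<Sum>k\<in>{..d i}. F k) = F 0 + (\<Sum>k\<in>{1..d i}. F k)" for F :: "nat \<Rightarrow> 'k laurent"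
      proof -
        have "{..d i} = insert 0 {1..d i}" by auto
        then show ?thesis by simp
      qed
      ultimately show ?thesis by (simp only: split) simp
    qed
    moreover have "(\<Sum>k\<in>{1..d i}. c i k * mon (\<beta>(i := int k - 1))) \<in> M"
    proof (rule M_sum)
      fix k assume "k \<in> {1..d i}"
      moreover then have "\<beta>(i := int k - 1) \<in> B" using \<beta> i by (auto simp: B_def)
      ultimately show "c i k * mon (\<beta>(i := int k - 1)) \<in> M" using dc(2)[OF i] by (intro M_scale M_mon) auto
    qed
    ultimately have "c i 0 * mon (\<beta>(i := - 1)) \<in> M" using M_diff[OF M_q] by fastforce
    then have "(g' * c i (d i)) * (c i 0 * mon (\<beta>(i := - 1))) \<in> M"
      by (rule M_scale[rotated]) (use g'(1) dc(2)[OF i, of "d i"] in simp)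
    then have "g * (mon \<beta> * var_pow i (- 1)) \<in> M" unfolding mon_shift \<beta>i g'(2) by (simp add: mult_ac)
    then show ?thesis by (simp add: mult_ac)
  qed
  have good_var: "good (var_pow i k)" if i: "i \<in> I" for i k
  proof (cases "i \<in> J")
    case True
    then show ?thesis by (intro good_J var_pow_in_alg_on)
  next
    case False
    have gI: "g * var_pow i j \<in> alg_on I" for j using g(1) JsubI i by (simp add: var_pow_in_alg_on)
    have "good (var_pow i 1)" unfolding good_def
      using M_mult[OF gI[of 1]] step_up[of i] i False by (intro exI[of _ 1]) simp
    moreover have "good (var_pow i (- 1))" unfolding good_def
      using M_mult[OF gI[of "- 1"]] step_down[of i] i False by (intro exI[of _ 1]) simp
    ultimately have "good (var_pow i (int (nat k))) \<and> good (var_pow i (- int (nat (- k))))"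
      using good_power[of "var_pow i 1" "nat k"] good_power[of "var_pow i (- 1)" "nat (- k)"]
      by (simp add: var_pow_power)
    then show ?thesis by (cases "k \<ge> 0") auto
  qed
  have good_mon: "good (single e 1)" if "e \<in> supp_on I" for e
  proof -
    have "good (\<Prod>i\<in>A. var_pow i (e i))" if "A \<subseteq> I" for A
      using finite_subset[OF that fin] that
      by (induction A rule: finite_induct) (auto intro: good_mult good_J good_var)
    from this[OF order_refl] show ?thesis by (simp only: single_eq_prod_var_pow[OF fin that])
  qed
  have good_all: "good f" if f: "f \<in> alg_on I" for f
  proof -
    have "good (\<Sum>m\<in>X. single m (lookup f m))" if "X \<subseteq> keys f" for X
      using finite_subset[OF that finite_keys] that
    proof (induction X rule: finite_induct)
      case (insert m X)
      then have "m \<in> supp_on I" using f by (auto simp: alg_on_def)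
      then have "good (single m (lookup f m))"
        by (subst single_split) (intro good_mult good_J good_mon, simp_all)
      then show ?case using insert by (auto intro: good_add)
    qed (simp add: good_J)
    from this[OF order_refl] show ?thesis unfolding poly_mapping_sum_single[symmetric] .
  qed
  have "\<exists>N P. lead_coeff P = 1 \<and> (\<forall>k. coeff P k \<in> alg_on J) \<and> poly P (g ^ N * f) \<in> q"
    if f: "f \<in> alg_on I" for f
  proof -
    obtain N where N: "\<And>x. x \<in> M \<Longrightarrow> g ^ N * f * x \<in> M" using good_all[OF f] unfolding good_def by blast
    have "\<forall>\<gamma>\<in>B. \<exists>a. (\<forall>\<beta>\<in>B. a \<beta> \<in> alg_on J) \<and> g ^ N * f * mon \<gamma> - (\<Sum>\<beta>\<in>B. a \<beta> * mon \<beta>) \<in> q"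
    proof
      fix \<gamma> assume "\<gamma> \<in> B"
      then have "g ^ N * f * mon \<gamma> \<in> M" using N M_mon by blast
      then obtain a z where "g ^ N * f * mon \<gamma> = (\<Sum>\<beta>\<in>B. a \<beta> * mon \<beta>) + z" "\<forall>\<beta>\<in>B. a \<beta> \<in> alg_on J" "z \<in> q"
        unfolding M_def by blast
      then show "\<exists>a. (\<forall>\<beta>\<in>B. a \<beta> \<in> alg_on J) \<and> g ^ N * f * mon \<gamma> - (\<Sum>\<beta>\<in>B. a \<beta> * mon \<beta>) \<in> q"
        by (intro exI[of _ a]) simp
    qed
    from bchoice[OF this] obtain a where "\<forall>\<gamma>\<in>B. (\<forall>\<beta>\<in>B. a \<gamma> \<beta> \<in> alg_on J)
       \<and> g ^ N * f * mon \<gamma> - (\<Sum>\<beta>\<in>B. a \<gamma> \<beta> * mon \<beta>) \<in> q" by blast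
    then have a: "\<And>\<gamma> \<beta>. \<gamma> \<in> B \<Longrightarrow> \<beta> \<in> B \<Longrightarrow> a \<gamma> \<beta> \<in> alg_on J"
      "\<And>\<gamma>. \<gamma> \<in> B \<Longrightarrow> g ^ N * f * mon \<gamma> - (\<Sum>\<beta>\<in>B. a \<gamma> \<beta> * mon \<beta>) \<in> q"
      by auto
    obtain b where b: "bij_betw b {0..<card B} B" using ex_bij_betw_nat_finite[OF finB] by blast
    have bB: "b i \<in> B" if "i < card B" for i using b that by (auto simp: bij_betw_def)
    have "\<exists>P. lead_coeff P = 1 \<and> (\<forall>k. coeff P k \<in> alg_on J) \<and> (\<forall>j<card B. poly P (g ^ N * f) * mon (b j) \<in> q)"
    proof (rule integral_relation[OF unital_subring_alg_on[of I] unital_subring_alg_on alg_on_mono[OF JI]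
            _ qD(2,3,4), where a = "\<lambda>i j. a (b i) (b j)"])
      show "g ^ N * f \<in> alg_on I" using f g(1) JsubI by simp
      fix i assume i: "i < card B"
      have "(\<Sum>j<card B. a (b i) (b j) * mon (b j)) = (\<Sum>\<beta>\<in>B. a (b i) \<beta> * mon \<beta>)"
        using sum.reindex_bij_betw[OF b] by (simp add: lessThan_atLeast0)
      then show "g ^ N * f * mon (b i) - (\<Sum>j<card B. a (b i) (b j) * mon (b j)) \<in> q"
        using a(2)[OF bB[OF i]] by simp
    qed (use a(1) bB in auto)
    then obtain P where P: "lead_coeff P = 1" "\<forall>k. coeff P k \<in> alg_on J"
      "\<forall>j<card B. poly P (g ^ N * f) * mon (b j) \<in> q" by blast
    \<comment> \<open>The monomial 1 belongs to the box, so a polynomial value that annihilates all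
      box monomials modulo \<open>q\<close> lies in \<open>q\<close> itself.\<close>
    have "0 \<in> b ` {0..<card B}" using b zeroB by (simp add: bij_betw_def)
    then obtain j where "j < card B" "b j = 0" by auto
    then have "poly P (g ^ N * f) \<in> q" using P(3) by (auto simp: mon_def)
    then show ?thesis using P by blast
  qed
  then show ?thesis using g by blast
qed

section \<open>Going up and down in Laurent polynomial rings\<close>

text \<open>An element of \<open>q'\<close> outside \<open>q\<close> is transcendental over
  \<open>L_J\<close> modulo \<open>q\<close>: in a relation the constant coefficient lies in
  \<open>q'\<close>, hence vanishes by independence, and then \<open>h\<close> can be cancelled
  because \<open>q\<close> is prime.\<close>

lemma poly_in_LSpec_imp_zero:
  fixes q :: "'k::field laurent set"
  assumes q: "q \<in> LSpec I" and q': "q' \<in> LSpec I" and qq: "q \<subseteq> q'" and JI: "J \<subseteq> I"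
    and indep: "alg_indep q' J" and h: "h \<in> q'" "h \<notin> q"
  shows "(\<forall>k. coeff P k \<in> alg_on J) \<Longrightarrow> poly P h \<in> q \<Longrightarrow> P = 0"
proof (induction P)
  case (pCons a P)
  have hI: "h \<in> alg_on I" using LSpecD(1)[OF q'] h(1) by blast
  have aJ: "a \<in> alg_on J" using pCons.prems(1) coeff_pCons_0[of a P] by metis
  have PJ: "\<forall>k. coeff P k \<in> alg_on J" using pCons.prems(1) coeff_pCons_Suc[of a P] by metis
  have "poly P h \<in> alg_on I" unfolding poly_altdef
    using PJ alg_on_mono[OF JI] hI by (intro alg_on_sum alg_on_closed) auto
  then have "h * poly P h \<in> q'" using LSpecD(5)[OF q' h(1)] by blast
  moreover have "a + h * poly P h \<in> q'" using pCons.prems(2) qq by auto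
  ultimately have "a \<in> q'" using LSpec_diff[OF q', of "a + h * poly P h" "h * poly P h"] by simp
  then have a0: "a = 0" using indep aJ by blast
  then have "h * poly P h \<in> q" using pCons.prems(2) by simp
  then have "poly P h \<in> q" using LSpec_prime[OF q hI \<open>poly P h \<in> alg_on I\<close>] h(2) by blast
  then have "P = 0" using pCons.IH PJ by blast
  then show ?case using a0 by simp
qed simp

text \<open>If no variable could be added, \<open>J\<close> would be maximal for \<open>q\<close>,
  and for \<open>f\<close> in \<open>q'\<close> outside \<open>q\<close> some \<open>g^N f\<close>
  would be integral over \<open>L_J\<close> modulo \<open>q\<close>. That element is again in
  \<open>q'\<close> and outside \<open>q\<close>, so it is transcendental by the preceding
  lemma.\<close>

lemma independent_lost:
  fixes q :: "'k::field laurent set"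
  assumes fin: "finite I" and q: "q \<in> LSpec I" and q': "q' \<in> LSpec I" and qq: "q \<subset> q'" and JI: "J \<subseteq> I"
    and indep: "alg_indep q' J"
  shows "\<exists>i\<in>I - J. alg_indep q (insert i J)"
proof (rule ccontr)
  assume "\<not> ?thesis"
  then have max: "\<And>i. i \<in> I - J \<Longrightarrow> \<not> alg_indep q (insert i J)" by blast
  have indep_q: "alg_indep q J" using indep qq by blast
  obtain g where g: "g \<in> alg_on J" "g \<noteq> 0" and int: "\<And>f. f \<in> alg_on I \<Longrightarrow> \<exists>N P. lead_coeff P = 1
           \<and> (\<forall>k. coeff P k \<in> alg_on J) \<and> poly P (g ^ N * f) \<in> q"
    using exists_integral_denominator[OF fin q JI indep_q max] by blast
  obtain f where f: "f \<in> q'" "f \<notin> q" using qq by blast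
  have fI: "f \<in> alg_on I" using LSpecD(1)[OF q'] f(1) by blast
  obtain N P where P: "lead_coeff P = 1" "\<forall>k. coeff P k \<in> alg_on J" "poly P (g ^ N * f) \<in> q"
    using int[OF fI] by blast
  have gI: "g ^ N \<in> alg_on I" "g \<in> alg_on I" using g(1) alg_on_mono[OF JI] by auto
  have "g \<notin> q" using indep_q g by blast
  then have "g ^ N \<notin> q" using LSpec_power[OF q gI(2)] by blast
  then have "g ^ N * f \<notin> q" using LSpec_prime[OF q gI(1) fI] f(2) by blast
  moreover have "g ^ N * f \<in> q'" using LSpecD(4)[OF q' f(1) gI(1)] .
  ultimately have "P = 0" using poly_in_LSpec_imp_zero[OF q q' _ JI indep _ _ P(2,3)] qq by blast
  then show False using P(1) by simp
qed

lemma ideal_adjoin: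
  fixes M :: "'k::field laurent set"
  assumes M: "ideal M (alg_rec I)" and a: "a \<in> alg_on I"
  shows "ideal {m + r * a | m r. m \<in> M \<and> r \<in> alg_on I} (alg_rec I)" (is "ideal ?X _")
    and "M \<subseteq> {m + r * a | m r. m \<in> M \<and> r \<in> alg_on I}"
    and "a \<in> {m + r * a | m r. m \<in> M \<and> r \<in> alg_on I}"
proof -
  note idl = ideal_subring_rec_iff[OF unital_subring_alg_on, of _ I]
  note M1 = M[unfolded idl]
  show MX: "M \<subseteq> ?X"
  proof
    fix m assume "m \<in> M"
    then have "m = m + 0 * a" "m \<in> M" "0 \<in> (alg_on I :: 'k laurent set)" by auto
    then show "m \<in> ?X" by blast
  qed
  have "a = 0 + 1 * a" "0 \<in> M" "1 \<in> (alg_on I :: 'k laurent set)" using M1 by auto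
  then show "a \<in> ?X" by blast
  have mulX: "s * x \<in> ?X" if x: "x \<in> ?X" and s: "s \<in> alg_on I" for x s
  proof -
    obtain m r where mr: "x = m + r * a" "m \<in> M" "r \<in> alg_on I" using x by blast
    have "s * x = s * m + (s * r) * a" unfolding mr(1) by (simp add: algebra_simps)
    moreover have "s * m \<in> M" "s * r \<in> alg_on I" using M1 mr s by simp_all
    ultimately show ?thesis by blast
  qed
  show "ideal ?X (alg_rec I)" unfolding idl
  proof (intro conjI ballI)
    show "?X \<subseteq> alg_on I" using M1 a by auto
    show "0 \<in> ?X" using MX M1 by blast
    fix x y assume "x \<in> ?X" "y \<in> ?X"
    then obtain m r m' r' where "x = m + r * a" "m \<in> M" "r \<in> alg_on I" "y = m' + r' * a" "m' \<in> M" "r' \<in> alg_on I"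
      by blast
    then have "x + y = (m + m') + (r + r') * a" "m + m' \<in> M" "r + r' \<in> alg_on I"
      using M1 by (auto simp: algebra_simps)
    then show "x + y \<in> ?X" by blast
  next
    fix x and s :: "'k laurent" assume x: "x \<in> ?X" "s \<in> alg_on I"
    show "s * x \<in> ?X" by (rule mulX[OF x])
    then show "x * s \<in> ?X" by (simp only: mult.commute)
  qed
qed

text \<open>Krull's argument with Zorn's lemma: for an ideal maximal among those disjoint from
  \<open>S\<close>, adjoining either of two outside elements meets \<open>S\<close>, and the product
  of the two meeting points would lie in the ideal if the product of the two elements did.\<close>

lemma LSpec_avoiding:
  fixes q0 S :: "'k::field laurent set"
  assumes q0: "ideal q0 (alg_rec I)" and S: "1 \<in> S" "\<And>a b. a \<in> S \<Longrightarrow> b \<in> S \<Longrightarrow> a * b \<in> S"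
    and disj: "q0 \<inter> S = {}"
  shows "\<exists>P\<in>LSpec I. q0 \<subseteq> P \<and> P \<inter> S = {}"
proof -
  note idl = ideal_subring_rec_iff[OF unital_subring_alg_on, of _ I]
  define \<A> where "\<A> = {Q. ideal Q (alg_rec I) \<and> q0 \<subseteq> Q \<and> Q \<inter> S = {}}"
  have "\<exists>M\<in>\<A>. \<forall>X\<in>\<A>. M \<subseteq> X \<longrightarrow> X = M"
  proof (rule subset_Zorn_nonempty)
    show "\<A> \<noteq> {}" using q0 disj unfolding \<A>_def by blast
    fix \<C> assume ne: "\<C> \<noteq> {}" and ch: "subset.chain \<A> \<C>"
    then have C: "\<And>X. X \<in> \<C> \<Longrightarrow> ideal X (alg_rec I) \<and> q0 \<subseteq> X \<and> X \<inter> S = {}"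
      and tot: "\<And>X Y. X \<in> \<C> \<Longrightarrow> Y \<in> \<C> \<Longrightarrow> X \<subseteq> Y \<or> Y \<subseteq> X"
      unfolding subset.chain_def \<A>_def by blast+
    have Ci: "X \<subseteq> alg_on I" "0 \<in> X" "\<forall>a\<in>X. \<forall>b\<in>X. a + b \<in> X" "\<forall>a\<in>X. \<forall>r\<in>alg_on I. r * a \<in> X \<and> a * r \<in> X"
      if "X \<in> \<C>" for X using C[OF that] unfolding idl by - (elim conjE, assumption)+
    have "ideal (\<Union>\<C>) (alg_rec I)" unfolding idl
    proof (intro conjI ballI)
      show "\<Union>\<C> \<subseteq> alg_on I" using Ci(1) by (rule Union_least)
      show "0 \<in> \<Union>\<C>" using Ci(2) ne by (meson UnionI ex_in_conv)
      fix a b assume "a \<in> \<Union>\<C>" "b \<in> \<Union>\<C>"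
      then obtain X Y where XY: "X \<in> \<C>" "Y \<in> \<C>" "a \<in> X" "b \<in> Y" by blast
      then have "\<exists>Z\<in>\<C>. a \<in> Z \<and> b \<in> Z" using tot[OF XY(1,2)] by (meson subsetD)
      then obtain Z where Z: "Z \<in> \<C>" "a \<in> Z" "b \<in> Z" by blast
      then have "a + b \<in> Z" using Ci(3)[OF Z(1)] by simp
      then show "a + b \<in> \<Union>\<C>" using Z(1) by blast
    next
      fix a and r :: "'k laurent" assume "a \<in> \<Union>\<C>" and r: "r \<in> alg_on I"
      then obtain X where X: "X \<in> \<C>" "a \<in> X" by blast
      then have "r * a \<in> X" "a * r \<in> X" using Ci(4)[OF X(1)] r by simp_all
      then show "r * a \<in> \<Union>\<C>" "a * r \<in> \<Union>\<C>" using X(1) by blast+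
    qed
    moreover have "q0 \<subseteq> \<Union>\<C>" using C ne by blast
    moreover have "\<Union>\<C> \<inter> S = {}" using C by blast
    ultimately show "\<Union>\<C> \<in> \<A>" by (simp add: \<A>_def)
  qed
  then obtain M where "M \<in> \<A>" and max: "\<And>X. X \<in> \<A> \<Longrightarrow> M \<subseteq> X \<Longrightarrow> X = M" by blast
  then have M: "ideal M (alg_rec I)" "q0 \<subseteq> M" "M \<inter> S = {}" by (auto simp: \<A>_def)
  note M1 = M(1)[unfolded idl]
  have meet: "\<exists>m\<in>M. \<exists>r\<in>alg_on I. m + r * a \<in> S" if a: "a \<in> alg_on I" "a \<notin> M" for a
  proof (rule ccontr)
    assume no: "\<not> ?thesis"
    let ?X = "{m + r * a | m r. m \<in> M \<and> r \<in> alg_on I}"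
    have "ideal ?X (alg_rec I)" and MX: "M \<subseteq> ?X" and aX: "a \<in> ?X"
      using ideal_adjoin[OF M(1) a(1)] by auto
    moreover have "q0 \<subseteq> ?X" using M(2) MX by blast
    moreover have "?X \<inter> S = {}" using no by blast
    ultimately have "?X \<in> \<A>" unfolding \<A>_def by blast
    then have "?X = M" using max MX by blast
    then show False using aX a(2) by blast
  qed
  have "M \<in> LSpec I"
  proof (rule LSpecI)
    show "1 \<notin> M" using M(3) S(1) by blast
    fix a b :: "'k laurent" assume a: "a \<in> alg_on I" "a \<notin> M" and b: "b \<in> alg_on I" "b \<notin> M"
    obtain m r where m: "m \<in> M" "r \<in> alg_on I" "m + r * a \<in> S" using meet[OF a] by blast
    obtain m' r' where m': "m' \<in> M" "r' \<in> alg_on I" "m' + r' * b \<in> S" using meet[OF b] by blast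
    show "a * b \<notin> M"
    proof
      assume ab: "a * b \<in> M"
      have "(m + r * a) * (m' + r' * b) = (m' + r' * b) * m + (r * a) * m' + (r * r') * (a * b)"
        by (simp add: algebra_simps)
      also have "\<dots> \<in> M"
      proof -
        have "m' + r' * b \<in> alg_on I" "r * a \<in> alg_on I" "r * r' \<in> alg_on I" using M1 m m' a b by auto
        then have "(m' + r' * b) * m \<in> M" "(r * a) * m' \<in> M" "(r * r') * (a * b) \<in> M"
          using M1 m m' ab by simp_all
        then show ?thesis using M1 by blast
      qed
      finally show False using S(2)[OF m(3) m'(3)] M(3) by blast
    qed
  qed (use M1 in simp_all)
  then show ?thesis using M by blast
qed

text \<open>If \<open>s\<close> does not involve \<open>x\<^sub>j\<close> while \<open>p = 1 - w\<close> has both an \<open>x\<^sub>j\<close>-free term and one of positive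
  degree, then \<open>p\<close> cannot divide \<open>s\<close>: compare the extreme \<open>x\<^sub>j\<close>-degrees.\<close>

lemma not_dvd_of_var_width:
  fixes w s v :: "'k::field laurent"
  assumes fin: "finite J" and j: "j \<in> J" and w: "w \<in> alg_on J" "w \<noteq> 0" "\<And>k. var_coeff j k w \<noteq> 0 \<Longrightarrow> 0 < k"
    and s: "s \<in> alg_on (J - {j})" "s \<noteq> 0" and v: "v \<in> alg_on J"
  shows "s \<noteq> (1 - w) * v"
proof
  assume eq: "s = (1 - w) * v"
  let ?J = "J - {j}"
  have P: "{0} \<in> (LSpec ?J :: 'k laurent set set)" using fin by (intro zero_LSpec) simp
  have J: "insert j ?J = J" using j by blast
  have jn: "j \<notin> ?J" by simp
  have sc: "var_coeff j k s = (if k = 0 then s else 0)" for k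
    using s(1) alg_on_mono[of "?J" "- {j}"] by (intro var_coeff_const) auto
  have v0: "v \<noteq> 0" using eq s(2) by auto
  then obtain k where k: "var_coeff j k v \<notin> {0}" using var_coeff_all_zero[of j v] by blast
  obtain a where a: "var_coeff j a v \<notin> {0}" "\<And>a'. 1 * a < 1 * a' \<Longrightarrow> var_coeff j a' v \<in> {0}"
    using var_coeff_extreme_exists[OF P k, of 1] by auto
  obtain b where b: "var_coeff j b v \<notin> {0}" "\<And>b'. - 1 * b < - 1 * b' \<Longrightarrow> var_coeff j b' v \<in> {0}"
    using var_coeff_extreme_exists[OF P k, of "- 1"] by auto
  obtain l where l: "var_coeff j l w \<noteq> 0" using w(2) var_coeff_all_zero[of j w] by blast
  have pc: "var_coeff j k (1 :: 'k laurent) = (if k = 0 then 1 else 0)" for k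
    by (simp add: var_coeff_const)
  have "var_coeff j l (1 - w) \<notin> {0}" using l w(3)[OF l] by (simp add: pc)
  \<comment> \<open>\<open>a\<close> and \<open>b\<close> are the highest and lowest degrees of
    \<open>v\<close> in \<open>x_j\<close>, and \<open>t\<close> is the highest of
    \<open>1 - w\<close>, whose lowest is 0. Extreme degrees add up in the product and must be 0
    because \<open>s\<close> is free of \<open>x_j\<close>; so \<open>b = 0\<close> and
    \<open>a = - t < 0\<close>, against \<open>b \<le> a\<close>.\<close>
  from var_coeff_extreme_exists[OF P this, of 1] obtain t where
    t: "var_coeff j t (1 - w) \<notin> {0}" "\<And>t'. 1 * t < 1 * t' \<Longrightarrow> var_coeff j t' (1 - w) \<in> {0}" by auto
  have "\<not> 1 * t < 1 * l" using t(2)[of l] \<open>var_coeff j l (1 - w) \<notin> {0}\<close> by blast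
  then have "0 < t" using w(3)[OF l] by simp
  have p0: "var_coeff j 0 (1 - w) \<notin> {0}" using w(3)[of 0] by (auto simp: pc)
  have pneg: "var_coeff j k' (1 - w) \<in> {0}" if "- 1 * 0 < - 1 * k'" for k' :: int
    using that w(3)[of k'] by (auto simp: pc)
  have mem: "1 - w \<in> alg_on (insert j ?J)" "v \<in> alg_on (insert j ?J)" using w(1) v J by simp_all
  have "var_coeff j (t + a) s \<notin> {0}"
    unfolding eq by (rule var_coeff_extreme[OF P jn mem t a, where s = 1]) auto
  then have "t + a = 0" unfolding sc by (auto split: if_splits)
  have "var_coeff j (0 + b) s \<notin> {0}"
    unfolding eq by (rule var_coeff_extreme[OF P jn mem p0 pneg b, where s = "- 1"]) auto
  then have "b = 0" unfolding sc by (auto split: if_splits)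
  then have "0 \<le> a" using a(2)[of b] b(1) by force
  then show False using \<open>0 < t\<close> \<open>t + a = 0\<close> by simp
qed

text \<open>Suppose \<open>z + u p\<close>, with \<open>z\<close> in \<open>q\<close> and
  \<open>p = 1 - w\<close>, is a nonzero \<open>s\<close> free of \<open>x_j\<close>. Homogenising
  the integral equation of \<open>g^N u\<close> by powers of \<open>p\<close> gives an identity
  inside \<open>L_J\<close>, where \<open>q\<close> is zero, so \<open>p\<close> divides
  \<open>(g^N s)^D\<close>. Modulo \<open>p\<close> the factor \<open>g\<close> is a unit; hence
  \<open>p\<close> divides \<open>s^D\<close>, which its width in \<open>x_j\<close>
  forbids.\<close>

lemma exists_prime_above:
  fixes q :: "'k::field laurent set"
  assumes fin: "finite I" and q: "q \<in> LSpec I" and JI: "J \<subseteq> I" and indep: "alg_indep q J"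
    and max: "\<And>i. i \<in> I - J \<Longrightarrow> \<not> alg_indep q (insert i J)" and j: "j \<in> J"
  shows "\<exists>q'\<in>LSpec I. q \<subset> q' \<and> alg_indep q' (J - {j})"
proof -
  note qD = LSpecD[OF q]
  have finJ: "finite J" using JI fin by (rule finite_subset)
  have JsubI: "x \<in> alg_on I" if "x \<in> alg_on J" for x :: "'k laurent" using that alg_on_mono[OF JI] by blast
  have J'subJ: "x \<in> alg_on J" if "x \<in> alg_on (J - {j})" for x :: "'k laurent"
    using that alg_on_mono[of "J - {j}" J] by blast
  obtain g where g: "g \<in> alg_on J" "g \<noteq> 0" and int: "\<And>f. f \<in> alg_on I \<Longrightarrow> \<exists>N P. lead_coeff P = 1
           \<and> (\<forall>k. coeff P k \<in> alg_on J) \<and> poly P (g ^ N * f) \<in> q"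
    using exists_integral_denominator[OF fin q JI indep max] by blast
  \<comment> \<open>Larger than every absolute exponent of \<open>x_j\<close> in \<open>g\<close>,
    so that all exponents of \<open>x_j\<close> in \<open>w\<close> are positive.\<close>
  define m where "m = 1 + (\<Sum>k\<in>var_exps j g. \<bar>k\<bar>)"
  have m: "0 < k + m" if "k \<in> var_exps j g" for k
    using member_le_sum[of k "var_exps j g" abs] that by (simp add: m_def)
  define w where "w = g * var_pow j m"
  have Xm: "var_pow j m \<in> (alg_on J :: 'k laurent set)" using j by (rule var_pow_in_alg_on)
  have w: "w \<in> alg_on J" using g(1) Xm by (simp add: w_def)
  have "keys (var_pow j m :: 'k laurent) \<noteq> {}" by (simp add: var_pow_def)
  then have Xnz: "var_pow j m \<noteq> (0 :: 'k laurent)" by auto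
  have w0: "w \<noteq> 0" unfolding w_def by (rule alg_on_no_zero_divisors[OF finJ g(1) Xm g(2) Xnz])
  have wexp: "0 < k" if "var_coeff j k w \<noteq> 0" for k
    using that m[of "k - m"] var_coeff_notin_exps[of "k - m" j g] by (auto simp: w_def var_coeff_mult_var_pow)
  define p where "p = 1 - w"
  have p: "p \<in> alg_on J" using w by (simp add: p_def)
  have pI: "p \<in> alg_on I" by (rule JsubI[OF p])
  define q0 where "q0 = {z + u * p | z u. z \<in> q \<and> u \<in> alg_on I}"
  define S where "S = (alg_on (J - {j}) - {0} :: 'k laurent set)"
  have "ideal q (alg_rec I)" using q by (simp add: Spec_def prime_ideal_def)
  then have id: "ideal q0 (alg_rec I)" and q_q0: "q \<subseteq> q0" and p_q0: "p \<in> q0"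
    unfolding q0_def using ideal_adjoin[OF _ pI] by auto
  have disj: "q0 \<inter> S = {}"
  proof (rule ccontr)
    assume "q0 \<inter> S \<noteq> {}"
    then obtain z u where zu: "z \<in> q" "u \<in> alg_on I" "z + u * p \<in> alg_on (J - {j})" "z + u * p \<noteq> 0"
      unfolding q0_def S_def by blast
    define s where "s = z + u * p"
    have sJ: "s \<in> alg_on J" using zu(3) J'subJ by (simp add: s_def)
    obtain N P where P: "lead_coeff P = 1" "\<forall>k. coeff P k \<in> alg_on J" "poly P (g ^ N * u) \<in> q"
      using int[OF zu(2)] by blast
    define D where "D = degree P"
    define y where "y = g ^ N * s"
    have yJ: "y \<in> alg_on J" using g(1) sJ by (simp add: y_def)
    have yI: "y \<in> alg_on I" by (rule JsubI[OF yJ])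
    \<comment> \<open>This is \<open>p^D P(h)\<close> with \<open>p h\<close> replaced by
      \<open>y\<close>; the two agree modulo \<open>q\<close> because
      \<open>y - p h = g^N z\<close>. The point of the replacement is that \<open>y\<close> lies in
      \<open>L_J\<close>.\<close>
    define E where "E = (\<Sum>k\<le>D. coeff P k * p ^ (D - k) * y ^ k)"
    have EJ: "E \<in> alg_on J" unfolding E_def using P(2) p yJ by (intro alg_on_sum alg_on_closed) auto
    define h where "h = g ^ N * u"
    have gNI: "g ^ N \<in> alg_on I" using JsubI[OF g(1)] by simp
    have hI: "h \<in> alg_on I" using gNI zu(2) by (simp add: h_def)
    have yh: "y - p * h \<in> q"
    proof -
      have "y - p * h = g ^ N * z" unfolding y_def h_def s_def by (simp add: algebra_simps)
      then show ?thesis using qD(4)[OF zu(1) gNI] by simp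
    qed
    have powdiff: "y ^ k - (p * h) ^ k \<in> q" for k
    proof -
      have "y ^ k - (p * h) ^ k = (\<Sum>i<k. (p * h) ^ (k - Suc i) * y ^ i) * (y - p * h)"
        by (simp add: power_diff_sumr2 mult.commute)
      also have "\<dots> \<in> q" using yI pI hI by (intro qD(4)[OF yh] alg_on_sum) auto
      finally show ?thesis .
    qed
    have "E - p ^ D * poly P h \<in> q"
    proof -
      have "p ^ D * poly P h = (\<Sum>k\<le>D. coeff P k * p ^ (D - k) * (p * h) ^ k)"
        unfolding poly_altdef D_def sum_distrib_left
      proof (intro sum.cong refl)
        fix k assume "k \<in> {..degree P}"
        then have "p ^ degree P = p ^ (degree P - k) * p ^ k" by (simp flip: power_add)
        then show "p ^ degree P * (coeff P k * h ^ k) = coeff P k * p ^ (degree P - k) * (p * h) ^ k"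
          by (simp add: power_mult_distrib mult_ac)
      qed
      then have "E - p ^ D * poly P h = (\<Sum>k\<le>D. (coeff P k * p ^ (D - k)) * (y ^ k - (p * h) ^ k))"
        by (simp add: E_def sum_subtractf right_diff_distrib)
      also have "\<dots> \<in> q" using P(2) pI JsubI by (intro qD(8) qD(4)[OF powdiff]) auto
      finally show ?thesis .
    qed
    moreover have "p ^ D * poly P h \<in> q" using P(3) pI by (intro qD(4)) (simp_all add: h_def)
    ultimately have "E \<in> q" using qD(3) by fastforce
    then have E0: "E = 0" using EJ indep by blast
    \<comment> \<open>\<open>P\<close> is monic, so the top term is \<open>y^D\<close>, and every
      other term keeps a factor \<open>p\<close>.\<close>
    have "E = y ^ D + (\<Sum>k<D. coeff P k * p ^ (D - k) * y ^ k)"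
      unfolding E_def lessThan_Suc_atMost[symmetric] using P(1) by (simp add: D_def)
    moreover have "(\<Sum>k<D. coeff P k * p ^ (D - k) * y ^ k) = p * (\<Sum>k<D. coeff P k * p ^ (D - Suc k) * y ^ k)"
      unfolding sum_distrib_left
    proof (intro sum.cong refl)
      fix k assume "k \<in> {..<D}"
      then have "p ^ (D - k) = p * p ^ (D - Suc k)" by (simp flip: power_Suc add: Suc_diff_Suc)
      then show "coeff P k * p ^ (D - k) * y ^ k = p * (coeff P k * p ^ (D - Suc k) * y ^ k)"
        by (simp add: mult_ac)
    qed
    ultimately have yD: "y ^ D = p * - (\<Sum>k<D. coeff P k * p ^ (D - Suc k) * y ^ k)"
      using E0 by (simp add: eq_neg_iff_add_eq_0)
    define v1 where "v1 = - (\<Sum>k<D. coeff P k * p ^ (D - Suc k) * y ^ k)"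
    have v1: "v1 \<in> alg_on J" unfolding v1_def using P(2) p yJ by (intro alg_on_closed alg_on_sum) auto
    \<comment> \<open>\<open>y^D\<close> contains \<open>g\<close> to the power \<open>N D\<close>;
      multiplying by the same power of \<open>x_j^m\<close> turns this into \<open>w^K\<close>, and
      \<open>w\<close> is 1 modulo \<open>p\<close>.\<close>
    define K where "K = N * D"
    have "s ^ D * w ^ K = y ^ D * var_pow j m ^ K"
    proof -
      have "y ^ D = g ^ K * s ^ D" unfolding y_def K_def power_mult_distrib power_mult ..
      then show ?thesis by (simp add: w_def power_mult_distrib mult_ac)
    qed
    also have "\<dots> = p * (v1 * var_pow j m ^ K)" unfolding yD v1_def by (simp add: mult_ac)
    finally have sw: "s ^ D * w ^ K = p * (v1 * var_pow j m ^ K)" .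
    have "1 - w ^ K = p * (\<Sum>i<K. w ^ i)" unfolding p_def by (rule one_diff_power_eq)
    moreover have "s ^ D = s ^ D * w ^ K + s ^ D * (1 - w ^ K)" by (simp add: algebra_simps)
    ultimately have "s ^ D = s ^ D * w ^ K + s ^ D * (p * (\<Sum>i<K. w ^ i))" by (simp only:)
    also have "\<dots> = p * (v1 * var_pow j m ^ K + s ^ D * (\<Sum>i<K. w ^ i))"
      unfolding sw by (simp add: algebra_simps)
    finally have "s ^ D = (1 - w) * (v1 * var_pow j m ^ K + s ^ D * (\<Sum>i<K. w ^ i))" by (simp add: p_def)
    moreover have "v1 * var_pow j m ^ K + s ^ D * (\<Sum>i<K. w ^ i) \<in> alg_on J"
      using v1 Xm sJ w by (intro alg_on_closed alg_on_sum) auto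
    moreover have "s ^ D \<in> alg_on (J - {j})" "s ^ D \<noteq> 0"
      using zu(3,4) alg_on_power_nonzero[OF _ zu(3,4)] finJ by (auto simp: s_def)
    ultimately show False using not_dvd_of_var_width[OF finJ j w w0 wexp] by blast
  qed
  have "1 \<in> S" by (simp add: S_def)
  moreover have "a * b \<in> S" if "a \<in> S" "b \<in> S" for a b
    using that alg_on_no_zero_divisors[of "J - {j}" a b] finJ by (auto simp: S_def)
  ultimately obtain q' where q': "q' \<in> LSpec I" "q0 \<subseteq> q'" "q' \<inter> S = {}"
    using LSpec_avoiding[OF id _ _ disj] by blast
  have "p \<notin> q"
  proof
    assume "p \<in> q"
    then have "p = 0" using indep p by blast
    then show False
      using not_dvd_of_var_width[OF finJ j w w0 wexp, of 1 "0"]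
        not_dvd_of_var_width[OF finJ j w w0 wexp, of "1" "1"] wexp[of 0] var_coeff_const[of "1::'k laurent" j 0]
      by (auto simp: p_def)
  qed
  then have "q \<subset> q'" using q_q0 q'(2) p_q0 by blast
  moreover have "alg_indep q' (J - {j})" using q'(3) by (auto simp: S_def)
  ultimately show ?thesis using q'(1) by blast
qed

section \<open>The rank of a prime of a Laurent polynomial ring\<close>

text \<open>For a prime \<open>q\<close> this is the transcendence degree of the fraction field of
  \<open>L_I\<close> modulo \<open>q\<close>. Subsets of the variables suffice: the variables
  generate that field, so they contain a transcendence basis.\<close>

definition indep_card :: "nat set \<Rightarrow> 'k::field laurent set \<Rightarrow> nat" where
  "indep_card I q = Max {card J | J. J \<subseteq> I \<and> alg_indep q J}"

context
  fixes I :: "nat set" and q :: "'k::field laurent set"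
  assumes fin: "finite I" and q: "q \<in> LSpec I"
begin

lemma indep_card_ge:
  assumes "J \<subseteq> I" "alg_indep q J" shows "card J \<le> indep_card I q"
proof -
  have "finite (card ` Pow I)" using fin by simp
  then have "finite {card J | J. J \<subseteq> I \<and> alg_indep q J}" by (rule rev_finite_subset) auto
  then show ?thesis unfolding indep_card_def using assms by (intro Max_ge) auto
qed

lemma indep_empty: "alg_indep q {}"
proof
  fix f assume f: "f \<in> q \<inter> alg_on {}"
  then obtain c where c: "f = single 0 c" using alg_on_empty_single by blast
  show "f \<in> {0}"
  proof (rule ccontr)
    assume "f \<notin> {0}"
    then have "c \<noteq> 0" using c by auto
    then have "single 0 (inverse c) * f = 1" by (simp add: c mult_single single_one)
    then show False using LSpecD(4)[OF q, of f "single 0 (inverse c)"] LSpecD(7)[OF q] f by auto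
  qed
qed

lemma indep_card_witness:
  "\<exists>J\<subseteq>I. alg_indep q J \<and> card J = indep_card I q"
proof -
  have "finite (card ` Pow I)" using fin by simp
  then have "finite {card J | J. J \<subseteq> I \<and> alg_indep q J}" by (rule rev_finite_subset) auto
  moreover have "{card J | J. J \<subseteq> I \<and> alg_indep q J} \<noteq> {}" using indep_empty by blast
  ultimately have "indep_card I q \<in> {card J | J. J \<subseteq> I \<and> alg_indep q J}"
    unfolding indep_card_def by (rule Max_in)
  then show ?thesis by auto
qed

lemma indep_card_le: "indep_card I q \<le> card I"
  using indep_card_witness card_mono[OF fin] by metis

lemma indep_card_witness_maximal:
  assumes "J \<subseteq> I" "card J = indep_card I q" "i \<in> I - J"
  shows "\<not> alg_indep q (insert i J)"
proof
  assume "alg_indep q (insert i J)"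
  then have "card (insert i J) \<le> indep_card I q" using assms by (intro indep_card_ge) auto
  moreover have "card (insert i J) = Suc (card J)"
    using assms finite_subset[OF assms(1) fin] by simp
  ultimately show False using assms(2) by simp
qed

lemma indep_card_strict:
  assumes q': "q' \<in> LSpec I" "q \<subset> q'"
    and J: "J \<subseteq> I" "alg_indep q' J"
  shows "card J < indep_card I q"
proof -
  obtain i where i: "i \<in> I - J" "alg_indep q (insert i J)"
    using independent_lost[OF fin q q'(1,2) J(1,2)] by blast
  then have "card (insert i J) \<le> indep_card I q" using J(1) by (intro indep_card_ge) auto
  then show ?thesis using i finite_subset[OF J(1) fin] by simp
qed

end

lemma indep_card_up:
  assumes fin: "finite I" and q: "q \<in> LSpec I" and pos: "0 < indep_card I q"
  shows "\<exists>q'\<in>LSpec I. q \<subset> q' \<and> indep_card I q \<le> Suc (indep_card I q')"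
proof -
  obtain J where J: "J \<subseteq> I" "alg_indep q J" "card J = indep_card I q"
    using indep_card_witness[OF fin q] by blast
  then obtain j where j: "j \<in> J" using pos by fastforce
  obtain q' where q': "q' \<in> LSpec I" "q \<subset> q'" "alg_indep q' (J - {j})"
    using exists_prime_above[OF fin q J(1,2) indep_card_witness_maximal[OF fin q J(1,3)] j] by blast
  then have "card (J - {j}) \<le> indep_card I q'" using J(1) by (intro indep_card_ge[OF fin q'(1)]) auto
  then show ?thesis using q' J(3) card_Suc_Diff1[OF finite_subset[OF J(1) fin] j] by auto
qed

text \<open>The prime below \<open>q\<close> is generated by the part of \<open>q\<close> not involving a variable \<open>x\<^sub>i\<close> that is
  algebraic over the others.\<close>

lemma indep_card_down:
  fixes q :: "'k::field laurent set"
  assumes fin: "finite I" and q: "q \<in> LSpec I" and lt: "indep_card I q < card I"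
  shows "\<exists>q'\<in>LSpec I. q' \<subset> q \<and> indep_card I q' \<le> Suc (indep_card I q)"
proof -
  obtain J where J: "J \<subseteq> I" "alg_indep q J" "card J = indep_card I q"
    using indep_card_witness[OF fin q] by blast
  then have "J \<noteq> I" using lt by auto
  then obtain i where i: "i \<in> I" "i \<notin> J" using J(1) by blast
  define q' where "q' = var_extend (I - {i}) i (q \<inter> alg_on (I - {i}))"
  have I: "insert i (I - {i}) = I" using i by blast
  have "q' \<in> LSpec (insert i (I - {i}))" unfolding q'_def
    by (rule LSpec_var_extend[OF LSpec_contract[OF q]]) auto
  then have q': "q' \<in> LSpec I" using I by simp
  have "q' \<subseteq> q"
  proof
    fix f assume f: "f \<in> q'"
    have "(\<Sum>k\<in>var_exps i f. var_coeff i k f * var_pow i k) \<in> q"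
      using f i by (intro LSpecD(8)[OF q] LSpecD(5)[OF q] var_pow_in_alg_on) (auto simp: q'_def var_extend_def)
    then show "f \<in> q" using var_coeff_expand[of f i] by simp
  qed
  have iJ: "insert i J \<subseteq> I" using i J by blast
  have indep': "alg_indep q' (insert i J)"
  proof
    fix f assume f: "f \<in> q' \<inter> alg_on (insert i J)"
    have "var_coeff i k f = 0" for k
    proof -
      have "var_coeff i k f \<in> alg_on (insert i J - {i})" using f by (intro var_coeff_in_alg_on) auto
      moreover have "insert i J - {i} = J" using i by blast
      moreover have "var_coeff i k f \<in> q" using f by (auto simp: q'_def var_extend_def)
      ultimately show ?thesis using J(2) by auto
    qed
    then show "f \<in> {0}" using var_coeff_all_zero by blast
  qed
  have "card (insert i J) = Suc (card J)" using i finite_subset[OF J(1) fin] by simp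
  then have "Suc (indep_card I q) \<le> indep_card I q'"
    using indep_card_ge[OF fin q' iJ indep'] J(3) by simp
  then have "q' \<noteq> q" by auto
  \<comment> \<open>Dropping \<open>x_i\<close> from a set independent modulo \<open>q'\<close>
    leaves a set independent modulo \<open>q\<close>: an element of \<open>q\<close> free of
    \<open>x_i\<close> is its own only coefficient and so belongs to \<open>q'\<close>.\<close>
  moreover have "indep_card I q' \<le> Suc (indep_card I q)"
  proof -
    obtain J' where J': "J' \<subseteq> I" "alg_indep q' J'" "card J' = indep_card I q'"
      using indep_card_witness[OF fin q'] by blast
    have "alg_indep q (J' - {i})"
    proof
      fix f assume f: "f \<in> q \<inter> alg_on (J' - {i})"
      then have mem: "f \<in> alg_on (I - {i})" "f \<in> alg_on I" "f \<in> alg_on (- {i})" "f \<in> alg_on J'"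
        using J'(1) alg_on_mono[of "J' - {i}"] by blast+
      then have "var_coeff i k f \<in> q \<inter> alg_on (I - {i})" for k
        using f LSpecD(2)[OF q] by (simp add: var_coeff_const)
      then have "f \<in> q'" using mem(2) I by (simp add: q'_def var_extend_def)
      then show "f \<in> {0}" using J'(2) mem(4) by blast
    qed
    then have "card (J' - {i}) \<le> indep_card I q" using J'(1) by (intro indep_card_ge[OF fin q]) auto
    moreover have "card J' - card {i} \<le> card (J' - {i})" by (rule diff_card_le_card_Diff) simp
    ultimately show ?thesis using J'(3) by simp
  qed
  ultimately show ?thesis using q' \<open>q' \<subseteq> q\<close> by blast
qed

lemma ranked_LSpec:
  assumes fin: "finite I"
  shows "ranked_Spec (alg_rec I) (card I) (\<lambda>q :: 'k::field laurent set. card I - indep_card I q)"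
  unfolding ranked_Spec_def
proof (intro ballI conjI impI)
  fix q :: "'k laurent set" assume q: "q \<in> LSpec I"
  note le = indep_card_le[OF fin]
  show "card I - indep_card I q \<le> card I" by simp
  show "card I - indep_card I q < card I - indep_card I q'" if q': "q' \<in> LSpec I" "q \<subset> q'" for q'
  proof -
    obtain J where J: "J \<subseteq> I" "alg_indep q' J" "card J = indep_card I q'"
      using indep_card_witness[OF fin q'(1)] by blast
    then show ?thesis using indep_card_strict[OF fin q q' J(1,2)] le[OF q] by simp
  qed
  show "\<exists>q'\<in>LSpec I. q' \<subset> q \<and> card I - indep_card I q \<le> Suc (card I - indep_card I q')"
    if "0 < card I - indep_card I q"
  proof -
    have "indep_card I q < card I" using that by simp
    from indep_card_down[OF fin q this] obtain q' where
      "q' \<in> LSpec I" "q' \<subset> q" "indep_card I q' \<le> Suc (indep_card I q)" by blast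
    then show ?thesis by (intro bexI[of _ q']) auto
  qed
  show "\<exists>q'\<in>LSpec I. q \<subset> q' \<and> card I - indep_card I q' \<le> Suc (card I - indep_card I q)"
    if "card I - indep_card I q < card I"
  proof -
    have "0 < indep_card I q" using that by (cases "indep_card I q = 0") auto
    from indep_card_up[OF fin q this] obtain q' where
      "q' \<in> LSpec I" "q \<subset> q'" "indep_card I q \<le> Suc (indep_card I q')" by blast
    then show ?thesis using le[OF q] by (intro bexI[of _ q']) auto
  qed
qed

section \<open>Jacobson algebras: corners, classification of primes and rank\<close>

section \<open>The bicyclic monoid and the algebras it generates\<close>

text \<open>\<open>Bic a b\<close> stands for \<open>x\<^sup>a y\<^sup>b\<close>. The bicyclic product is written additively, although it does not
  commute, because polynomial mappings multiply by adding their indices.\<close>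

datatype bic = Bic (bic_x: nat) (bic_y: nat)

instantiation bic :: monoid_add
begin

definition zero_bic :: bic where "0 = Bic 0 0"

definition plus_bic :: "bic \<Rightarrow> bic \<Rightarrow> bic" where
  "p + q = Bic (bic_x p + bic_x q - min (bic_y p) (bic_x q)) (bic_y p + bic_y q - min (bic_y p) (bic_x q))"

instance
proof
  fix a b c :: bic
  show "a + b + c = a + (b + c)" by (cases a; cases b; cases c) (auto simp: plus_bic_def min_def)
  show "0 + a = a" "a + 0 = a" by (cases a; simp add: plus_bic_def zero_bic_def)+
qed

end

type_synonym 'k jacobson = "(nat \<Rightarrow> bic) \<Rightarrow>\<^sub>0 'k"

definition bic_deg :: "bic \<Rightarrow> int" where
  "bic_deg p = int (bic_x p) - int (bic_y p)"

lemma bic_deg_simps [simp]: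
  "bic_deg 0 = 0" "bic_deg (p + q) = bic_deg p + bic_deg q" "bic_deg (Bic a b) = int a - int b"
  by (auto simp: bic_deg_def zero_bic_def plus_bic_def of_nat_diff)

lemma bic_absorb:
  "0 < bic_x p \<Longrightarrow> Bic 1 1 + p = p" "0 < bic_y p \<Longrightarrow> p + Bic 1 1 = p"
  by (cases p; auto simp: plus_bic_def min_def)+

text \<open>Decides when the monomial 1 survives in \<open>p (1 - x y) q\<close>: it occurs in both
  \<open>p q\<close> and \<open>p x y q\<close> and cancels, or in neither, unless
  \<open>p = q = 1\<close>.\<close>

lemma bic_sum_zero_cases:
  "p + q = 0 \<longleftrightarrow> p = 0 \<and> q = 0 \<or> p + (Bic 1 1 + q) = 0"
  "\<not> (p = 0 \<and> q = 0 \<and> p + (Bic 1 1 + q) = 0)"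
  by (cases p; cases q; auto simp: plus_bic_def zero_bic_def min_def)+

definition xy_mono :: "nat set \<Rightarrow> nat \<Rightarrow> bic" where
  "xy_mono B = (\<lambda>j. if j \<in> B then Bic 1 1 else 0)"

lemma xy_mono_insert:
  assumes "i \<notin> B"
  shows "xy_mono (insert i B) = xy_mono {i} + xy_mono B" "xy_mono (insert i B) = xy_mono B + xy_mono {i}"
  using assms by (auto simp: xy_mono_def fun_eq_iff)

text \<open>\<open>idem i\<close> is the matrix unit \<open>1 - x\<^sub>i y\<^sub>i\<close> of \<open>F(i)\<close>, and \<open>idems A\<close> is the product of the
  \<open>idem i\<close> for \<open>i \<in> A\<close>, expanded so that no order of the factors has to be chosen.\<close>

definition idem :: "nat \<Rightarrow> 'k::field jacobson" where
  "idem i = 1 - single (xy_mono {i}) 1"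

definition idems :: "nat set \<Rightarrow> 'k::field jacobson" where
  "idems A = (\<Sum>B\<in>Pow A. (- 1) ^ card B * single (xy_mono B) 1)"

lemma idems_empty [simp]: "idems {} = 1"
proof -
  have "xy_mono {} = 0" by (auto simp: xy_mono_def)
  then show ?thesis by (simp add: idems_def single_one)
qed

lemma idems_insert:
  assumes fin: "finite A" and i: "i \<notin> A"
  shows "idems (insert i A) = idem i * (idems A :: 'k::field jacobson)"
    and "idems (insert i A) = (idems A :: 'k::field jacobson) * idem i"
proof -
  let ?s = "\<lambda>B. single (xy_mono B) 1 :: 'k jacobson"
  have inj: "inj_on (insert i) (Pow A)" using i by (auto simp: inj_on_def)
  have "Pow A \<inter> insert i ` Pow A = {}" using i by auto
  then have "(idems (insert i A) :: 'k jacobson) = idems A + (\<Sum>B\<in>Pow A. (- 1) ^ card (insert i B) * ?s (insert i B))"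
    unfolding idems_def Pow_insert using fin by (subst sum.union_disjoint) (auto simp: sum.reindex[OF inj])
  also have "(\<Sum>B\<in>Pow A. (- 1) ^ card (insert i B) * ?s (insert i B)) = (\<Sum>B\<in>Pow A. - ((- 1) ^ card B * ?s (insert i B)))"
  proof (intro sum.cong refl)
    fix B assume "B \<in> Pow A"
    then have "card (insert i B) = Suc (card B)" using i fin by (auto intro!: card_insert_disjoint dest: finite_subset)
    then show "(- 1) ^ card (insert i B) * ?s (insert i B) = - ((- 1) ^ card B * ?s (insert i B))" by simp
  qed
  finally have *: "(idems (insert i A) :: 'k jacobson) = idems A - (\<Sum>B\<in>Pow A. (- 1) ^ card B * ?s (insert i B))"
    by (simp add: sum_negf)
  have c: "?s {i} * (- 1) ^ n = (- 1) ^ n * ?s {i}" for n by (cases "even n") simp_all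
  have nB: "i \<notin> B" if "B \<in> Pow A" for B using that i by blast
  have s1: "?s (insert i B) = ?s {i} * ?s B" if "B \<in> Pow A" for B
    unfolding xy_mono_insert(1)[OF nB[OF that]] by (simp add: mult_single)
  have s2: "?s (insert i B) = ?s B * ?s {i}" if "B \<in> Pow A" for B
    unfolding xy_mono_insert(2)[OF nB[OF that]] by (simp add: mult_single)
  have "(\<Sum>B\<in>Pow A. (- 1) ^ card B * ?s (insert i B)) = ?s {i} * idems A"
    unfolding idems_def sum_distrib_left by (intro sum.cong refl) (simp only: s1 c mult.assoc[symmetric])
  then show "idems (insert i A) = idem i * (idems A :: 'k jacobson)" unfolding * by (simp add: idem_def algebra_simps)
  have "(\<Sum>B\<in>Pow A. (- 1) ^ card B * ?s (insert i B)) = idems A * ?s {i}"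
    unfolding idems_def sum_distrib_right by (intro sum.cong refl) (simp only: s2 mult.assoc)
  then show "idems (insert i A) = (idems A :: 'k jacobson) * idem i" unfolding * by (simp add: idem_def algebra_simps)
qed

lemma xy_single_in_alg_on: "i \<in> I \<Longrightarrow> single (xy_mono {i}) c \<in> alg_on I"
  by (rule single_in_alg_on) (auto simp: supp_on_def xy_mono_def)

lemma idem_in_alg_on: "i \<in> I \<Longrightarrow> idem i \<in> alg_on I"
  by (simp add: idem_def xy_single_in_alg_on)

lemma idems_in_alg_on:
  assumes "finite A" "A \<subseteq> I" shows "idems A \<in> alg_on I"
  using assms by (induction A) (simp_all add: idems_insert(1) idem_in_alg_on)

lemma alg_on_disjoint_commute:
  assumes f: "f \<in> alg_on A" and g: "g \<in> (alg_on B :: ((nat \<Rightarrow> 'g::monoid_add) \<Rightarrow>\<^sub>0 'k::field) set)"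
    and AB: "A \<inter> B = {}"
  shows "f * g = g * f"
proof (rule additive_eqI[of "\<lambda>f. f * g" "\<lambda>f. g * f" "supp_on A"])
  fix u :: "nat \<Rightarrow> 'g" and c :: 'k assume u: "u \<in> supp_on A"
  show "single u c * g = g * single u c"
  proof (rule additive_eqI[of "\<lambda>g. _ * g" "\<lambda>g. g * _" "supp_on B"])
    fix v :: "nat \<Rightarrow> 'g" and d :: 'k assume v: "v \<in> supp_on B"
    have "u + v = v + u"
    proof
      fix i show "(u + v) i = (v + u) i" using u v AB by (cases "i \<in> A") (auto simp: supp_on_def)
    qed
    then show "single u c * single v d = single v d * single u c"
      by (simp add: mult_single mult.commute)
  qed (use g in \<open>simp_all add: algebra_simps alg_on_def\<close>)
qed (use f in \<open>simp_all add: algebra_simps alg_on_def\<close>)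

text \<open>From \<open>y x = 1\<close> follow \<open>(1 - x y) x = 0\<close> and
  \<open>y (1 - x y) = 0\<close>.\<close>

lemma idem_mult_single:
  "0 < bic_x (m i) \<Longrightarrow> idem i * single m (c::'k::field) = 0"
  "0 < bic_y (m i) \<Longrightarrow> single m c * idem i = (0 :: 'k::field jacobson)"
proof -
  have "xy_mono {i} + m = m" if "0 < bic_x (m i)"
    using that bic_absorb(1)[of "m i"] by (auto simp: xy_mono_def fun_eq_iff)
  then show "0 < bic_x (m i) \<Longrightarrow> idem i * single m c = 0"
    by (simp add: idem_def left_diff_distrib mult_single)
  have "m + xy_mono {i} = m" if "0 < bic_y (m i)"
    using that bic_absorb(2)[of "m i"] by (auto simp: xy_mono_def fun_eq_iff)
  then show "0 < bic_y (m i) \<Longrightarrow> single m c * idem i = (0 :: 'k jacobson)"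
    by (simp add: idem_def right_diff_distrib mult_single)
qed

lemma idem_idem: "idem i * idem i = (idem i :: 'k::field jacobson)"
proof -
  have "single (xy_mono {i}) 1 * idem i = (0 :: 'k jacobson)"
    by (rule idem_mult_single(2)) (simp add: xy_mono_def)
  then show ?thesis by (subst (1) idem_def) (simp add: left_diff_distrib)
qed

lemma idems_idem:
  assumes "finite A" shows "idems A * idems A = (idems A :: 'k::field jacobson)"
  using assms
proof (induction A)
  case (insert i A)
  have "idems (insert i A) * idems (insert i A) = (idem i * (idems A * idems A) * idem i :: 'k jacobson)"
    by (subst (1) idems_insert(1)[OF insert.hyps], subst (1) idems_insert(2)[OF insert.hyps]) (simp add: mult.assoc)
  also have "\<dots> = idem i * (idem i * idems A)"
    using insert.IH idems_insert[OF insert.hyps, where 'k = 'k] by (simp add: mult.assoc)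
  also have "\<dots> = idems (insert i A)"
    by (simp add: mult.assoc[symmetric] idem_idem idems_insert(1)[OF insert.hyps])
  finally show ?case .
qed simp

section \<open>The corner map\<close>

text \<open>\<open>corner N a\<close> is the element of \<open>L\<close> with \<open>e a e \<equiv> e \<cdot> corner N a\<close> modulo the ideals \<open>F(i)\<close>,
  \<open>i \<notin> N\<close>, where \<open>e = idems N\<close>: all monomials with a nontrivial factor in \<open>N\<close> are killed by \<open>e\<close>
  from one side.\<close>

definition corner :: "nat set \<Rightarrow> 'k::field jacobson \<Rightarrow> 'k laurent" where
  "corner N = lin_ext (\<lambda>m. if \<forall>i\<in>N. m i = 0 then single (\<lambda>i. bic_deg (m i)) 1 else 0)"

lemma corner_linear [simp]:
  "corner N 0 = 0" "corner N (a + b) = corner N a + corner N b"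
  "corner N (- a) = - corner N a" "corner N (a - b) = corner N a - corner N b"
  by (simp_all add: corner_def)

lemma corner_single:
  "corner N (single m c) = (if \<forall>i\<in>N. m i = 0 then single (\<lambda>i. bic_deg (m i)) c else 0)"
  by (simp add: corner_def mult_single)

lemma corner_one [simp]: "corner N 1 = 1"
  unfolding single_one[symmetric] corner_single by (simp add: zero_fun_def)

lemma corner_in_alg_on:
  assumes "a \<in> alg_on I" shows "corner N a \<in> alg_on (I - N)"
  unfolding corner_def
proof (rule lin_ext_in_alg_on)
  fix m assume "m \<in> keys a"
  then have "m \<in> supp_on I" using assms by (auto simp: alg_on_def)
  then show "(if \<forall>i\<in>N. m i = 0 then single (\<lambda>i. bic_deg (m i)) 1 else 0) \<in> alg_on (I - N)"
    by (auto intro!: single_in_alg_on simp: supp_on_def)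
qed

text \<open>The induction needs a subset \<open>A\<close> of \<open>N\<close>: for variables in
  \<open>A\<close> the idempotent has been inserted, for the others in \<open>N\<close> only the
  product of \<open>u\<close> and \<open>v\<close> must be trivial. Expanding
  \<open>1 - x_i y_i\<close> absorbs \<open>x_i y_i\<close> into \<open>v\<close>, which therefore
  has to vary.\<close>

lemma corner_idems_single:
  assumes "finite A" "A \<subseteq> N"
  shows "corner N (single u 1 * idems A * single v 1) =
    (if (\<forall>i\<in>A. u i = 0 \<and> v i = 0) \<and> (\<forall>i\<in>N - A. u i + v i = 0)
     then single (\<lambda>i. bic_deg (u i) + bic_deg (v i)) 1 else (0 :: 'k::field laurent))"
  using assms
proof (induction A arbitrary: v)
  case empty
  then show ?case by (simp add: mult_single corner_single)
next
  case (insert i A)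
  let ?v = "xy_mono {i} + v"
  let ?C = "(\<forall>j\<in>A. u j = 0 \<and> v j = 0) \<and> (\<forall>j\<in>N - insert i A. u j + v j = 0)"
  let ?d = "single (\<lambda>i. bic_deg (u i) + bic_deg (v i)) 1 :: 'k laurent"
  have i: "i \<in> N" "i \<notin> A" "A \<subseteq> N" using insert by auto
  have vj: "?v j = (if j = i then Bic 1 1 + v i else v j)" for j by (simp add: xy_mono_def)
  have N: "(\<forall>j\<in>N - A. Q j) \<longleftrightarrow> Q i \<and> (\<forall>j\<in>N - insert i A. Q j)" for Q using i by blast
  have deg: "bic_deg (?v j) = bic_deg (v j)" for j unfolding vj by simp
  have "corner N (single u 1 * idems (insert i A) * single v 1) =
     corner N (single u 1 * idems A * single v 1) -
     corner N (single u 1 * idems A * (single ?v 1 :: 'k jacobson))"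
    unfolding idems_insert(2)[OF insert.hyps] idem_def
    by (simp add: algebra_simps mult_single)
  also have "corner N (single u 1 * idems A * (single v 1 :: 'k jacobson)) =
     (if u i + v i = 0 \<and> ?C then ?d else 0)"
    unfolding insert.IH[OF i(3)] N by (intro if_cong) auto
  also have "corner N (single u 1 * idems A * (single ?v 1 :: 'k jacobson)) =
     (if u i + (Bic 1 1 + v i) = 0 \<and> ?C then ?d else 0)"
  proof -
    have "(\<forall>j\<in>A. u j = 0 \<and> ?v j = 0) \<longleftrightarrow> (\<forall>j\<in>A. u j = 0 \<and> v j = 0)" unfolding vj using i(2) by auto
    moreover have "(\<forall>j\<in>N - insert i A. u j + ?v j = 0) \<longleftrightarrow> (\<forall>j\<in>N - insert i A. u j + v j = 0)" unfolding vj by auto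
    moreover have "u i + ?v i = u i + (Bic 1 1 + v i)" unfolding vj by simp
    ultimately show ?thesis unfolding insert.IH[OF i(3)] N deg by (intro if_cong) auto
  qed
  also have "(if u i + v i = 0 \<and> ?C then ?d else 0) - (if u i + (Bic 1 1 + v i) = 0 \<and> ?C then ?d else 0) =
     (if (\<forall>j\<in>insert i A. u j = 0 \<and> v j = 0) \<and> (\<forall>j\<in>N - insert i A. u j + v j = 0) then ?d else 0)"
    using bic_sum_zero_cases[of "u i" "v i"] by (cases ?C) auto
  finally show ?case .
qed

text \<open>For nonempty \<open>N\<close> the corner map is not multiplicative:
  \<open>y_i x_i = 1\<close>, while both factors have corner 0 if \<open>i\<close> is in
  \<open>N\<close>. Inserting \<open>idems N\<close> repairs this, as it does in
  \<open>(e a e)(e b e)\<close>.\<close>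

lemma corner_idems_mult:
  assumes fin: "finite N"
  shows "corner N (a * idems N * b) = corner N a * (corner N b :: 'k::field laurent)"
proof (rule additive_eqI[of "\<lambda>a. corner N (a * idems N * b)" "\<lambda>a. corner N a * corner N b" UNIV])
  fix u and c :: 'k
  show "corner N (single u c * idems N * b) = corner N (single u c) * corner N b"
  proof (rule additive_eqI[of "\<lambda>b. corner N (_ * b)" "\<lambda>b. _ * corner N b" UNIV])
    fix v and d :: 'k
    have "single u c * idems N * single v d =
       single 0 (c * d) * (single u 1 * idems N * single v 1)"
    proof -
      have "single u c * idems N * single v d =
        single 0 c * (single u 1 * idems N * single 0 d) * single v 1"
        by (subst single_split[of u c], subst single_split[of v d]) (simp add: mult.assoc)
      also have "\<dots> = single 0 c * single 0 d * (single u 1 * idems N) * single v 1"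
        unfolding single_zero_commute[of "single u 1 * idems N" d] by (simp only: mult.assoc)
      finally show ?thesis by (simp add: mult_single mult.assoc)
    qed
    then have "corner N (single u c * idems N * single v d) =
       single 0 (c * d) * corner N (single u 1 * idems N * single v 1)"
      by (simp add: corner_def lin_ext_scale)
    also have "\<dots> = corner N (single u c) * corner N (single v d)"
      unfolding corner_idems_single[OF fin order_refl] by (auto simp: corner_single mult_single plus_fun_def)
    finally show "corner N (single u c * idems N * single v d) =
       corner N (single u c) * corner N (single v d)" .
  qed (simp_all add: algebra_simps)
qed (simp_all add: algebra_simps)

text \<open>An element free of the variables in \<open>N\<close> leaves the test at \<open>N\<close>
  untouched and enters only through its degrees, which are additive in a commutative group; so it
  can be pulled out from between \<open>s\<close> and \<open>t\<close>.\<close>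

lemma corner_mult_disjoint:
  fixes c s t :: "'k::field jacobson"
  assumes c: "c \<in> alg_on (- N)"
  shows "corner N (s * c * t) = corner N (s * t) * corner N c"
proof (rule additive_eqI[of "\<lambda>c. corner N (s * c * t)" "\<lambda>c. corner N (s * t) * corner N c" "supp_on (- N)"])
  fix w :: "nat \<Rightarrow> bic" and d :: 'k assume w: "w \<in> supp_on (- N)"
  let ?w = "single w d"
  show "corner N (s * ?w * t) = corner N (s * t) * corner N ?w"
  proof (rule additive_eqI[of "\<lambda>s. corner N (s * ?w * t)" "\<lambda>s. corner N (s * t) * corner N ?w" UNIV])
    fix u :: "nat \<Rightarrow> bic" and c1 :: 'k
    let ?u = "single u c1"
    show "corner N (?u * ?w * t) = corner N (?u * t) * corner N ?w"
    proof (rule additive_eqI[of "\<lambda>t. corner N (?u * ?w * t)" "\<lambda>t. corner N (?u * t) * corner N ?w" UNIV])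
      fix v :: "nat \<Rightarrow> bic" and c2 :: 'k
      have "\<And>i. i \<in> N \<Longrightarrow> w i = 0" using w by (auto simp: supp_on_def)
      then show "corner N (?u * ?w * single v c2) = corner N (?u * single v c2) * corner N ?w"
        by (auto simp: mult_single corner_single plus_fun_def algebra_simps)
    qed (simp_all add: algebra_simps)
  qed (simp_all add: algebra_simps)
qed (use c in \<open>simp_all add: algebra_simps alg_on_def\<close>)

text \<open>A linear section of the corner map, choosing a power of \<open>x_i\<close> or of
  \<open>y_i\<close> by the sign of the exponent. It is not multiplicative, since
  \<open>x_i y_i\<close> is not 1.\<close>

definition laurent_lift :: "'k::field laurent \<Rightarrow> 'k jacobson" where
  "laurent_lift = lin_ext (\<lambda>e. single (\<lambda>i. Bic (nat (e i)) (nat (- e i))) 1)"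

lemma laurent_lift_linear [simp]:
  "laurent_lift 0 = 0" "laurent_lift (a + b) = laurent_lift a + laurent_lift b"
  by (simp_all add: laurent_lift_def)

lemma laurent_lift_in_alg_on:
  assumes "l \<in> alg_on I" shows "laurent_lift l \<in> alg_on I"
  unfolding laurent_lift_def
proof (rule lin_ext_in_alg_on)
  fix e assume "e \<in> keys l"
  then have "e \<in> supp_on I" using assms by (auto simp: alg_on_def)
  then show "single (\<lambda>i. Bic (nat (e i)) (nat (- e i))) 1 \<in> alg_on I"
    by (auto intro!: single_in_alg_on simp: supp_on_def zero_bic_def)
qed

lemma corner_laurent_lift:
  fixes l :: "'k::field laurent"
  assumes "l \<in> alg_on (- N)" shows "corner N (laurent_lift l) = l"
proof (rule additive_eqI[of "\<lambda>l. corner N (laurent_lift l)" "\<lambda>l. l" "supp_on (- N)"])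
  fix e :: "nat \<Rightarrow> int" and c :: 'k assume "e \<in> supp_on (- N)"
  then have e0: "e i = 0" if "i \<in> N" for i using that by (auto simp: supp_on_def)
  have "laurent_lift (single e c) = single (\<lambda>i. Bic (nat (e i)) (nat (- e i))) c"
    by (simp add: laurent_lift_def mult_single)
  moreover have "int (nat (e i)) - int (nat (- e i)) = e i" for i by simp
  ultimately show "corner N (laurent_lift (single e c)) = single e c"
    using e0 by (simp add: corner_single zero_bic_def)
qed (use assms in \<open>simp_all add: alg_on_def\<close>)

section \<open>Primes of the Jacobson algebras\<close>

abbreviation JSpec :: "nat set \<Rightarrow> 'k::field jacobson set set" where
  "JSpec I \<equiv> Spec (alg_rec I)"

lemmas JSpecD = Spec_subring_recD[OF unital_subring_alg_on]

lemma JSpec_diff: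
  fixes P :: "'k::field jacobson set"
  shows "P \<in> JSpec I \<Longrightarrow> a \<in> P \<Longrightarrow> b \<in> P \<Longrightarrow> a - b \<in> P"
  using JSpecD(3)[of P I a "- b"] JSpecD(6)[of P I b] by simp

text \<open>For a prime \<open>q\<close>, the largest two-sided ideal whose corner lies in
  \<open>q\<close>. It stands in for the tensor ideal until the two are identified at the
  end.\<close>

definition corner_ideal :: "nat set \<Rightarrow> nat set \<Rightarrow> 'k::field laurent set \<Rightarrow> 'k jacobson set" where
  "corner_ideal I N q = {f \<in> alg_on I. \<forall>s\<in>alg_on I. \<forall>t\<in>alg_on I. corner N (s * f * t) \<in> q}"

lemma corner_ideal_mult:
  assumes "f \<in> corner_ideal I N q" "r \<in> alg_on I"
  shows "r * f \<in> corner_ideal I N q" "f * r \<in> corner_ideal I N q"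
proof -
  have "corner N (s * (r * f) * t) \<in> q" if "s \<in> alg_on I" "t \<in> alg_on I" for s t
  proof -
    have "corner N ((s * r) * f * t) \<in> q" using assms that unfolding corner_ideal_def by simp
    then show ?thesis by (simp add: mult.assoc)
  qed
  then show "r * f \<in> corner_ideal I N q" using assms unfolding corner_ideal_def by simp
  have "corner N (s * (f * r) * t) \<in> q" if "s \<in> alg_on I" "t \<in> alg_on I" for s t
  proof -
    have "corner N (s * f * (r * t)) \<in> q" using assms that unfolding corner_ideal_def by simp
    then show ?thesis by (simp add: mult.assoc)
  qed
  then show "f * r \<in> corner_ideal I N q" using assms unfolding corner_ideal_def by simp
qed

text \<open>If \<open>s a t\<close> and \<open>s' b t'\<close> have corners outside
  \<open>q\<close>, the middle factor \<open>t * idems N * s'\<close> witnesses primeness, because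
  the corner of the product is then the product of the corners.\<close>

lemma corner_ideal_in_JSpec:
  fixes q :: "'k::field laurent set"
  assumes fin: "finite I" and N: "N \<subseteq> I" and q: "q \<in> LSpec (I - N)"
  shows "corner_ideal I N q \<in> JSpec I"
proof (rule Spec_subring_recI[OF unital_subring_alg_on])
  let ?P = "corner_ideal I N q"
  note qD = LSpecD[OF q]
  have finN: "finite N" using N fin by (rule finite_subset)
  have e: "idems N \<in> (alg_on I :: 'k jacobson set)" using idems_in_alg_on[OF finN N] .
  show "?P \<subseteq> alg_on I" by (auto simp: corner_ideal_def)
  show "0 \<in> ?P" using qD(2) by (simp add: corner_ideal_def)
  show "a + b \<in> ?P" if "a \<in> ?P" "b \<in> ?P" for a b
    using that qD(3) by (simp add: corner_ideal_def algebra_simps)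
  show "r * a \<in> ?P" if "a \<in> ?P" "r \<in> alg_on I" for a r by (rule corner_ideal_mult(1)[OF that])
  show "a * r \<in> ?P" if "a \<in> ?P" "r \<in> alg_on I" for a r by (rule corner_ideal_mult(2)[OF that])
  show "1 \<notin> ?P"
  proof
    assume "1 \<in> ?P"
    then have "corner N (1 * 1 * 1) \<in> q" unfolding corner_ideal_def
      by (simp only: mem_Collect_eq alg_on_closed)
    then show False using qD(7) by simp
  qed
  fix a b :: "'k jacobson" assume a: "a \<in> alg_on I - ?P" and b: "b \<in> alg_on I - ?P"
  obtain s t where st: "s \<in> alg_on I" "t \<in> alg_on I" "corner N (s * a * t) \<notin> q"
    using a unfolding corner_ideal_def by blast
  obtain s' t' where st': "s' \<in> alg_on I" "t' \<in> alg_on I" "corner N (s' * b * t') \<notin> q"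
    using b unfolding corner_ideal_def by blast
  have "corner N (s * a * t) \<in> alg_on (I - N)" "corner N (s' * b * t') \<in> alg_on (I - N)"
    using a b st st' by (intro corner_in_alg_on; simp)+
  from LSpec_prime[OF q this] have "corner N (s * a * t) * corner N (s' * b * t') \<notin> q"
    using st(3) st'(3) by blast
  moreover have "s * a * t * idems N * (s' * b * t') = s * (a * (t * idems N * s') * b) * t'"
    by (simp add: mult.assoc)
  ultimately have "corner N (s * (a * (t * idems N * s') * b) * t') \<notin> q"
    using corner_idems_mult[OF finN, of "s * a * t" "s' * b * t'"] by simp
  then have "a * (t * idems N * s') * b \<notin> ?P" using st st' unfolding corner_ideal_def by blast
  then show "\<exists>s\<in>alg_on I. a * s * b \<notin> ?P" using st st' e by (intro bexI[of _ "t * idems N * s'"]) simp_all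
qed

lemma corner_idem: "corner N (idem i) = (if i \<in> N then 1 else 0)"
proof -
  have "(\<forall>j\<in>N. xy_mono {i} j = 0) \<longleftrightarrow> i \<notin> N" by (auto simp: xy_mono_def zero_bic_def)
  moreover have "(\<lambda>j. bic_deg (xy_mono {i} j)) = 0" by (auto simp: xy_mono_def)
  ultimately show ?thesis by (simp add: idem_def corner_single single_one)
qed

text \<open>This test recovers \<open>N\<close> from the ideal, and the next one, on lifts, recovers
  \<open>q\<close>; together they also decode inclusions.\<close>

lemma idem_in_corner_ideal:
  fixes q :: "'k::field laurent set"
  assumes N: "N \<subseteq> I" and q: "q \<in> LSpec (I - N)" and i: "i \<in> I"
  shows "idem i \<in> corner_ideal I N q \<longleftrightarrow> i \<notin> N"
proof -
  show ?thesis
  proof (cases "i \<in> N")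
    case True
    have "idem i \<notin> corner_ideal I N q"
    proof
      assume "idem i \<in> corner_ideal I N q"
      then have "corner N (1 * idem i * 1) \<in> q" unfolding corner_ideal_def
        by (simp only: mem_Collect_eq alg_on_closed)
      then show False using True LSpecD(7)[OF q] by (simp add: corner_idem)
    qed
    then show ?thesis using True by simp
  next
    case False
    have "corner N (s * idem i * t) = (0 :: 'k laurent)" for s t
      using corner_mult_disjoint[of "idem i" N s t, OF idem_in_alg_on] False by (simp add: corner_idem)
    then have "idem i \<in> corner_ideal I N q"
      using LSpecD(2)[OF q] idem_in_alg_on[OF i, where 'a = 'k] by (simp add: corner_ideal_def)
    then show ?thesis using False by simp
  qed
qed

lemma laurent_lift_in_corner_ideal:
  fixes q :: "'k::field laurent set"
  assumes N: "N \<subseteq> I" and q: "q \<in> LSpec (I - N)" and l: "l \<in> alg_on (I - N)"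
  shows "laurent_lift l \<in> corner_ideal I N q \<longleftrightarrow> l \<in> q"
proof -
  have lN: "l \<in> alg_on (- N)" using l alg_on_mono[of "I - N" "- N"] by blast
  have c: "corner N (s * laurent_lift l * t) = corner N (s * t) * l" for s t
    using corner_mult_disjoint[OF laurent_lift_in_alg_on[OF lN], of s t] corner_laurent_lift[OF lN] by simp
  have lI: "laurent_lift l \<in> alg_on I" using laurent_lift_in_alg_on[OF l] alg_on_mono[of "I - N" I] by blast
  show ?thesis
  proof
    assume "laurent_lift l \<in> corner_ideal I N q"
    then have "corner N (1 * laurent_lift l * 1) \<in> q" unfolding corner_ideal_def
        by (simp only: mem_Collect_eq alg_on_closed)
    then show "l \<in> q" unfolding c by simp
  next
    assume l: "l \<in> q"
    have "corner N (s * laurent_lift l * t) \<in> q" if "s \<in> alg_on I" "t \<in> alg_on I" for s t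
      unfolding c by (rule LSpecD(4)[OF q l corner_in_alg_on]) (use that in simp)
    then show "laurent_lift l \<in> corner_ideal I N q" using lI unfolding corner_ideal_def by blast
  qed
qed

lemma corner_ideal_subsetD:
  fixes q1 q2 :: "'k::field laurent set"
  assumes N: "N1 \<subseteq> I" "N2 \<subseteq> I" and q: "q1 \<in> LSpec (I - N1)" "q2 \<in> LSpec (I - N2)"
    and sub: "corner_ideal I N1 q1 \<subseteq> corner_ideal I N2 q2"
  shows "N2 \<subseteq> N1" "q1 \<subseteq> q2"
proof -
  show N21: "N2 \<subseteq> N1"
  proof
    fix i assume i: "i \<in> N2"
    then have "i \<in> I" using N by blast
    then have "idem i \<in> corner_ideal I N1 q1 \<longleftrightarrow> i \<notin> N1" "idem i \<in> corner_ideal I N2 q2 \<longleftrightarrow> i \<notin> N2"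
      using idem_in_corner_ideal N q by blast+
    then show "i \<in> N1" using sub i by blast
  qed
  show "q1 \<subseteq> q2"
  proof
    fix l assume l: "l \<in> q1"
    then have l1: "l \<in> alg_on (I - N1)" using LSpecD(1)[OF q(1)] by blast
    moreover have "I - N1 \<subseteq> I - N2" using N21 by blast
    ultimately have l2: "l \<in> alg_on (I - N2)" using alg_on_mono by blast
    have "laurent_lift l \<in> corner_ideal I N1 q1" using laurent_lift_in_corner_ideal[OF N(1) q(1) l1] l by blast
    then have "laurent_lift l \<in> corner_ideal I N2 q2" using sub by blast
    then show "l \<in> q2" using laurent_lift_in_corner_ideal[OF N(2) q(2) l2] by blast
  qed
qed

lemma corner_ideal_mono: "q \<subseteq> q' \<Longrightarrow> corner_ideal I N q \<subseteq> corner_ideal I N q'"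
  by (auto simp: corner_ideal_def)

definition x_pow :: "nat \<Rightarrow> nat \<Rightarrow> 'k::field jacobson" where
  "x_pow i b = single (\<lambda>j. if j = i then Bic b 0 else 0) 1"

definition y_pow :: "nat \<Rightarrow> nat \<Rightarrow> 'k::field jacobson" where
  "y_pow i b = single (\<lambda>j. if j = i then Bic 0 b else 0) 1"

text \<open>Sandwiching by \<open>y\<^sub>i\<^sup>b\<^sup>+\<^sup>z\<close> and \<open>x\<^sub>i\<^sup>b\<close> with \<open>b\<close> large extracts the coefficient of \<open>x\<^sub>i\<^sup>z\<close>.\<close>

lemma corner_remove_variable:
  fixes g :: "'k::field jacobson"
  assumes i: "i \<notin> N" and b: "\<And>m. m \<in> keys g \<Longrightarrow> bic_x (m i) \<le> b \<and> bic_y (m i) \<le> b"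
  shows "corner N g = (\<Sum>z\<in>{- int b..int b}. var_pow i z * corner (insert i N)
    (y_pow i (nat (int b + z)) * g * x_pow i b))"
proof -
  let ?y = "\<lambda>z. (\<lambda>j. if j = i then Bic 0 (nat (int b + z)) else 0) :: nat \<Rightarrow> bic"
  let ?x = "(\<lambda>j. if j = i then Bic b 0 else 0) :: nat \<Rightarrow> bic"
  let ?Y = "\<lambda>z. single (?y z) 1 :: 'k jacobson"
  let ?X = "single ?x 1 :: 'k jacobson"
  show ?thesis unfolding x_pow_def y_pow_def
  proof (rule additive_eqI[of "\<lambda>g. corner N g"
       "\<lambda>g. \<Sum>z\<in>{- int b..int b}. var_pow i z * corner (insert i N) (?Y z * g * ?X)"
       "{m. bic_x (m i) \<le> b \<and> bic_y (m i) \<le> b}"])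
    fix m and c :: 'k assume "m \<in> {m. bic_x (m i) \<le> b \<and> bic_y (m i) \<le> b}"
    then have m: "bic_x (m i) \<le> b" "bic_y (m i) \<le> b" by auto
    have mj: "(?y z + m + ?x) j = (if j = i then Bic 0 (nat (int b + z)) + m i + Bic b 0 else m j)" for z j by simp
    \<comment> \<open>The \<open>y\<close>-exponent of \<open>m i\<close> is at most
      \<open>b\<close>, so the product is \<open>y^(b+z) x^(b+d)\<close> with \<open>d\<close> the
      degree of \<open>m i\<close>; this is 1 exactly for \<open>z = d\<close>.\<close>
    have mi: "Bic 0 (nat (int b + z)) + m i + Bic b 0 = 0 \<longleftrightarrow> z = bic_deg (m i)" if "z \<in> {- int b..int b}" for z
      using m that by (cases "m i") (auto simp: plus_bic_def zero_bic_def bic_deg_def min_def)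
    have "(\<Sum>z\<in>{- int b..int b}. var_pow i z * corner (insert i N) (?Y z * single m c * ?X)) =
        (\<Sum>z\<in>{- int b..int b}. if z = bic_deg (m i) then corner N (single m c) else 0)"
    proof (rule sum.cong[OF refl])
      fix z assume z: "z \<in> {- int b..int b}"
      have "?Y z * single m c * ?X = single (?y z + m + ?x) c"
        by (simp add: mult_single)
      then have c1: "corner (insert i N) (?Y z * single m c * ?X) =
          (if \<forall>j\<in>insert i N. (?y z + m + ?x) j = 0 then single (\<lambda>j. bic_deg ((?y z + m + ?x) j)) c else 0)"
        by (simp only: corner_single)
      have c2: "(\<forall>j\<in>insert i N. (?y z + m + ?x) j = 0) \<longleftrightarrow> z = bic_deg (m i) \<and> (\<forall>j\<in>N. m j = 0)"
        unfolding mj using mi[OF z] i by auto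
      have c3: "var_pow i z * single (\<lambda>j. bic_deg ((?y z + m + ?x) j)) c = single (\<lambda>j. bic_deg (m j)) c"
        if "z = bic_deg (m i)"
      proof -
        have "(?y z + m + ?x) i = 0" unfolding mj using mi[OF z] that by simp
        then have "(\<lambda>j. if j = i then z else 0) + (\<lambda>j. bic_deg ((?y z + m + ?x) j)) = (\<lambda>j. bic_deg (m j))"
          using that unfolding mj by (auto simp: fun_eq_iff)
        then show ?thesis unfolding var_pow_def mult_single by simp
      qed
      show "var_pow i z * corner (insert i N) (?Y z * single m c * ?X) =
          (if z = bic_deg (m i) then corner N (single m c) else 0)"
        unfolding c1 c2 corner_single using c3 by simp
    qed
    moreover have "bic_deg (m i) \<in> {- int b..int b}" using m by (auto simp: bic_deg_def)
    ultimately show "corner N (single m c) =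
        (\<Sum>z\<in>{- int b..int b}. var_pow i z * corner (insert i N) (?Y z * single m c * ?X))"
      by simp
  qed (use b in \<open>auto simp: algebra_simps sum.distrib\<close>)
qed

text \<open>By \<open>corner_remove_variable\<close> a corner at \<open>N\<close> is a combination,
  with powers of \<open>x_i\<close> as coefficients, of corners at \<open>insert i N\<close> of
  elements of the same ideal, and these lie in \<open>q\<close>.\<close>

lemma corner_ideal_remove_variable:
  fixes q q' :: "'k::field laurent set"
  assumes N: "insert i N \<subseteq> I" "i \<notin> N" and q': "q' \<in> LSpec (I - N)" and qq: "q \<subseteq> q'"
  shows "corner_ideal I (insert i N) q \<subseteq> corner_ideal I N q'"
proof
  fix f assume f: "f \<in> corner_ideal I (insert i N) q"
  have "corner N (s * f * t) \<in> q'" if st: "s \<in> alg_on I" "t \<in> alg_on I" for s t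
  proof -
    let ?g = "s * f * t"
    have g: "?g \<in> corner_ideal I (insert i N) q" using f st by (intro corner_ideal_mult)
    define b where "b = (\<Sum>m\<in>keys ?g. bic_x (m i) + bic_y (m i))"
    have b: "bic_x (m i) \<le> b \<and> bic_y (m i) \<le> b" if "m \<in> keys ?g" for m
    proof -
      have "bic_x (m i) + bic_y (m i) \<le> b" unfolding b_def using that
        by (intro member_le_sum[of m _ "\<lambda>m. bic_x (m i) + bic_y (m i)"]) auto
      then show ?thesis by simp
    qed
    have i: "i \<in> I" using N by blast
    show ?thesis
    proof (subst corner_remove_variable[OF N(2), of ?g b])
      show "bic_x (m i) \<le> b \<and> bic_y (m i) \<le> b" if "m \<in> keys ?g" for m by (rule b[OF that])
    next
     show "(\<Sum>z = - int b..int b. var_pow i z * corner (insert i N) (y_pow i (nat (int b + z)) * ?g *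
         x_pow i b)) \<in> q'"
     proof (rule LSpecD(8)[OF q'])
      fix z
      have "y_pow i (nat (int b + z)) \<in> (alg_on I :: 'k jacobson set)"
        "x_pow i b \<in> (alg_on I :: 'k jacobson set)"
        using i by (auto intro!: single_in_alg_on simp: supp_on_def x_pow_def y_pow_def)
      then have "corner (insert i N) (y_pow i (nat (int b + z)) * ?g *
         x_pow i b) \<in> q'"
        using g qq unfolding corner_ideal_def by blast
      then show "var_pow i z * corner (insert i N) (y_pow i (nat (int b + z)) * ?g *
         x_pow i b) \<in> q'"
        using i N(2) by (intro LSpecD(4)[OF q'] var_pow_in_alg_on) auto
     qed
    qed
  qed
  then show "f \<in> corner_ideal I N q'" using f by (simp add: corner_ideal_def)
qed

section \<open>Classification of the primes\<close>

definition idem_support :: "nat set \<Rightarrow> 'k::field jacobson set \<Rightarrow> nat set" where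
  "idem_support I P = {i \<in> I. idem i \<notin> P}"

definition corner_prime :: "nat set \<Rightarrow> 'k::field jacobson set \<Rightarrow> 'k laurent set" where
  "corner_prime I P = corner (idem_support I P) `
     {a \<in> alg_on I. idems (idem_support I P) * a * idems (idem_support I P) \<in> P}"

context
  fixes I :: "nat set" and P :: "'k::field jacobson set"
  assumes fin: "finite I" and P: "P \<in> JSpec I"
begin

text \<open>The idempotents are joined one at a time by primeness. Split a monomial \<open>m\<close>
  into its part in the variable \<open>i\<close>, which commutes with \<open>idems A\<close>, and
  the rest, which commutes with \<open>idem i\<close>; so \<open>idem i * m * idems A\<close> lies
  in the ideal generated by \<open>idem i * idems A\<close>.\<close>

lemma idems_notin_prime:
  assumes "A \<subseteq> idem_support I P" shows "idems A \<notin> P"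
proof -
  have "finite A" by (rule finite_subset[OF _ fin]) (use assms in \<open>auto simp: idem_support_def\<close>)
  then show ?thesis using assms
  proof (induction A)
    case empty
    then show ?case using JSpecD(7)[OF P] by simp
  next
    case (insert i A)
    have i: "i \<in> I" "idem i \<notin> P" and AI: "A \<subseteq> I" using insert.prems by (auto simp: idem_support_def)
    have eA: "idems A \<in> alg_on A" "idems A \<in> alg_on I" using idems_in_alg_on insert.hyps(1) AI by blast+
    have ei: "idem i \<in> alg_on I" "idem i \<in> alg_on {i}" using idem_in_alg_on i by auto
    show ?case
    proof
      assume *: "idems (insert i A) \<in> P"
      have "idem i * s * idems A \<in> P" if s: "s \<in> alg_on I" for s
      proof -
        have mono: "idem i * single m c * idems A \<in> P" if m: "m \<in> supp_on I" for m c
        proof (cases "0 < bic_x (m i)")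
          case True
          then show ?thesis using idem_mult_single(1)[of m i c] JSpecD(2)[OF P] by simp
        next
          case False
          define mr where "mr = m(i := 0)"
          define mi where "mi = (\<lambda>j. if j = i then m i else 0)"
          have "m = mr + mi" by (auto simp: mr_def mi_def)
          then have split: "single m c = single mr c * single mi 1"
            by (simp add: mult_single)
          have mr: "single mr c \<in> alg_on (- {i})" "single mr c \<in> alg_on I"
            using m by (auto intro!: single_in_alg_on simp: supp_on_def mr_def)
          have mi: "single mi 1 \<in> (alg_on {i} :: 'k jacobson set)" "single mi 1 \<in> (alg_on I :: 'k jacobson set)"
            using m i by (auto intro!: single_in_alg_on simp: supp_on_def mi_def)
          have c1: "idem i * single mr c = single mr c * idem i"
            by (rule alg_on_disjoint_commute[OF ei(2) mr(1)]) simp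
          have c2: "single mi 1 * idems A = idems A * (single mi 1 :: 'k jacobson)"
            by (rule alg_on_disjoint_commute[OF mi(1) eA(1)]) (use insert.hyps in simp)
          have "idem i * single m c * idems A =
             (idem i * single mr c) * (single mi 1 * idems A)"
            unfolding split by (simp only: mult.assoc)
          also have "\<dots> = single mr c * (idem i * idems A) * single mi 1"
            unfolding c1 c2 by (simp only: mult.assoc)
          also have "\<dots> \<in> P"
            by (rule JSpecD(5)[OF P JSpecD(4)[OF P *[unfolded idems_insert(1)[OF insert.hyps]] mr(2)] mi(2)])
          finally show ?thesis .
        qed
        have "idem i * s * idems A = (\<Sum>m\<in>keys s. idem i * single m (lookup s m) * idems A)"
          by (subst (1) poly_mapping_sum_single[of s]) (simp add: sum_distrib_left sum_distrib_right)
        also have "\<dots> \<in> P" using s by (intro JSpecD(8)[OF P] mono) (auto simp: alg_on_def)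
        finally show ?thesis .
      qed
      then have "idem i \<in> P \<or> idems A \<in> P" by (intro JSpecD(9)[OF P ei(1) eA(2)])
      then show False using i insert.IH insert.prems by blast
    qed
  qed
qed

text \<open>For \<open>i\<close> outside the support \<open>1 - x_i y_i\<close> lies in
  \<open>P\<close>, so common powers can be cancelled inside \<open>x_i^a y_i^b\<close> until one
  exponent is 0.\<close>

lemma single_cong_normal_form:
  assumes "finite A" "A \<subseteq> I - idem_support I P" "m \<in> supp_on I"
  shows "single m 1 -
     single (\<lambda>j. if j \<in> A then Bic (nat (bic_deg (m j))) (nat (- bic_deg (m j))) else m j) 1 \<in> P"
  using assms
proof (induction A)
  case empty
  then show ?case using JSpecD(2)[OF P] by simp
next
  case (insert i A)
  let ?f = "\<lambda>A. (\<lambda>j. if j \<in> A then Bic (nat (bic_deg (m j))) (nat (- bic_deg (m j))) else m j)"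
  let ?s = "\<lambda>m. single m 1 :: 'k jacobson"
  have i: "i \<in> I" "idem i \<in> P" using insert.prems by (auto simp: idem_support_def)
  define u where "u = ?f A"
  have uI: "u \<in> supp_on I" using insert.prems by (auto simp: u_def supp_on_def)
  \<comment> \<open>Consecutive monomials differ by \<open>x_i^(a+k) (1 - x_i y_i) y_i^(b+k)\<close>
    times the part in the other variables.\<close>
  have step: "?s (u(i := Bic (a + k) (b + k))) - ?s (u(i := Bic a b)) \<in> P" for a b k
  proof (induction k)
    case 0
    then show ?case using JSpecD(2)[OF P] by simp
  next
    case (Suc k)
    let ?l = "u(i := Bic (a + k) 0)" and ?r = "(\<lambda>j. if j = i then Bic 0 (b + k) else 0)"
    have Bic_add: "Bic a b + Bic c d = Bic (a + c - min b c) (b + d - min b c)" for a b c d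
      by (simp add: plus_bic_def)
    have e1: "?l + ?r = u(i := Bic (a + k) (b + k))"
      by (auto simp: fun_eq_iff Bic_add)
    have e2: "?l + xy_mono {i} + ?r = u(i := Bic (a + Suc k) (b + Suc k))"
      by (auto simp: fun_eq_iff Bic_add xy_mono_def)
    have "?s ?l * idem i * ?s ?r = ?s (u(i := Bic (a + k) (b + k))) - ?s (u(i := Bic (a + Suc k) (b + Suc k)))"
      by (simp only: idem_def right_diff_distrib left_diff_distrib mult_single e1 e2 mult_1_right)
    moreover have "?s ?l * idem i * ?s ?r \<in> P"
      using uI i by (intro JSpecD(5)[OF P] JSpecD(4)[OF P] single_in_alg_on) (auto simp: supp_on_def)
    ultimately have d: "?s (u(i := Bic (a + k) (b + k))) - ?s (u(i := Bic (a + Suc k) (b + Suc k))) \<in> P" by simp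
    have eq: "?s (u(i := Bic (a + Suc k) (b + Suc k))) - ?s (u(i := Bic a b)) =
      (?s (u(i := Bic (a + k) (b + k))) - ?s (u(i := Bic a b))) -
      (?s (u(i := Bic (a + k) (b + k))) - ?s (u(i := Bic (a + Suc k) (b + Suc k))))" by (simp del: fun_upd_apply)
    show ?case unfolding eq by (rule JSpec_diff[OF P Suc d])
  qed
  have ui: "u i = m i" using insert.hyps by (simp add: u_def)
  define k where "k = min (bic_x (m i)) (bic_y (m i))"
  have "u = u(i := Bic (nat (bic_deg (m i)) + k) (nat (- bic_deg (m i)) + k))"
    using ui by (cases "m i") (auto simp: k_def bic_deg_def fun_eq_iff)
  moreover have "u(i := Bic (nat (bic_deg (m i))) (nat (- bic_deg (m i)))) = ?f (insert i A)"
    by (auto simp: u_def)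
  ultimately have "?s u - ?s (?f (insert i A)) \<in> P" using step[of "nat (bic_deg (m i))" k "nat (- bic_deg (m i))"] by metis
  moreover have "?s m - ?s u \<in> P" using insert by (simp add: u_def)
  ultimately have "(?s m - ?s u) + (?s u - ?s (?f (insert i A))) \<in> P" by (intro JSpecD(3)[OF P])
  then show ?case by simp
qed

abbreviation "NN \<equiv> idem_support I P"
abbreviation "ee \<equiv> (idems NN :: 'k jacobson)"

lemma NN_facts: "finite NN" "NN \<subseteq> I" "ee \<in> alg_on I" "ee \<notin> P" "ee \<in> alg_on NN"
proof -
  show NI: "NN \<subseteq> I" by (auto simp: idem_support_def)
  show fN: "finite NN" by (rule finite_subset[OF NI fin])
  show "ee \<in> alg_on I" "ee \<in> alg_on NN" by (rule idems_in_alg_on[OF fN]; use NI in simp)+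
  show "ee \<notin> P" by (rule idems_notin_prime) simp
qed

text \<open>Membership of \<open>e a e\<close> in \<open>P\<close> thus depends only on the corner
  of \<open>a\<close>. For monomials nontrivial somewhere in the support both terms vanish; the
  others commute with \<open>e\<close>, which leaves the congruence with the normal form.\<close>

lemma corner_congruence:
  assumes a: "a \<in> alg_on I"
  shows "ee * a * ee - ee * laurent_lift (corner NN a) \<in> P"
proof -
  have mono: "ee * single m c * ee - ee * laurent_lift (corner NN (single m c)) \<in> P"
    if m: "m \<in> supp_on I" for m c
  proof (cases "\<forall>i\<in>NN. m i = 0")
    case False
    then obtain i where i: "i \<in> NN" "m i \<noteq> 0" by blast
    define A where "A = NN - {i}"
    have A: "finite A" "i \<notin> A" "NN = insert i A" using i NN_facts(1) by (auto simp: A_def)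
    have "ee * single m c * ee = 0"
    proof (cases "0 < bic_x (m i)")
      case True
      then have "ee * single m c = 0"
        unfolding A(3) idems_insert(2)[OF A(1,2)] mult.assoc by (simp add: idem_mult_single(1))
      then show ?thesis by simp
    next
      case False
      then have "0 < bic_y (m i)" using i(2) by (cases "m i") (auto simp: zero_bic_def)
      then have "single m c * ee = 0"
        unfolding A(3) idems_insert(1)[OF A(1,2)] mult.assoc[symmetric] by (simp add: idem_mult_single(2))
      then show ?thesis by (simp add: mult.assoc)
    qed
    moreover have "corner NN (single m c) = 0" using False by (simp only: corner_single if_False)
    ultimately show ?thesis using JSpecD(2)[OF P] by simp
  next
    case True
    let ?n = "\<lambda>j. Bic (nat (bic_deg (m j))) (nat (- bic_deg (m j)))"
    have mN: "m \<in> supp_on (- NN)" using True by (auto simp: supp_on_def)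
    have "single m c * ee = ee * single m c"
      by (rule alg_on_disjoint_commute[OF single_in_alg_on[OF mN] NN_facts(5)]) simp
    then have "ee * single m c * ee = ee * single m c"
      using idems_idem[OF NN_facts(1), where 'k = 'k] by (simp add: mult.assoc) (simp add: mult.assoc[symmetric])
    moreover have "laurent_lift (corner NN (single m c)) = single ?n c"
      using True by (simp add: corner_single laurent_lift_def mult_single)
    moreover have "(\<lambda>j. if j \<in> I - NN then ?n j else m j) = ?n"
      using m True by (auto simp: fun_eq_iff supp_on_def zero_bic_def)
    then have d: "single m 1 - single ?n 1 \<in> P"
      using single_cong_normal_form[of "I - NN" m] fin m by simp
    moreover have "ee * single m c - ee * single ?n c =
       ee * single 0 c * (single m 1 - single ?n 1)"
      by (simp add: right_diff_distrib mult.assoc mult_single)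
    ultimately show ?thesis using JSpecD(4)[OF P d, of "ee * single 0 c"] NN_facts(3) by simp
  qed
  have "ee * a * ee - ee * laurent_lift (corner NN a) =
     (\<Sum>m\<in>keys a. ee * single m (lookup a m) * ee -
        ee * laurent_lift (corner NN (single m (lookup a m))))"
    (is "?F a = (\<Sum>m\<in>_. ?F (?s m))")
  proof -
    have "?F (sum ?s (keys a)) = (\<Sum>m\<in>keys a. ?F (?s m))"
      by (rule additive_sum) (simp add: algebra_simps)
    then show ?thesis unfolding poly_mapping_sum_single[symmetric] .
  qed
  also have "\<dots> \<in> P" using a by (intro JSpecD(8)[OF P] mono) (auto simp: alg_on_def)
  finally show ?thesis .
qed

text \<open>\<open>corner_prime\<close> is defined as an image; here the choice of the preimage is
  seen not to matter.\<close>

lemma corner_prime_mem_iff: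
  assumes a: "a \<in> alg_on I"
  shows "corner NN a \<in> corner_prime I P \<longleftrightarrow> ee * a * ee \<in> P"
proof
  assume "corner NN a \<in> corner_prime I P"
  then obtain b where b: "b \<in> alg_on I" "ee * b * ee \<in> P" "corner NN a = corner NN b"
    unfolding corner_prime_def by blast
  have "ee * (a - b) * ee \<in> P" using corner_congruence[of "a - b"] a b by simp
  then have "ee * (a - b) * ee + ee * b * ee \<in> P" using b(2) by (rule JSpecD(3)[OF P])
  then show "ee * a * ee \<in> P" by (simp add: algebra_simps)
next
  assume "ee * a * ee \<in> P"
  then show "corner NN a \<in> corner_prime I P" using a unfolding corner_prime_def by blast
qed

lemma corner_NN_lift:
  assumes "l \<in> alg_on (I - NN)"
  shows "corner NN (laurent_lift l) = l" "laurent_lift l \<in> alg_on I"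
  using corner_laurent_lift[of l NN] laurent_lift_in_alg_on[OF assms] assms
    alg_on_mono[of "I - NN" "- NN"] alg_on_mono[of "I - NN" I] by blast+

lemma corner_prime_in_LSpec: "corner_prime I P \<in> LSpec (I - NN)"
proof (rule LSpecI)
  let ?q = "corner_prime I P"
  note iff = corner_prime_mem_iff and lift = corner_NN_lift
  note cm = corner_idems_mult[OF NN_facts(1), symmetric]
  show sub: "?q \<subseteq> alg_on (I - NN)" unfolding corner_prime_def using corner_in_alg_on by blast
  show "0 \<in> ?q" using iff[of 0] JSpecD(2)[OF P] by simp
  show "a + b \<in> ?q" if ab: "a \<in> ?q" "b \<in> ?q" for a b
  proof -
    obtain c d where cd: "c \<in> alg_on I" "ee * c * ee \<in> P" "a = corner NN c" "d \<in> alg_on I" "ee * d * ee \<in> P" "b = corner NN d"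
      using ab unfolding corner_prime_def by blast
    then have "ee * (c + d) * ee \<in> P" using JSpecD(3)[OF P cd(2,5)] by (simp add: algebra_simps)
    then show ?thesis using iff[of "c + d"] cd by simp
  qed
  show "r * a \<in> ?q" if a: "a \<in> ?q" and r: "r \<in> alg_on (I - NN)" for a r
  proof -
    obtain c where c: "c \<in> alg_on I" "ee * c * ee \<in> P" "a = corner NN c"
      using a unfolding corner_prime_def by blast
    have "r * a = corner NN (laurent_lift r * ee * c)" by (simp only: c(3) cm[symmetric] lift(1)[OF r])
    moreover have "ee * (laurent_lift r * ee * c) * ee = (ee * laurent_lift r) * (ee * c * ee)"
      by (simp add: mult.assoc)
    moreover have "\<dots> \<in> P" using lift(2)[OF r] NN_facts(3) by (intro JSpecD(4)[OF P c(2)]) simp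
    ultimately show ?thesis using iff[of "laurent_lift r * ee * c"] lift(2)[OF r] NN_facts(3) c(1) by simp
  qed
  show "1 \<notin> ?q"
    using iff[of 1] idems_idem[OF NN_facts(1), where 'k = 'k] NN_facts(4) by simp
  fix a b :: "'k laurent" assume a: "a \<in> alg_on (I - NN)" "a \<notin> ?q" and b: "b \<in> alg_on (I - NN)" "b \<notin> ?q"
  let ?a = "laurent_lift a" and ?b = "laurent_lift b"
  have nP: "ee * ?a * ee \<notin> P" "ee * ?b * ee \<notin> P"
    using iff[OF lift(2)[OF a(1)]] iff[OF lift(2)[OF b(1)]] lift(1)[OF a(1)] lift(1)[OF b(1)] a(2) b(2) by simp_all
  have mem: "ee * ?a * ee \<in> alg_on I" "ee * ?b * ee \<in> alg_on I"
    using NN_facts(3) lift(2)[OF a(1)] lift(2)[OF b(1)] by simp_all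
  obtain s where s: "s \<in> alg_on I" "(ee * ?a * ee) * s * (ee * ?b * ee) \<notin> P"
    using JSpecD(9)[OF P mem] nP by blast
  \<comment> \<open>Chosen so that \<open>e x e\<close> is the product of \<open>e ?a e\<close>,
    \<open>s\<close> and \<open>e ?b e\<close>, which lies outside \<open>P\<close>, while the
    corner of \<open>x\<close> is a multiple of \<open>a * b\<close>.\<close>
  define x where "x = ?a * ee * (s * ee * ?b)"
  have x: "x \<in> alg_on I" using NN_facts(3) lift(2)[OF a(1)] lift(2)[OF b(1)] s(1) by (simp add: x_def)
  have "ee * x * ee \<notin> P" using s(2) by (simp add: x_def mult.assoc)
  then have "corner NN x \<notin> ?q" using iff[OF x] by simp
  moreover have "corner NN x = corner NN s * (a * b)"
    unfolding x_def cm[symmetric] by (simp add: cm[symmetric] lift(1)[OF a(1)] lift(1)[OF b(1)] mult_ac)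
  ultimately show "a * b \<notin> ?q"
    using \<open>\<And>r a. a \<in> ?q \<Longrightarrow> r \<in> alg_on (I - NN) \<Longrightarrow> r * a \<in> ?q\<close> corner_in_alg_on[OF s(1), of NN] by metis
qed

text \<open>For the reverse inclusion primeness is used twice with \<open>e\<close> outside
  \<open>P\<close>: from \<open>e s (f t e)\<close> in \<open>P\<close> for all \<open>s\<close> one
  gets \<open>f t e\<close> in \<open>P\<close>, and from this for all \<open>t\<close> one gets
  \<open>f\<close> in \<open>P\<close>.\<close>

theorem prime_eq_corner_ideal: "P = corner_ideal I NN (corner_prime I P)"
proof
  show "P \<subseteq> corner_ideal I NN (corner_prime I P)"
  proof
    fix f assume f: "f \<in> P"
    then have fI: "f \<in> alg_on I" using JSpecD(1)[OF P] by blast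
    have "corner NN (s * f * t) \<in> corner_prime I P" if "s \<in> alg_on I" "t \<in> alg_on I" for s t
    proof -
      have "ee * (s * f * t) * ee \<in> P"
        using that NN_facts(3) f by (intro JSpecD(5)[OF P] JSpecD(4)[OF P])
      then show ?thesis using corner_prime_mem_iff[of "s * f * t"] that fI by simp
    qed
    then show "f \<in> corner_ideal I NN (corner_prime I P)" using fI by (simp add: corner_ideal_def)
  qed
  show "corner_ideal I NN (corner_prime I P) \<subseteq> P"
  proof
    fix f assume f: "f \<in> corner_ideal I NN (corner_prime I P)"
    then have fI: "f \<in> alg_on I" by (simp add: corner_ideal_def)
    have st: "ee * s * (f * t * ee) \<in> P" if "s \<in> alg_on I" "t \<in> alg_on I" for s t
    proof -
      have "ee * (s * f * t) * ee \<in> P"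
        using f that fI corner_prime_mem_iff[of "s * f * t"] by (simp add: corner_ideal_def)
      then show ?thesis by (simp add: mult.assoc)
    qed
    have "f * t * ee \<in> P" if t: "t \<in> alg_on I" for t
      using JSpecD(9)[OF P NN_facts(3), of "f * t * ee"] st[OF _ t] t fI NN_facts(3,4) by simp
    then show "f \<in> P" using JSpecD(9)[OF P fI NN_facts(3)] NN_facts(4) by blast
  qed
qed

end

lemma corner_ideal_inverse:
  fixes q :: "'k::field laurent set"
  assumes fin: "finite I" and N: "N \<subseteq> I" and q: "q \<in> LSpec (I - N)"
  shows "idem_support I (corner_ideal I N q) = N" "corner_prime I (corner_ideal I N q) = q"
proof -
  let ?P = "corner_ideal I N q"
  have P: "?P \<in> JSpec I" by (rule corner_ideal_in_JSpec[OF fin N q])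
  show NN: "idem_support I ?P = N"
    using idem_in_corner_ideal[OF N q] N by (auto simp: idem_support_def)
  have q': "corner_prime I ?P \<in> LSpec (I - N)" using corner_prime_in_LSpec[OF fin P] NN by simp
  have eq: "corner_ideal I N q = corner_ideal I N (corner_prime I ?P)"
    using prime_eq_corner_ideal[OF fin P] NN by simp
  show "corner_prime I ?P = q"
    using corner_ideal_subsetD(2)[OF N N q q'] corner_ideal_subsetD(2)[OF N N q' q] eq by auto
qed

section \<open>The rank of a prime of a Jacobson algebra\<close>

text \<open>Truncated subtraction is harmless for a prime: the independence number is at most the
  number of variables outside the support.\<close>

definition jacobson_rank :: "nat set \<Rightarrow> 'k::field jacobson set \<Rightarrow> nat" where
  "jacobson_rank I P = 2 * card (I - idem_support I P) - indep_card (I - idem_support I P) (corner_prime I P)"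

lemma jacobson_rank_corner_ideal:
  fixes q :: "'k::field laurent set"
  assumes "finite I" "N \<subseteq> I" "q \<in> LSpec (I - N)"
  shows "jacobson_rank I (corner_ideal I N q) = 2 * card (I - N) - indep_card (I - N) q"
  by (simp add: jacobson_rank_def corner_ideal_inverse[OF assms])

lemma JSpec_cases:
  fixes P :: "'k::field jacobson set"
  assumes "finite I" "P \<in> JSpec I"
  obtains N q where "N \<subseteq> I" "q \<in> LSpec (I - N)" "P = corner_ideal I N q"
    "jacobson_rank I P = 2 * card (I - N) - indep_card (I - N) q"
proof (rule that)
  show "idem_support I P \<subseteq> I" by (auto simp: idem_support_def)
  show "corner_prime I P \<in> LSpec (I - idem_support I P)" by (rule corner_prime_in_LSpec[OF assms])
  show "P = corner_ideal I (idem_support I P) (corner_prime I P)" by (rule prime_eq_corner_ideal[OF assms])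
  show "jacobson_rank I P = 2 * card (I - idem_support I P) - indep_card (I - idem_support I P) (corner_prime I P)"
    by (rule jacobson_rank_def)
qed

text \<open>If \<open>d\<close> variables leave \<open>N\<close>, the first term grows by
  \<open>2 d\<close> but the independence number by at most \<open>d\<close>: restricting an
  independent set for the larger prime to the old variables removes at most \<open>d\<close>
  elements. For equal \<open>N\<close> the Laurent case applies.\<close>

lemma jacobson_rank_strict:
  fixes P Q :: "'k::field jacobson set"
  assumes fin: "finite I" and P: "P \<in> JSpec I" and Q: "Q \<in> JSpec I" and PQ: "P \<subset> Q"
  shows "jacobson_rank I P < jacobson_rank I Q"
proof -
  obtain N1 q1 where 1: "N1 \<subseteq> I" "q1 \<in> LSpec (I - N1)" "P = corner_ideal I N1 q1"
    "jacobson_rank I P = 2 * card (I - N1) - indep_card (I - N1) q1"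
    by (rule JSpec_cases[OF fin P])
  obtain N2 q2 where 2: "N2 \<subseteq> I" "q2 \<in> LSpec (I - N2)" "Q = corner_ideal I N2 q2"
    "jacobson_rank I Q = 2 * card (I - N2) - indep_card (I - N2) q2"
    by (rule JSpec_cases[OF fin Q])
  have sub: "N2 \<subseteq> N1" "q1 \<subseteq> q2"
    using corner_ideal_subsetD[OF 1(1) 2(1) 1(2) 2(2)] PQ 1(3) 2(3) by blast+
  have fin1: "finite (I - N1)" and fin2: "finite (I - N2)" using fin by auto
  obtain J where J: "J \<subseteq> I - N2" "alg_indep q2 J" "card J = indep_card (I - N2) q2"
    using indep_card_witness[OF fin2 2(2)] by blast
  have le1: "indep_card (I - N1) q1 \<le> card (I - N1)" by (rule indep_card_le[OF fin1 1(2)])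
  have le2: "indep_card (I - N2) q2 \<le> card (I - N2)" by (rule indep_card_le[OF fin2 2(2)])
  show ?thesis
  proof (cases "N1 = N2")
    case True
    then have "q1 \<subset> q2" using sub(2) PQ 1(3) 2(3) by blast
    then have "card J < indep_card (I - N1) q1"
      using indep_card_strict[OF fin1 1(2), of q2 J] 2(2) J(1,2) True by simp
    then show ?thesis using 1(4) 2(4) J(3) le1 True by simp
  next
    case False
    have "q1 \<inter> alg_on (J \<inter> (I - N1)) \<subseteq> {0}"
      using sub(2) J(2) alg_on_mono[of "J \<inter> (I - N1)" J] by blast
    then have "card (J \<inter> (I - N1)) \<le> indep_card (I - N1) q1"
      by (intro indep_card_ge[OF fin1 1(2)]) auto
    moreover have "card J \<le> card (J \<inter> (I - N1)) + card (N1 - N2)"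
    proof -
      have "J \<subseteq> (J \<inter> (I - N1)) \<union> (N1 - N2)" using J(1) by blast
      moreover have f: "finite (J \<inter> (I - N1))" "finite (N1 - N2)" using fin fin1 1(1) by (auto intro: finite_subset)
      ultimately have "card J \<le> card ((J \<inter> (I - N1)) \<union> (N1 - N2))" by (intro card_mono) auto
      also have "\<dots> \<le> card (J \<inter> (I - N1)) + card (N1 - N2)" by (rule card_Un_le)
      finally show ?thesis .
    qed
    moreover have "card (I - N2) = card (I - N1) + card (N1 - N2)"
    proof -
      have "I - N2 = (I - N1) \<union> (N1 - N2)" using sub(1) 1(1) by blast
      moreover have "(I - N1) \<inter> (N1 - N2) = {}" by blast
      ultimately show ?thesis using fin1 finite_subset[OF 1(1) fin] by (simp add: card_Un_disjoint)
    qed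
    moreover have "0 < card (N1 - N2)"
      using False sub(1) finite_subset[OF 1(1) fin] by (simp add: card_gt_0_iff)
    ultimately show ?thesis using 1(4) 2(4) J(3) le1 le2 by linarith
  qed
qed

lemma ranked_JSpec:
  assumes fin: "finite I"
  shows "ranked_Spec (alg_rec I) (2 * card I) (jacobson_rank I :: 'k::field jacobson set \<Rightarrow> nat)"
  unfolding ranked_Spec_def
proof (intro ballI conjI impI)
  fix P :: "'k jacobson set" assume P: "P \<in> JSpec I"
  show "jacobson_rank I P < jacobson_rank I Q" if "Q \<in> JSpec I" "P \<subset> Q" for Q
    by (rule jacobson_rank_strict[OF fin P that])
  obtain N q where N: "N \<subseteq> I" and q: "q \<in> LSpec (I - N)" and Pq: "P = corner_ideal I N q"
    and rk: "jacobson_rank I P = 2 * card (I - N) - indep_card (I - N) q"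
    by (rule JSpec_cases[OF fin P])
  have finN: "finite (I - N)" using fin by simp
  have le: "indep_card (I - N) q \<le> card (I - N)" by (rule indep_card_le[OF finN q])
  have cI: "card (I - N) \<le> card I" using fin by (intro card_mono) auto
  show "jacobson_rank I P \<le> 2 * card I" using rk cI by simp
  show "\<exists>Q\<in>JSpec I. Q \<subset> P \<and> jacobson_rank I P \<le> Suc (jacobson_rank I Q)" if pos: "0 < jacobson_rank I P"
  proof (cases "indep_card (I - N) q < card (I - N)")
    case True
    obtain q' where q': "q' \<in> LSpec (I - N)" "q' \<subset> q" "indep_card (I - N) q' \<le> Suc (indep_card (I - N) q)"
      using indep_card_down[OF finN q True] by blast
    have "corner_ideal I N q' \<subseteq> P" using corner_ideal_mono[of q' q I N] q'(2) Pq by blast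
    moreover have "corner_ideal I N q' \<noteq> P"
      using corner_ideal_subsetD(2)[OF N N q q'(1)] q'(2) Pq by blast
    moreover have "corner_ideal I N q' \<in> JSpec I" by (rule corner_ideal_in_JSpec[OF fin N q'(1)])
    moreover have "jacobson_rank I P \<le> Suc (jacobson_rank I (corner_ideal I N q'))"
      using rk jacobson_rank_corner_ideal[OF fin N q'(1)] q'(3) by simp
    ultimately show ?thesis by blast
  next
    case False
    \<comment> \<open>Now \<open>q\<close> is zero and cannot be lowered. The prime below uses the
      zero ideal and one more variable in \<open>N\<close>, which takes the rank from
      \<open>card (I - N)\<close> to one less.\<close>
    then have ic: "indep_card (I - N) q = card (I - N)" using le by simp
    then have "0 < card (I - N)" using pos rk by simp
    then have "I - N \<noteq> {}" by (metis card.empty less_irrefl)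
    then obtain i where i: "i \<in> I" "i \<notin> N" by blast
    have N': "insert i N \<subseteq> I" using i N by blast
    have fin': "finite (I - insert i N)" using fin by simp
    have z: "{0} \<in> (LSpec (I - insert i N) :: 'k laurent set set)" by (rule zero_LSpec[OF fin'])
    let ?Q = "corner_ideal I (insert i N) {0 :: 'k laurent}"
    have Q: "?Q \<in> JSpec I" by (rule corner_ideal_in_JSpec[OF fin N' z])
    have "?Q \<subseteq> P" unfolding Pq using corner_ideal_remove_variable[OF N' i(2) q, of "{0}"] LSpecD(2)[OF q] by blast
    moreover have "?Q \<noteq> P"
      using corner_ideal_subsetD(1)[OF N N' q z] Pq i(2) by blast
    moreover have "jacobson_rank I P \<le> Suc (jacobson_rank I ?Q)"
    proof -
      have "I - N = insert i (I - insert i N)" using i by blast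
      then have "card (I - N) = Suc (card (I - insert i N))" using fin' by (metis card_insert_disjoint Diff_iff insertI1)
      then show ?thesis
        using rk ic jacobson_rank_corner_ideal[OF fin N' z] indep_card_le[OF fin' z] by simp
    qed
    ultimately show ?thesis using Q by blast
  qed
  show "\<exists>Q\<in>JSpec I. P \<subset> Q \<and> jacobson_rank I Q \<le> Suc (jacobson_rank I P)" if lt: "jacobson_rank I P < 2 * card I"
  proof (cases "0 < indep_card (I - N) q")
    case True
    obtain q' where q': "q' \<in> LSpec (I - N)" "q \<subset> q'" "indep_card (I - N) q \<le> Suc (indep_card (I - N) q')"
      using indep_card_up[OF finN q True] by blast
    have "P \<subseteq> corner_ideal I N q'" using corner_ideal_mono[of q q' I N] q'(2) Pq by blast
    moreover have "corner_ideal I N q' \<noteq> P"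
      using corner_ideal_subsetD(2)[OF N N q'(1) q] q'(2) Pq by blast
    moreover have "corner_ideal I N q' \<in> JSpec I" by (rule corner_ideal_in_JSpec[OF fin N q'(1)])
    moreover have "jacobson_rank I (corner_ideal I N q') \<le> Suc (jacobson_rank I P)"
      using rk le jacobson_rank_corner_ideal[OF fin N q'(1)] q'(3) by simp
    ultimately show ?thesis by blast
  next
    case False
    \<comment> \<open>Now \<open>q\<close> is maximal. A variable leaves \<open>N\<close>; extending
      \<open>q\<close> to it makes that variable independent, so the rank grows by only one.\<close>
    then have ic: "indep_card (I - N) q = 0" by simp
    then have "N \<noteq> {}" using lt rk by auto
    then obtain i where i: "i \<in> N" by blast
    define M where "M = N - {i}"
    have M: "M \<subseteq> I" "i \<notin> M" "N = insert i M" using i N by (auto simp: M_def)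
    have IM: "I - M = insert i (I - N)" using i N by (auto simp: M_def)
    define q' where "q' = var_extend (I - N) i q"
    have q': "q' \<in> LSpec (I - M)" unfolding q'_def IM by (rule LSpec_var_extend[OF q]) (use i in simp)
    have qq: "q \<subseteq> q'"
    proof
      fix f assume f: "f \<in> q"
      then have fN: "f \<in> alg_on (I - N)" using LSpecD(1)[OF q] by blast
      then have "f \<in> alg_on (- {i})" "f \<in> alg_on (insert i (I - N))"
        using alg_on_mono[of "I - N" "- {i}"] alg_on_mono[of "I - N" "insert i (I - N)"] i by blast+
      then show "f \<in> q'" using f LSpecD(2)[OF q] by (simp add: q'_def var_extend_def var_coeff_const)
    qed
    let ?Q = "corner_ideal I M q'"
    have Q: "?Q \<in> JSpec I" by (rule corner_ideal_in_JSpec[OF fin M(1) q'])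
    have "P \<subseteq> ?Q" unfolding Pq M(3) by (rule corner_ideal_remove_variable[OF _ M(2) q' qq]) (use M N in auto)
    moreover have "P \<noteq> ?Q"
      using corner_ideal_subsetD(1)[OF M(1) N q' q] Pq i M(2) by blast
    moreover have "jacobson_rank I ?Q \<le> Suc (jacobson_rank I P)"
    proof -
      have finM: "finite (I - M)" using fin by simp
      have "alg_indep q' {i}"
      proof
        fix f assume f: "f \<in> q' \<inter> alg_on {i}"
        have "var_coeff i k f = 0" for k
        proof -
          have "var_coeff i k f \<in> alg_on ({i} - {i})" using f by (intro var_coeff_in_alg_on) auto
          moreover have "var_coeff i k f \<in> q" using f by (auto simp: q'_def var_extend_def)
          ultimately show ?thesis using indep_empty[OF finN q] by auto
        qed
        then show "f \<in> {0}" using var_coeff_all_zero by blast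
      qed
      then have "card {i} \<le> indep_card (I - M) q'" using IM by (intro indep_card_ge[OF finM q']) auto
      moreover have "card (I - M) = Suc (card (I - N))" unfolding IM using finN i by simp
      ultimately show ?thesis using rk ic jacobson_rank_corner_ideal[OF fin M(1) q'] by simp
    qed
    ultimately show ?thesis using Q by blast
  qed
qed

section \<open>Passage to the function-space models and conclusion\<close>

section \<open>Transfer to the concrete algebras\<close>

type_synonym 'k bic_ring = "((nat \<Rightarrow> nat \<times> nat) \<Rightarrow> 'k) ring"

text \<open>The renaming \<open>enc\<close> of monomials lets one lemma serve both convolution
  algebras; for Laurent polynomials it is the identity.\<close>

lemma lookup_mult_conv:
  fixes f g :: "'m::monoid_add \<Rightarrow>\<^sub>0 'k::field" and enc :: "'n \<Rightarrow> 'm"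
  assumes enc: "bij enc" and mul: "\<And>u v. enc (mul u v) = enc u + enc v"
  shows "(\<lambda>m. lookup (f * g) (enc m)) =
     conv mul (\<lambda>m. lookup f (enc m)) (\<lambda>m. lookup g (enc m))"
proof
  fix m
  let ?f = "\<lambda>m. lookup f (enc m)" and ?g = "\<lambda>m. lookup g (enc m)"
  let ?S = "\<lambda>u. single u (lookup f u)" and ?T = "\<lambda>u. single u (lookup g u)"
  let ?A = "{u. ?f u \<noteq> 0}" and ?B = "{v. ?g v \<noteq> 0}"
  have inj: "inj enc" using enc by (rule bij_is_inj)
  have img: "enc ` ?A = keys f" "enc ` ?B = keys g"
    using enc by (auto simp: in_keys_iff bij_def image_iff) (metis surjD)+
  have fin: "finite ?A" "finite ?B"
    using finite_imageD[of enc ?A] finite_imageD[of enc ?B] img inj_on_subset[OF inj] by auto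
  have f: "f = (\<Sum>u\<in>?A. ?S (enc u))" and g: "g = (\<Sum>v\<in>?B. ?T (enc v))"
    using poly_mapping_sum_single[of f] poly_mapping_sum_single[of g] img[symmetric]
    by (simp_all add: sum.reindex inj_on_subset[OF inj])
  have "f * g = (\<Sum>u\<in>?A. \<Sum>v\<in>?B. single (enc (mul u v)) (?f u * ?g v))"
    by (subst (1) f, subst (1) g) (simp add: sum_product mult_single mul)
  then have "lookup (f * g) (enc m) = (\<Sum>u\<in>?A. \<Sum>v\<in>?B. if mul u v = m then ?f u * ?g v else 0)"
    using inj by (simp add: lookup_sum lookup_single when_def inj_eq)
  also have "\<dots> = (\<Sum>(u, v)\<in>?A \<times> ?B. if mul u v = m then ?f u * ?g v else 0)"
    by (rule sum.cartesian_product)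
  also have "\<dots> = (\<Sum>(u, v)\<in>{(u, v). ?f u \<noteq> 0 \<and> ?g v \<noteq> 0 \<and> mul u v = m}. ?f u * ?g v)"
    by (rule sum.mono_neutral_cong_right) (use fin in \<open>auto split: if_splits\<close>)
  finally show "lookup (f * g) (enc m) = conv mul ?f ?g m" by (simp add: conv_def)
qed

definition enc_mono :: "(nat \<Rightarrow> nat \<times> nat) \<Rightarrow> nat \<Rightarrow> bic" where
  "enc_mono m = (\<lambda>i. Bic (fst (m i)) (snd (m i)))"

definition dec_mono :: "(nat \<Rightarrow> bic) \<Rightarrow> nat \<Rightarrow> nat \<times> nat" where
  "dec_mono m = (\<lambda>i. (bic_x (m i), bic_y (m i)))"

lemma enc_dec_mono [simp]: "enc_mono (dec_mono m) = m" "dec_mono (enc_mono u) = u"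
  by (simp_all add: enc_mono_def dec_mono_def)

lemma bij_enc_mono: "bij enc_mono"
  by (rule bij_betw_byWitness[of _ dec_mono]) auto

lemma enc_mono_simps:
  "enc_mono (mono_mul u v) = enc_mono u + enc_mono v"
  "enc_mono m i = 0 \<longleftrightarrow> m i = (0, 0)" "enc_mono m = 0 \<longleftrightarrow> m = (\<lambda>i. (0, 0))"
  by (auto simp: enc_mono_def mono_mul_def bic_mul_def plus_bic_def zero_bic_def fun_eq_iff prod_eq_iff)

definition bic_iso :: "'k::field jacobson \<Rightarrow> (nat \<Rightarrow> nat \<times> nat) \<Rightarrow> 'k" where
  "bic_iso f = (\<lambda>m. lookup f (enc_mono m))"

text \<open>The target is at first a bare record. Its ring axioms are inherited along the bijection,
  so associativity and distributivity of \<open>conv\<close> are never verified directly.\<close>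

lemma ring_hom_ring_of_bij:
  assumes R: "ring R" and bij: "bij_betw h (carrier R) (carrier T)"
    and hom: "\<And>a b. a \<in> carrier R \<Longrightarrow> b \<in> carrier R \<Longrightarrow> h (a \<otimes>\<^bsub>R\<^esub> b) = h a \<otimes>\<^bsub>T\<^esub> h b"
      "\<And>a b. a \<in> carrier R \<Longrightarrow> b \<in> carrier R \<Longrightarrow> h (a \<oplus>\<^bsub>R\<^esub> b) = h a \<oplus>\<^bsub>T\<^esub> h b"
      "h \<one>\<^bsub>R\<^esub> = \<one>\<^bsub>T\<^esub>" "h \<zero>\<^bsub>R\<^esub> = \<zero>\<^bsub>T\<^esub>"
  shows "ring_hom_ring R (T :: 'b ring) h"
proof -
  have "h a \<in> carrier T" if "a \<in> carrier R" for a using that bij by (auto simp: bij_betw_def)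
  then have "h \<in> Ring.ring_hom R T" using hom by (intro ring_hom_memI)
  moreover then have "h \<in> ring_iso R T" using bij by (simp add: ring_iso_def)
  then have "ring (T \<lparr>zero := h \<zero>\<^bsub>R\<^esub>\<rparr>)" by (rule ring.ring_iso_imp_img_ring[OF R])
  then have "ring T" by (simp add: hom(4))
  ultimately show ?thesis using R by (intro ring_hom_ringI2)
qed

lemma bij_bic_iso: "bij_betw bic_iso (alg_on I) (carrier (bic_alg I :: 'k::field bic_ring))"
proof (rule bij_betw_byWitness[of _ "\<lambda>f. Abs_poly_mapping (\<lambda>m. f (dec_mono m))"])
  have supp_eq: "{m. lookup f (enc_mono m) \<noteq> 0} = dec_mono ` keys f" for f :: "'k jacobson"
  proof safe
    fix m assume "lookup f (enc_mono m) \<noteq> 0"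
    then have "enc_mono m \<in> keys f" by (simp add: in_keys_iff)
    then show "m \<in> dec_mono ` keys f" by (metis enc_dec_mono(2) imageI)
  qed (auto simp: in_keys_iff)
  show "\<forall>f\<in>alg_on I. Abs_poly_mapping (\<lambda>m. bic_iso f (dec_mono m)) = (f :: 'k jacobson)"
    by (simp add: bic_iso_def Poly_Mapping.lookup_inverse)
  have fin: "finite {m. f (dec_mono m) \<noteq> 0}" if "finite {m. f m \<noteq> 0}" for f :: "(nat \<Rightarrow> nat \<times> nat) \<Rightarrow> 'k"
  proof -
    have "{m. f (dec_mono m) \<noteq> 0} = enc_mono ` {m. f m \<noteq> 0}" by (auto simp: image_iff) (metis enc_dec_mono(1))
    then show ?thesis using that by simp
  qed
  show "\<forall>f\<in>carrier (bic_alg I). bic_iso (Abs_poly_mapping (\<lambda>m. f (dec_mono m))) = (f :: _ \<Rightarrow> 'k)"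
    using fin by (auto simp: bic_iso_def bic_alg_def lookup_Abs_poly_mapping)
  show "bic_iso ` alg_on I \<subseteq> carrier (bic_alg I :: 'k bic_ring)"
  proof safe
    fix f :: "'k jacobson" assume f: "f \<in> alg_on I"
    have "m i = (0, 0)" if "lookup f (enc_mono m) \<noteq> 0" "i \<notin> I" for m i
    proof -
      have "enc_mono m \<in> supp_on I" using f that(1) by (auto simp: alg_on_def in_keys_iff)
      then show ?thesis using that(2) enc_mono_simps(2)[of m i] by (auto simp: supp_on_def)
    qed
    then show "bic_iso f \<in> carrier (bic_alg I)" by (simp add: bic_iso_def bic_alg_def supp_eq)
  qed
  show "(\<lambda>f. Abs_poly_mapping (\<lambda>m. f (dec_mono m))) ` carrier (bic_alg I) \<subseteq> (alg_on I :: 'k jacobson set)"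
  proof safe
    fix f :: "(nat \<Rightarrow> nat \<times> nat) \<Rightarrow> 'k" assume f: "f \<in> carrier (bic_alg I)"
    then have finf: "finite {m. f m \<noteq> 0}" and supp: "\<And>m i. f m \<noteq> 0 \<Longrightarrow> i \<notin> I \<Longrightarrow> m i = (0, 0)"
      by (auto simp: bic_alg_def)
    have "m \<in> supp_on I" if "f (dec_mono m) \<noteq> 0" for m
      using supp[OF that] enc_mono_simps(2)[of "dec_mono m"] by (auto simp: supp_on_def)
    then show "Abs_poly_mapping (\<lambda>m. f (dec_mono m)) \<in> alg_on I"
      using fin[OF finf] by (auto simp: alg_on_def in_keys_iff)
  qed
qed

lemma bic_iso_hom:
  "ring_hom_ring (alg_rec I) (bic_alg I :: 'k::field bic_ring) bic_iso"
proof (rule ring_hom_ring_of_bij)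
  show "bic_iso (a \<otimes>\<^bsub>alg_rec I\<^esub> b) = bic_iso a \<otimes>\<^bsub>bic_alg I\<^esub> (bic_iso b :: _ \<Rightarrow> 'k)" for a b
    using lookup_mult_conv[of enc_mono mono_mul, OF bij_enc_mono enc_mono_simps(1)] by (simp add: bic_iso_def bic_alg_def)
qed (use bij_bic_iso in \<open>auto simp: ring_subring_rec unital_subring_alg_on bic_iso_def bic_alg_def lookup_add
      lookup_one when_def enc_mono_simps(3)\<close>)

lemma bij_lookup: "bij_betw lookup (alg_on I) (carrier (laurent_alg I :: ((nat \<Rightarrow> int) \<Rightarrow> 'k::field) ring))"
proof (rule bij_betw_byWitness[of _ Abs_poly_mapping])
  show "lookup ` alg_on I \<subseteq> carrier (laurent_alg I :: ((nat \<Rightarrow> int) \<Rightarrow> 'k) ring)"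
    by (auto simp: laurent_alg_def alg_on_def supp_on_def subset_iff in_keys_iff)
  show "Abs_poly_mapping ` carrier (laurent_alg I) \<subseteq> (alg_on I :: 'k laurent set)"
    by (auto simp: laurent_alg_def alg_on_def supp_on_def in_keys_iff)
qed (auto simp: Poly_Mapping.lookup_inverse laurent_alg_def)

lemma lookup_hom:
  "ring_hom_ring (alg_rec I) (laurent_alg I :: ((nat \<Rightarrow> int) \<Rightarrow> 'k::field) ring) lookup"
proof (rule ring_hom_ring_of_bij)
  have "bij (\<lambda>e. e :: nat \<Rightarrow> int)" using bij_id by (simp add: id_def)
  from lookup_mult_conv[OF this, of "\<lambda>u v i. u i + v i"]
  show "lookup (a \<otimes>\<^bsub>alg_rec I\<^esub> b) = lookup a \<otimes>\<^bsub>laurent_alg I\<^esub> (lookup b :: _ \<Rightarrow> 'k)" for a b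
    by (simp add: laurent_alg_def plus_fun_def)
qed (use bij_lookup in \<open>auto simp: ring_subring_rec unital_subring_alg_on laurent_alg_def lookup_add
      lookup_one when_def fun_eq_iff\<close>)

lemma pi_map_bic_iso:
  assumes b: "b \<in> alg_on (- N)"
  shows "pi_map (bic_iso b) = lookup (corner N b :: 'k::field laurent)"
proof
  fix e :: "nat \<Rightarrow> int"
  let ?d = "\<lambda>m. (\<lambda>i. bic_deg (m i))"
  have deg: "(\<lambda>i. int (fst (m i)) - int (snd (m i))) = ?d (enc_mono m)" for m by (simp add: enc_mono_def)
  have "pi_map (bic_iso b) e = (\<Sum>m\<in>{m. lookup b (enc_mono m) \<noteq> 0 \<and> ?d (enc_mono m) = e}. lookup b (enc_mono m))"
    unfolding pi_map_def bic_iso_def deg ..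
  also have "\<dots> = (\<Sum>m\<in>{m \<in> keys b. ?d m = e}. lookup b m)"
    by (rule sum.reindex_bij_witness[of _ dec_mono enc_mono]) (auto simp: in_keys_iff)
  also have "\<dots> = (\<Sum>m\<in>keys b. if ?d m = e then lookup b m else 0)"
    by (rule sum.inter_filter) simp
  also have "\<dots> = (\<Sum>m\<in>keys b. lookup (corner N (single m (lookup b m))) e)"
  proof (rule sum.cong[OF refl])
    fix m assume "m \<in> keys b"
    then have "\<forall>i\<in>N. m i = 0" using b by (auto simp: alg_on_def supp_on_def)
    then show "(if ?d m = e then lookup b m else 0) =
       lookup (corner N (single m (lookup b m))) e"
      by (simp add: corner_single lookup_single when_def)
  qed
  also have "\<dots> = lookup (corner N (\<Sum>m\<in>keys b. single m (lookup b m))) e"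
    by (simp add: additive_sum[of "corner N"] lookup_sum)
  finally show "pi_map (bic_iso b) e = lookup (corner N b) e"
    unfolding poly_mapping_sum_single[symmetric] .
qed

text \<open>Only one inclusion is computed: each summand \<open>a b\<close> lies in the corner ideal
  because \<open>b\<close> does. For equality the classification gives \<open>N1\<close> and
  \<open>q1\<close> for the given prime; its elements \<open>1 - x_i y_i\<close> with
  \<open>i\<close> outside \<open>N\<close> force \<open>N1 = N\<close>, and the lifts of
  \<open>q'\<close> force \<open>q1 = q'\<close>.\<close>

lemma tensor_ideal_eq_corner_ideal:
  fixes q :: "((nat \<Rightarrow> int) \<Rightarrow> 'k::field) set"
  assumes N: "N \<subseteq> {..<n}" and q: "q \<in> Spec (laurent_alg ({..<n} - N))"
    and p: "tensor_ideal n N q \<in> Spec (S n)"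
  defines "q' \<equiv> {l \<in> alg_on ({..<n} - N). lookup l \<in> q}"
  shows "{f \<in> alg_on {..<n}. bic_iso f \<in> tensor_ideal n N q} = corner_ideal {..<n} N q'"
proof -
  let ?I = "{..<n}" and ?C = "{..<n} - N" and ?p = "tensor_ideal n N q"
  let ?S = "S n :: 'k bic_ring"
  have fin: "finite ?I" by simp
  interpret L: ring_hom_ring "alg_rec ?C" "laurent_alg ?C" "lookup :: 'k laurent \<Rightarrow> _"
    by (rule lookup_hom)
  have hS: "ring_hom_ring (alg_rec ?I) ?S bic_iso" unfolding S_def by (rule bic_iso_hom)
  interpret h: ring_hom_ring "alg_rec ?I" ?S bic_iso by (rule hS)
  have surjL: "lookup ` carrier (alg_rec ?C) = carrier (laurent_alg ?C :: ((nat \<Rightarrow> int) \<Rightarrow> 'k) ring)"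
    using bij_lookup[of ?C, where 'k = 'k] by (simp add: bij_betw_def)
  have bijS: "bij_betw bic_iso (alg_on J) (carrier (bic_alg J :: 'k bic_ring))" for J by (rule bij_bic_iso)
  have surjS: "bic_iso ` carrier (alg_rec ?I) = carrier ?S"
    using bijS by (simp add: bij_betw_def S_def)
  have q': "q' \<in> LSpec ?C" using L.Spec_vimage[OF surjL q] by (simp add: q'_def)
  define P where "P = {f \<in> alg_on ?I. bic_iso f \<in> ?p}"
  have P: "P \<in> JSpec ?I" using h.Spec_vimage[OF surjS p] by (simp add: P_def)
  let ?T = "corner_ideal ?I N q'"
  have T: "?T \<in> JSpec ?I" by (rule corner_ideal_in_JSpec[OF fin N q'])
  have CN: "?C \<subseteq> - N" "?C \<subseteq> ?I" by auto
  have pi_mem: "pi_map (bic_iso b) \<in> q \<longleftrightarrow> corner N b \<in> q'" if b: "b \<in> alg_on ?C" for b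
  proof -
    have "b \<in> alg_on (- N)" using b alg_on_mono[OF CN(1)] by blast
    moreover have "corner N b \<in> alg_on (?C - N)" using b by (rule corner_in_alg_on)
    moreover have "?C - N = ?C" by auto
    ultimately show ?thesis by (simp add: pi_map_bic_iso q'_def)
  qed
  have mem_T: "b \<in> ?T" if b: "b \<in> alg_on ?C" "corner N b \<in> q'" for b
  proof -
    have bN: "b \<in> alg_on (- N)" "b \<in> alg_on ?I" using b alg_on_mono[OF CN(1)] alg_on_mono[OF CN(2)] by blast+
    have "corner N (s * b * t) \<in> q'" if "s \<in> alg_on ?I" "t \<in> alg_on ?I" for s t
      unfolding corner_mult_disjoint[OF bN(1)]
      by (rule LSpecD(4)[OF q' b(2) corner_in_alg_on]) (use that in simp)
    then show ?thesis using bN(2) unfolding corner_ideal_def by blast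
  qed
  have mem_P: "b \<in> P" if b: "b \<in> alg_on ?C" "corner N b \<in> q'" for b
  proof -
    have bI: "b \<in> alg_on ?I" using b alg_on_mono[OF CN(2)] by blast
    have one: "bic_iso 1 = (\<one>\<^bsub>?S\<^esub>)" using h.hom_one by simp
    have oneN: "bic_iso 1 \<in> carrier (bic_alg N :: 'k bic_ring)"
      using bij_betwE[OF bijS[of N]] by simp
    have bC: "bic_iso b \<in> carrier (bic_alg ?C)" using bij_betwE[OF bijS[of ?C]] b(1) by blast
    have bS: "bic_iso b \<in> carrier ?S" using h.hom_closed[of b] bI by simp
    have "finsum ?S (\<lambda>j. bic_iso 1 \<otimes>\<^bsub>?S\<^esub> bic_iso b) {..<1::nat} \<in> ?p"
      unfolding tensor_ideal_def
      by (intro CollectI exI[of _ 1] exI[of _ "\<lambda>_. bic_iso 1"] exI[of _ "\<lambda>_. bic_iso b"])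
         (use oneN bC b(2) pi_mem[OF b(1)] in simp)
    moreover have "{..<1::nat} = insert 0 {}" by auto
    ultimately have "bic_iso b \<in> ?p" using bS one by (simp add: h.S.finsum_insert)
    then show ?thesis using bI by (simp add: P_def)
  qed
  have "P \<subseteq> ?T"
  proof
    fix f assume f: "f \<in> P"
    have idT: "ideal (bic_iso ` ?T) ?S"
      using T h.ideal_image[OF _ surjS] by (simp add: Spec_def prime_ideal_def)
    interpret T: ideal "bic_iso ` ?T" ?S by (rule idT)
    obtain k a b where ab: "bic_iso f = finsum ?S (\<lambda>j. a j \<otimes>\<^bsub>?S\<^esub> b j) {..<k::nat}"
      "\<And>j. j < k \<Longrightarrow> a j \<in> carrier (bic_alg N) \<and> b j \<in> carrier (bic_alg ?C) \<and> pi_map (b j) \<in> q"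
      using f unfolding P_def tensor_ideal_def by blast
    have in_T: "a j \<otimes>\<^bsub>?S\<^esub> b j \<in> bic_iso ` ?T" if j: "j < k" for j
    proof -
      obtain b' where b': "b' \<in> alg_on ?C" "b j = bic_iso b'"
        using ab(2)[OF j] bijS[of ?C] unfolding bij_betw_def by blast
      have "b' \<in> ?T" using ab(2)[OF j] b' pi_mem[OF b'(1)] by (intro mem_T) auto
      moreover have "a j \<in> carrier ?S" using ab(2)[OF j] N by (auto simp: S_def bic_alg_def)
      ultimately show ?thesis using b'(2) T.I_l_closed by blast
    qed
    have "finsum ?S (\<lambda>j. a j \<otimes>\<^bsub>?S\<^esub> b j) {..<m} \<in> bic_iso ` ?T" if "m \<le> k" for m
      using that
    proof (induction m)
      case 0
      then show ?case using T.zero_closed by simp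
    next
      case (Suc m)
      have "(\<lambda>j. a j \<otimes>\<^bsub>?S\<^esub> b j) \<in> {..<m} \<rightarrow> carrier ?S" "a m \<otimes>\<^bsub>?S\<^esub> b m \<in> carrier ?S"
        using in_T T.Icarr Suc.prems by auto
      then have "finsum ?S (\<lambda>j. a j \<otimes>\<^bsub>?S\<^esub> b j) {..<Suc m} =
         a m \<otimes>\<^bsub>?S\<^esub> b m \<oplus>\<^bsub>?S\<^esub> finsum ?S (\<lambda>j. a j \<otimes>\<^bsub>?S\<^esub> b j) {..<m}"
        unfolding lessThan_Suc by (subst h.S.finsum_insert) auto
      also have "\<dots> \<in> bic_iso ` ?T" using in_T[of m] Suc by (intro T.a_closed) auto
      finally show ?case .
    qed
    then have "bic_iso f \<in> bic_iso ` ?T" using ab(1) by simp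
    moreover have "inj_on bic_iso (alg_on ?I :: 'k jacobson set)" using bijS[of ?I] by (simp add: bij_betw_def)
    moreover have "?T \<subseteq> alg_on ?I" "f \<in> alg_on ?I" using f by (auto simp: corner_ideal_def P_def)
    ultimately show "f \<in> ?T" by (meson inj_on_image_mem_iff)
  qed
  obtain N1 q1 where 1: "N1 \<subseteq> ?I" "q1 \<in> LSpec (?I - N1)" "P = corner_ideal ?I N1 q1"
    by (rule JSpec_cases[OF fin P])
  have "N \<subseteq> N1" "q1 \<subseteq> q'" using corner_ideal_subsetD[OF 1(1) N 1(2) q'] 1(3) \<open>P \<subseteq> ?T\<close> by blast+
  moreover have "N1 \<subseteq> N"
  proof
    fix i assume i: "i \<in> N1"
    show "i \<in> N"
    proof (rule ccontr)
      assume "i \<notin> N"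
      then have iC: "i \<in> ?C" using i 1(1) by blast
      have "corner N (idem i) = (0 :: 'k laurent)" using \<open>i \<notin> N\<close> by (simp add: corner_idem)
      then have "idem i \<in> P" using mem_P[OF idem_in_alg_on[OF iC]] LSpecD(2)[OF q'] by simp
      then show False using idem_in_corner_ideal[OF 1(1,2)] i 1(1,3) by blast
    qed
  qed
  ultimately have N1: "N1 = N" by blast
  have "q' \<subseteq> q1"
  proof
    fix l assume l: "l \<in> q'"
    then have lC: "l \<in> alg_on ?C" by (simp add: q'_def)
    have "l \<in> alg_on (- N)" using lC alg_on_mono[OF CN(1)] by blast
    then have "laurent_lift l \<in> P" using l by (intro mem_P laurent_lift_in_alg_on[OF lC]) (simp add: corner_laurent_lift)
    then show "l \<in> q1" using laurent_lift_in_corner_ideal[OF 1(1,2)] lC N1 1(3) by blast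
  qed
  then have "q1 = q'" using \<open>q1 \<subseteq> q'\<close> by blast
  then show ?thesis using 1(3) N1 by (simp add: P_def)
qed

theorem theorem4p12:
  fixes n :: nat and N :: "nat set" and q :: "((nat \<Rightarrow> int) \<Rightarrow> 'k::field) set"
  assumes "N \<subseteq> {..<n}"
    and "q \<in> Spec (laurent_alg ({..<n} - N))"
    and "tensor_ideal n N q \<in> Spec (S n)"
  shows "height (S n) (tensor_ideal n N q)
           = enat (card ({..<n} - N)) + height (laurent_alg ({..<n} - N)) q
       \<and> coheight (S n) (tensor_ideal n N q)
           = enat (2 * card N) + coheight (laurent_alg ({..<n} - N)) q
       \<and> height (S n) (tensor_ideal n N q) + coheight (S n) (tensor_ideal n N q)
           = cl_Kdim (S n :: ((nat \<Rightarrow> nat \<times> nat) \<Rightarrow> 'k) ring)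
       \<and> cl_Kdim (S n :: ((nat \<Rightarrow> nat \<times> nat) \<Rightarrow> 'k) ring) = enat (2 * n)"
proof -
  let ?I = "{..<n}" and ?C = "{..<n} - N" and ?p = "tensor_ideal n N q"
  let ?S = "S n :: ((nat \<Rightarrow> nat \<times> nat) \<Rightarrow> 'k) ring"
  let ?L = "laurent_alg ?C :: ((nat \<Rightarrow> int) \<Rightarrow> 'k) ring"
  define q' where "q' = {l \<in> alg_on ?C. lookup l \<in> q}"
  define P where "P = {f \<in> alg_on ?I. bic_iso f \<in> ?p}"
  have hL: "ring_hom_ring (alg_rec ?C) ?L lookup" by (rule lookup_hom)
  have hS: "ring_hom_ring (alg_rec ?I) ?S bic_iso" unfolding S_def by (rule bic_iso_hom)
  have bL: "lookup ` carrier (alg_rec ?C) = carrier ?L"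
    "inj_on lookup (carrier (subring_rec (alg_on ?C :: 'k laurent set)))"
    using bij_lookup[of ?C, where 'k = 'k] by (simp_all add: bij_betw_def)
  have bS: "bic_iso ` carrier (alg_rec ?I) = carrier ?S"
    "inj_on bic_iso (carrier (subring_rec (alg_on ?I :: 'k jacobson set)))"
    using bij_bic_iso[of ?I, where 'k = 'k] by (simp_all add: bij_betw_def S_def)
  have q': "q' \<in> LSpec ?C" using ring_hom_ring.Spec_vimage[OF hL bL(1) assms(2)] by (simp add: q'_def)
  have P: "P \<in> JSpec ?I" using ring_hom_ring.Spec_vimage[OF hS bS(1) assms(3)] by (simp add: P_def)
  have PT: "P = corner_ideal ?I N q'"
    unfolding P_def q'_def by (rule tensor_ideal_eq_corner_ideal[OF assms])
  define t where "t = indep_card ?C q'"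
  have t: "t \<le> card ?C" unfolding t_def by (rule indep_card_le[OF _ q']) simp
  have rkP: "jacobson_rank ?I P = 2 * card ?C - t"
    unfolding PT t_def by (rule jacobson_rank_corner_ideal[OF _ assms(1) q']) simp
  have rL: "ranked_Spec (alg_rec ?C) (card ?C) (\<lambda>q :: 'k laurent set. card ?C - indep_card ?C q)"
    by (rule ranked_LSpec) simp
  have rS: "ranked_Spec (alg_rec ?I) (2 * card ?I) (jacobson_rank ?I :: 'k jacobson set \<Rightarrow> nat)"
    by (rule ranked_JSpec) simp
  have htL: "height ?L q = enat (card ?C - t)"
    using ring_hom_ring.height_image_iso[OF hL bL assms(2)] ranked_height[OF rL q'] by (simp add: q'_def t_def)
  have chL: "coheight ?L q = enat t"
    using coheight_iso[OF hL bL(1) assms(2)] ranked_coheight[OF rL q'] t by (simp add: q'_def t_def)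
  have htS: "height ?S ?p = enat (2 * card ?C - t)"
    using ring_hom_ring.height_image_iso[OF hS bS assms(3)] ranked_height[OF rS P] rkP by (simp add: P_def)
  have chS: "coheight ?S ?p = enat (2 * n - (2 * card ?C - t))"
    using coheight_iso[OF hS bS(1) assms(3)] ranked_coheight[OF rS P] rkP by (simp add: P_def)
  have dim: "cl_Kdim ?S = enat (2 * n)"
  proof -
    \<comment> \<open>\<open>bic_iso\<close> is injective, so the kernel condition in
      \<open>cl_Kdim_image\<close> holds for every chain and disappears.\<close>
    have "a_kernel (alg_rec ?I) ?S bic_iso \<subseteq> c 0" if "prime_chain (alg_rec ?I) c k" for c k
    proof
      fix x assume "x \<in> a_kernel (alg_rec ?I) ?S bic_iso"
      then have x: "x \<in> alg_on ?I" "bic_iso x = bic_iso 0"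
        by (simp_all add: a_kernel_def' bic_iso_def S_def bic_alg_def)
      then have "x = 0" using inj_onD[OF bS(2), of x 0] by simp
      moreover have "c 0 \<in> JSpec ?I" using that by (simp add: prime_chain_def)
      ultimately show "x \<in> c 0" using JSpecD(2) by blast
    qed
    then have "cl_Kdim ?S = Sup {enat k | k. \<exists>c. prime_chain (subring_rec (alg_on ?I :: 'k jacobson set)) c k}"
      unfolding ring_hom_ring.cl_Kdim_image[OF hS bS(1)] by (metis (no_types, opaque_lifting))
    then show ?thesis using ranked_cl_Kdim[OF rS P] by simp
  qed
  have c: "card ?C + card N = n" using card_Diff_subset[OF finite_subset[OF assms(1)] assms(1)] card_mono[OF _ assms(1)] by simp
  \<comment> \<open>With \<open>t \<le> card ?C\<close> no subtraction truncates; the height of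
    \<open>q\<close> is \<open>card ?C - t\<close> and its co-height is \<open>t\<close>.\<close>
  have "2 * card ?C - t = card ?C + (card ?C - t)" "2 * n - (2 * card ?C - t) = 2 * card N + t"
    "(2 * card ?C - t) + (2 * n - (2 * card ?C - t)) = 2 * n" using c t by linarith+
  then show ?thesis unfolding htL chL htS chS dim plus_enat_simps by (simp only: simp_thms)
qed

end
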